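(* Let $n>1$ and $\hat{\mathfrak g}=\hat{\mathfrak{sl}}_n$ with standard Borel subalgebra $\hat{\mathfrak b}=\hat{\mathfrak h}\oplus\hat{\mathfrak n}_+$. A quadruple $(p,q,p',q')$ of Dyck paths of semilength $n$ has the form $\Psi(\mathfrak i)$ for some ideal $\mathfrak i$ of $\hat{\mathfrak b}$ contained in $\hat{\mathfrak n}_+$ and of level $1$ if and only if one of the following (mutually excluding) conditions is satisfied: (i) $p=q'=\mathbf p$, $q=\mathbf q$ and $\mathbf v_{(0)}(p')=1$; (ii) $p=\mathbf p$, $q=\mathbf q$, $\mathbf v_{(0)}(p')>1$ and $q'\ge\overline{p'}$; (iii) $p=\mathbf p$, $q\ne\mathbf q$, $\mathtt m(q)\subset\mathtt v_{(0)}(p')$, $q'\ge\overline{p'}$ and, additionally, $q'=\mathbf p$ if $(2,0)\notin\mathtt v_{(0)}(q)$ or $(2n-2,0)\notin\mathtt v_{(0)}(q)$; (iv) $p\ne\mathbf p$, $q\ge\overline p$, $\mathtt m(q)\cup\{(2,0),(2n-2,0)\}\subset\mathtt v_{(0)}(p')$, and $q'=\mathbf p$.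
   Context: **Affine algebra.** Let $\mathfrak g=\mathfrak{sl}_n(\mathbb C)$ with standard triangular decomposition $\mathfrak g=\mathfrak n_-\oplus\mathfrak h\oplus\mathfrak n_+$, roots $\Delta=\Delta_+\cup\Delta_-$, simple roots $\alpha_1,\dots,\alpha_{n-1}$ ($\alpha_i$ is the root of the matrix unit $e_{i,i+1}$). $\hat{\mathfrak g}=\mathfrak g\otimes\mathbb C[t,t^{-1}]\oplus\mathbb Cc\oplus\mathbb Cd$ is the untwisted affine Lie algebra (universal central extension of the loop algebra, with derivation $d$, $[d,x\otimes t^k]=k\,x\otimes t^k$), $\hat{\mathfrak h}=\mathfrak h\oplus\mathbb Cc\oplus\mathbb Cd$; $\hat{\mathfrak n}_+$ is spanned by $\mathfrak n_+\otimes1$ and all $x\otimes t^k$, $x\in\mathfrak g$, $k>0$. $\hat{\mathfrak g}_\alpha$ is a root space, $\delta$ the indivisible positive imaginary root ($\hat{\mathfrak g}_{k\delta}=\mathfrak h\otimes t^k$ for $k\neq0$), $\hat\Delta_+$ the set of roots of $\hat{\mathfrak n}_+$. **Level and the sets $\mathtt a$.** For an ideal $\mathfrak i$ of $\hat{\mathfrak b}$ contained in $\hat{\mathfrak n}_+$, $\mathrm{supp}(\mathfrak i)=\{\alpha\in\hat\Delta_+:\mathfrak i\cap\hat{\mathfrak g}_\alpha\ne0\}$; the level of a nonzero such $\mathfrak i$ is the minimal positive integer $l$ with $l\delta\in\mathrm{supp}(\mathfrak i)$. For $\mathfrak i$ of level $1$: $\mathtt a_+(\mathfrak i)=\Delta_+\cap\mathrm{supp}(\mathfrak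 i)$, $\mathtt a_-(\mathfrak i)=\{\alpha\in\Delta_-:\alpha+\delta\in\mathrm{supp}(\mathfrak i)\}$, $\mathtt a'_+(\mathfrak i)=\{\alpha\in\Delta_+:\alpha+\delta\in\mathrm{supp}(\mathfrak i)\}$, $\mathtt a'_-(\mathfrak i)=\{\alpha\in\Delta_-:\alpha+2\delta\in\mathrm{supp}(\mathfrak i)\}$. **Dyck paths.** A Dyck path of semilength $n$ is a path in the first quadrant from $(0,0)$ to $(2n,0)$ with steps $r=(1,1)$ (rises) and $f=(1,-1)$ (falls). A peak is the end point of a rise followed by a fall, a valley the end point of a fall followed by a rise; height means $y$-coordinate. Write $p\le q$ if $q$ never goes below $p$. $\mathbf p=r^nf^n$ and $\mathbf q=(rf)^n$ are the maximum and minimum paths. $\mathtt v_{(0)}(p)$ is the set of valleys of height $0$ of $p$, and $\mathbf v_{(0)}(p)=|\mathtt v_{(0)}(p)|$. $\mathcal D_n(i,j)$ is the set of Dyck paths of semilength $n$ whose first (leftmost) peak has height $i$ and last peak has height $j$; set $\mathcal D_n(0,0):=\mathcal D_n(1,1)$. For $p\in\mathcal D_n(i,j)$, $\overline p$ is the unique minimal (with respect to $\le$) path in $\mathcal D_n(n-j,n-i)$. For a Dyck path $p$, $\mathtt m(p)$ is the set of all points $(2m,0)$, $m=1,\dots,n-1$, for which $\{(2m-2,0),(2m,0),(2m+2,0)\}\setminus(\mathtt v_{(0)}(p)\cup\{(0,0),(2n,0)\})\neq\varnothing$. **The map $\Psi$.** Consider an $n\times n$ array of boxes; the box in row $a$,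 column $b$ corresponds to the root $\alpha_a+\dots+\alpha_{b-1}$ if $a<b$ and to $-(\alpha_b+\dots+\alpha_{a-1})$ if $a>b$. To $S\subset\Delta_+$ which is the set of roots of an ideal of $\mathfrak b=\mathfrak h\oplus\mathfrak n_+$ in $\mathfrak n_+$, associate the lattice path with unit east and south steps from the top-left to the bottom-right corner such that the boxes to its north-east are exactly those of $S$; reading east steps as rises and south steps as falls gives a Dyck path. To $S\subset\Delta_-$ which is the set of roots of a $\mathfrak b$-submodule of $\mathfrak g/\mathfrak b\cong\mathfrak n_-$, associate the lattice path with unit east and south steps between the same corners such that the boxes to its north-east are exactly all boxes on or above the main diagonal together with those of $S$; reading south steps as rises and east steps as falls gives a Dyck path. For $\mathfrak i$ of level $1$, $\Psi(\mathfrak i)=(p,q,p',q')$, where $p,q,p',q'$ are the Dyck paths associated in this way to $\mathtt a_+(\mathfrak i)$, $\mathtt a_-(\mathfrak i)$, $\mathtt a'_+(\mathfrak i)$, $\mathtt a'_-(\mathfrak i)$, respectively. *)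

theory Defs
  imports "HOL-Library.Function_Algebras" "Jordan_Normal_Form.Matrix"
begin

section \<open>The affine Lie algebra\<close>

text \<open>
  An element of \<open>sl\<^sub>n \<otimes> \<complex>[t, t\<^sup>-\<^sup>1] \<oplus> \<complex>c \<oplus> \<complex>d\<close> is given by the coefficients
  \<open>loop x k\<close> of \<open>t\<^sup>k\<close> and by its coordinates along \<open>c\<close> and \<open>d\<close>.
  Rows and columns of matrices are numbered from 0.
\<close>

datatype affine = Affine (loop: "int \<Rightarrow> complex mat") (c_coord: complex) (d_coord: complex)

definition mat_trace :: "complex mat \<Rightarrow> complex" where
  "mat_trace A = (\<Sum>i<dim_row A. A $$ (i, i))"

definition sl :: "nat \<Rightarrow> complex mat set" where
  "sl n = {A \<in> carrier_mat n n. mat_trace A = 0}"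

definition sl_hat :: "nat \<Rightarrow> affine set" where
  "sl_hat n = {x. (\<forall>k. loop x k \<in> sl n) \<and> finite {k. loop x k \<noteq> 0\<^sub>m n n}}"

definition tens :: "nat \<Rightarrow> complex mat \<Rightarrow> int \<Rightarrow> affine" where
  "tens n A k = Affine (\<lambda>l. if l = k then A else 0\<^sub>m n n) 0 0"

definition aff_zero :: "nat \<Rightarrow> affine" where
  "aff_zero n = Affine (\<lambda>k. 0\<^sub>m n n) 0 0"

definition aff_add :: "affine \<Rightarrow> affine \<Rightarrow> affine" where
  "aff_add x y =
     Affine (\<lambda>k. loop x k + loop y k) (c_coord x + c_coord y) (d_coord x + d_coord y)"

definition aff_scale :: "complex \<Rightarrow> affine \<Rightarrow> affine" where
  "aff_scale z x = Affine (\<lambda>k. z \<cdot>\<^sub>m loop x k) (z * c_coord x) (z * d_coord x)"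

text \<open>
  \<open>[x \<otimes> t\<^sup>k, y \<otimes> t\<^sup>l] = [x, y] \<otimes> t\<^sup>k\<^sup>+\<^sup>l + k \<delta>\<^bsub>k+l,0\<^esub> tr(xy) c\<close>,
  \<open>[d, x \<otimes> t\<^sup>k] = k x \<otimes> t\<^sup>k\<close>, \<open>c\<close> central, extended bilinearly. The sum over \<open>i\<close> is written
  entrywise because the type of matrices of all sizes is not an additive monoid.
\<close>

definition aff_bracket :: "nat \<Rightarrow> affine \<Rightarrow> affine \<Rightarrow> affine" where
  "aff_bracket n x y =
     Affine
       (\<lambda>k. mat n n (\<lambda>(r, s).
          (\<Sum>i | loop x i \<noteq> 0\<^sub>m n n.
             (loop x i * loop y (k - i) - loop y (k - i) * loop x i) $$ (r, s))
          + d_coord x * of_int k * loop y k $$ (r, s)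
          - d_coord y * of_int k * loop x k $$ (r, s)))
       (\<Sum>i | loop x i \<noteq> 0\<^sub>m n n. of_int i * mat_trace (loop x i * loop y (- i)))
       0"

definition n_pos :: "nat \<Rightarrow> complex mat set" where
  "n_pos n = {A \<in> sl n. \<forall>i<n. \<forall>j<n. j \<le> i \<longrightarrow> A $$ (i, j) = 0}"

definition n_neg :: "nat \<Rightarrow> complex mat set" where
  "n_neg n = {A \<in> sl n. \<forall>i<n. \<forall>j<n. i \<le> j \<longrightarrow> A $$ (i, j) = 0}"

definition h_hat :: "nat \<Rightarrow> affine set" where
  "h_hat n = {x \<in> sl_hat n. diagonal_mat (loop x 0) \<and> (\<forall>k. k \<noteq> 0 \<longrightarrow> loop x k = 0\<^sub>m n n)}"

definition n_hat_pos :: "nat \<Rightarrow> affine set" where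
  "n_hat_pos n = {x \<in> sl_hat n. c_coord x = 0 \<and> d_coord x = 0 \<and>
     loop x 0 \<in> n_pos n \<and> (\<forall>k<0. loop x k = 0\<^sub>m n n)}"

definition b_hat :: "nat \<Rightarrow> affine set" where
  "b_hat n = {aff_add h x | h x. h \<in> h_hat n \<and> x \<in> n_hat_pos n}"

definition is_subspace :: "nat \<Rightarrow> affine set \<Rightarrow> bool" where
  "is_subspace n V \<longleftrightarrow> aff_zero n \<in> V \<and> (\<forall>x\<in>V. \<forall>y\<in>V. aff_add x y \<in> V) \<and>
     (\<forall>z. \<forall>x\<in>V. aff_scale z x \<in> V)"

definition is_ideal_of_b_hat :: "nat \<Rightarrow> affine set \<Rightarrow> bool" where
  "is_ideal_of_b_hat n I \<longleftrightarrow> I \<subseteq> b_hat n \<and> is_subspace n I \<and>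
     (\<forall>x\<in>b_hat n. \<forall>y\<in>I. aff_bracket n x y \<in> I)"


section \<open>Roots\<close>

text \<open>
  Linear functionals on \<open>h_hat n\<close>, each extended by 0 outside \<open>h_hat n\<close> so that each functional has
  exactly one representative and pointwise addition is addition in the dual space.
\<close>

definition h_hat_dual :: "nat \<Rightarrow> (affine \<Rightarrow> complex) set" where
  "h_hat_dual n = {\<alpha>.
     (\<forall>x\<in>h_hat n. \<forall>y\<in>h_hat n. \<alpha> (aff_add x y) = \<alpha> x + \<alpha> y) \<and>
     (\<forall>z. \<forall>x\<in>h_hat n. \<alpha> (aff_scale z x) = z * \<alpha> x) \<and>
     (\<forall>x. x \<notin> h_hat n \<longrightarrow> \<alpha> x = 0)}"

definition root_space :: "nat \<Rightarrow> (affine \<Rightarrow> complex) \<Rightarrow> affine set" where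
  "root_space n \<alpha> = {x \<in> sl_hat n. \<forall>h\<in>h_hat n. aff_bracket n h x = aff_scale (\<alpha> h) x}"

definition roots_of :: "nat \<Rightarrow> affine set \<Rightarrow> (affine \<Rightarrow> complex) set" where
  "roots_of n V = {\<alpha> \<in> h_hat_dual n. \<alpha> \<noteq> 0 \<and> V \<inter> root_space n \<alpha> - {aff_zero n} \<noteq> {}}"

definition pos_roots_hat :: "nat \<Rightarrow> (affine \<Rightarrow> complex) set" where
  "pos_roots_hat n = roots_of n (n_hat_pos n)"

definition pos_roots :: "nat \<Rightarrow> (affine \<Rightarrow> complex) set" where
  "pos_roots n = roots_of n ((\<lambda>A. tens n A 0) ` n_pos n)"

definition neg_roots :: "nat \<Rightarrow> (affine \<Rightarrow> complex) set" where
  "neg_roots n = roots_of n ((\<lambda>A. tens n A 0) ` n_neg n)"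

text \<open>
  With 0-based numbering, \<open>simple_root n i\<close> for \<open>i < n - 1\<close> is the root of the matrix unit with
  entry 1 at \<open>(i, i + 1)\<close>, i.e. the root usually called \<open>\<alpha>\<^bsub>i+1\<^esub>\<close>.
\<close>

definition simple_root :: "nat \<Rightarrow> nat \<Rightarrow> affine \<Rightarrow> complex" where
  "simple_root n i =
     (\<lambda>h. if h \<in> h_hat n then loop h 0 $$ (i, i) - loop h 0 $$ (Suc i, Suc i) else 0)"

definition delta :: "nat \<Rightarrow> affine \<Rightarrow> complex" where
  "delta n = (\<lambda>h. if h \<in> h_hat n then d_coord h else 0)"

definition supp :: "nat \<Rightarrow> affine set \<Rightarrow> (affine \<Rightarrow> complex) set" where
  "supp n I = {\<alpha> \<in> pos_roots_hat n. I \<inter> root_space n \<alpha> \<noteq> {aff_zero n}}"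

definition has_level :: "nat \<Rightarrow> affine set \<Rightarrow> nat \<Rightarrow> bool" where
  "has_level n I l \<longleftrightarrow> I \<noteq> {aff_zero n} \<and> 0 < l \<and>
     (\<lambda>h. of_nat l * delta n h) \<in> supp n I \<and>
     (\<forall>m. 0 < m \<and> (\<lambda>h. of_nat m * delta n h) \<in> supp n I \<longrightarrow> l \<le> m)"

definition a_pos :: "nat \<Rightarrow> affine set \<Rightarrow> (affine \<Rightarrow> complex) set" where
  "a_pos n I = pos_roots n \<inter> supp n I"

definition a_neg :: "nat \<Rightarrow> affine set \<Rightarrow> (affine \<Rightarrow> complex) set" where
  "a_neg n I = {\<alpha> \<in> neg_roots n. \<alpha> + delta n \<in> supp n I}"

definition a_pos' :: "nat \<Rightarrow> affine set \<Rightarrow> (affine \<Rightarrow> complex) set" where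
  "a_pos' n I = {\<alpha> \<in> pos_roots n. \<alpha> + delta n \<in> supp n I}"

definition a_neg' :: "nat \<Rightarrow> affine set \<Rightarrow> (affine \<Rightarrow> complex) set" where
  "a_neg' n I = {\<alpha> \<in> neg_roots n. \<alpha> + delta n + delta n \<in> supp n I}"


section \<open>Dyck paths\<close>

datatype step = Rise | Fall

definition height :: "step list \<Rightarrow> nat \<Rightarrow> int" where
  "height p x = (\<Sum>s\<leftarrow>take x p. case s of Rise \<Rightarrow> 1 | Fall \<Rightarrow> - 1)"

definition dyck_paths :: "nat \<Rightarrow> step list set" where
  "dyck_paths n = {p. length p = 2 * n \<and> (\<forall>x\<le>2 * n. 0 \<le> height p x) \<and> height p (2 * n) = 0}"

definition peaks :: "step list \<Rightarrow> (nat \<times> int) set" where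
  "peaks p = {(Suc x, height p (Suc x)) | x.
     Suc x < length p \<and> p ! x = Rise \<and> p ! Suc x = Fall}"

definition valleys :: "step list \<Rightarrow> (nat \<times> int) set" where
  "valleys p = {(Suc x, height p (Suc x)) | x.
     Suc x < length p \<and> p ! x = Fall \<and> p ! Suc x = Rise}"

definition path_le :: "step list \<Rightarrow> step list \<Rightarrow> bool" where
  "path_le p q \<longleftrightarrow> length p = length q \<and> (\<forall>x\<le>length p. height p x \<le> height q x)"

definition max_path :: "nat \<Rightarrow> step list" where
  "max_path n = replicate n Rise @ replicate n Fall"

definition min_path :: "nat \<Rightarrow> step list" where
  "min_path n = concat (replicate n [Rise, Fall])"

definition zero_valleys :: "step list \<Rightarrow> (nat \<times> int) set" where
  "zero_valleys p = {v \<in> valleys p. snd v = 0}"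

definition first_peak_height :: "step list \<Rightarrow> int" where
  "first_peak_height p = height p (Min (fst ` peaks p))"

definition last_peak_height :: "step list \<Rightarrow> int" where
  "last_peak_height p = height p (Max (fst ` peaks p))"

definition dyck_paths_ij :: "nat \<Rightarrow> int \<Rightarrow> int \<Rightarrow> step list set" where
  "dyck_paths_ij n i j = (let (i', j') = (if i = 0 \<and> j = 0 then (1, 1) else (i, j)) in
     {p \<in> dyck_paths n. first_peak_height p = i' \<and> last_peak_height p = j'})"

text \<open>
  Here \<open>(i, j)\<close> is always the pair of actual peak heights of \<open>p\<close>; the convention
  \<open>\<D>\<^sub>n(0,0) = \<D>\<^sub>n(1,1)\<close> only affects the target set, namely for \<open>p = max_path n\<close>.
\<close>

definition bar_path :: "nat \<Rightarrow> step list \<Rightarrow> step list" where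
  "bar_path n p =
     (let D = dyck_paths_ij n (int n - last_peak_height p) (int n - first_peak_height p)
      in THE r. r \<in> D \<and> (\<forall>s\<in>D. path_le s r \<longrightarrow> s = r))"

definition m_set :: "nat \<Rightarrow> step list \<Rightarrow> (nat \<times> int) set" where
  "m_set n p = {(2 * m, 0) | m. 1 \<le> m \<and> m \<le> n - 1 \<and>
     {(2 * m - 2, 0), (2 * m, 0), (2 * m + 2, 0)} - (zero_valleys p \<union> {(0, 0), (2 * n, 0)}) \<noteq> {}}"


section \<open>From ideals to quadruples of Dyck paths\<close>

definition box_root :: "nat \<Rightarrow> nat \<times> nat \<Rightarrow> affine \<Rightarrow> complex" where
  "box_root n = (\<lambda>(a, b).
     if a < b then (\<Sum>i\<in>{a..<b}. simple_root n i) else - (\<Sum>i\<in>{b..<a}. simple_root n i))"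

datatype lattice_step = East | South

definition lattice_paths :: "nat \<Rightarrow> lattice_step list set" where
  "lattice_paths n = {w. count_list w East = n \<and> count_list w South = n}"

text \<open>
  Row \<open>a\<close> counts from the top and column \<open>b\<close> from the left, both from 0. Box \<open>(a, b)\<close> is
  north-east of the path iff the east step crossing column \<open>b\<close> runs below it, i.e. is preceded
  by more than \<open>a\<close> south steps.
\<close>

definition boxes_north_east :: "lattice_step list \<Rightarrow> (nat \<times> nat) set" where
  "boxes_north_east w = {(a, b). \<exists>x<length w. w ! x = East \<and>
     count_list (take x w) East = b \<and> a < count_list (take x w) South}"

definition boxes_of_roots :: "nat \<Rightarrow> (affine \<Rightarrow> complex) set \<Rightarrow> (nat \<times> nat) set" where
  "boxes_of_roots n S = {(a, b). a < n \<and> b < n \<and> a \<noteq> b \<and> box_root n (a, b) \<in> S}"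

definition path_of_boxes :: "nat \<Rightarrow> (nat \<times> nat) set \<Rightarrow> lattice_step list" where
  "path_of_boxes n B = (THE w. w \<in> lattice_paths n \<and> boxes_north_east w = B)"

definition dyck_of_pos :: "nat \<Rightarrow> (affine \<Rightarrow> complex) set \<Rightarrow> step list" where
  "dyck_of_pos n S = map (\<lambda>s. case s of East \<Rightarrow> Rise | South \<Rightarrow> Fall)
     (path_of_boxes n (boxes_of_roots n S))"

definition dyck_of_neg :: "nat \<Rightarrow> (affine \<Rightarrow> complex) set \<Rightarrow> step list" where
  "dyck_of_neg n S = map (\<lambda>s. case s of South \<Rightarrow> Rise | East \<Rightarrow> Fall)
     (path_of_boxes n ({(a, b). a \<le> b \<and> b < n} \<union> boxes_of_roots n S))"

definition Psi :: "nat \<Rightarrow> affine set \<Rightarrow> step list \<times> step list \<times> step list \<times> step list" where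
  "Psi n I = (dyck_of_pos n (a_pos n I), dyck_of_neg n (a_neg n I),
              dyck_of_pos n (a_pos' n I), dyck_of_neg n (a_neg' n I))"


section \<open>The four conditions\<close>

definition cond_i ::
  "nat \<Rightarrow> step list \<Rightarrow> step list \<Rightarrow> step list \<Rightarrow> step list \<Rightarrow> bool" where
  "cond_i n p q p' q' \<longleftrightarrow>
     p = max_path n \<and> q' = max_path n \<and> q = min_path n \<and> card (zero_valleys p') = 1"

definition cond_ii ::
  "nat \<Rightarrow> step list \<Rightarrow> step list \<Rightarrow> step list \<Rightarrow> step list \<Rightarrow> bool" where
  "cond_ii n p q p' q' \<longleftrightarrow>
     p = max_path n \<and> q = min_path n \<and> 1 < card (zero_valleys p') \<and> path_le (bar_path n p') q'"

definition cond_iii ::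
  "nat \<Rightarrow> step list \<Rightarrow> step list \<Rightarrow> step list \<Rightarrow> step list \<Rightarrow> bool" where
  "cond_iii n p q p' q' \<longleftrightarrow>
     p = max_path n \<and> q \<noteq> min_path n \<and> m_set n q \<subseteq> zero_valleys p' \<and>
     path_le (bar_path n p') q' \<and>
     ((2, 0) \<notin> zero_valleys q \<or> (2 * n - 2, 0) \<notin> zero_valleys q \<longrightarrow> q' = max_path n)"

definition cond_iv ::
  "nat \<Rightarrow> step list \<Rightarrow> step list \<Rightarrow> step list \<Rightarrow> step list \<Rightarrow> bool" where
  "cond_iv n p q p' q' \<longleftrightarrow>
     p \<noteq> max_path n \<and> path_le (bar_path n p) q \<and>
     m_set n q \<union> {(2, 0), (2 * n - 2, 0)} \<subseteq> zero_valleys p' \<and> q' = max_path n"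

end

theory Submission
  imports Defs
begin

text \<open>
  An ideal \<open>I\<close> enters only through the matrix units \<open>E\<^sub>a\<^sub>b \<otimes> t\<^sup>k\<close> with \<open>k \<le> 2\<close> which it contains and through
  \<open>V = I \<inter> h \<otimes> t\<close>. Acting with finite simple root vectors makes the four sets of boxes staircases.
  Acting with the affine one, \<open>E\<^sub>n\<^sub>1 \<otimes> t\<close>, turns boxes in the first row (last column) of \<open>p\<close> into boxes in the
  last row (first column) of \<open>q\<close>, which is the inequality \<open>path_le (bar_path n p) q\<close>, and likewise
  for \<open>p'\<close> and \<open>q'\<close>. A negative simple root in \<open>q\<close> puts its coroot into \<open>V\<close>, and any root in \<open>p\<close> puts
  the highest coroot there. Finally an element of \<open>V\<close> on which a simple root does not vanish gives that
  simple root in \<open>p'\<close>, and the highest root not vanishing on it forces \<open>q'\<close> to be maximal.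

  Conversely, when these conditions hold, all equations that they force on \<open>V\<close>, \<open>\<alpha>\<^sub>i = 0\<close> for every
  simple root missing in \<open>p'\<close> and \<open>\<theta> = 0\<close> unless \<open>q'\<close> is maximal, together with the given boxes cut out
  an ideal, as one sees entry by entry. The four cases of the theorem
  tell when \<open>V \<noteq> 0\<close>: the simple roots are coordinates on \<open>h\<close> and \<open>\<theta>\<close> is their sum, so a single
  coordinate suffices iff \<open>\<theta>\<close> is unrestricted, and two always do.
\<close>

subsection \<open>Lattice paths as height functions\<close>

text \<open>The boxes do not determine the Cartan part \<open>V\<close> in degree 1: it lies between
  the span of the coroots that brackets force into it and the common kernel of the roots that it
  must annihilate. The construction takes the kernel, so that the only remaining question is whether
  the kernel is nonzero. Its stability then needs no list of coroots. Apart from rescaling by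
  \<open>d\<close>, a bracket has a nonzero diagonal entry in degree 1 at position \<open>r\<close>
  only if \<open>r\<close> is \<open>good\<close>, whereas \<open>alpha_i = 0\<close> is imposed
  only when neither end of that simple root is good, and \<open>theta = 0\<close> only when neither
  \<open>0\<close> nor \<open>n - 1\<close> is good.

  Comparison with \<open>bar_path n p\<close> concerns two numbers only: the first peak of one path
  and the last peak of the other have heights adding up to at least \<open>n\<close>, for both
  pairings. These heights tell where the first row and last column of \<open>p\<close> begin, and
  how far the last row and first column of \<open>q\<close> reach. This is why the affine simple
  root yields exactly that inequality.\<close>

lemma height_0 [simp]: "height p 0 = 0"
  by (simp add: height_def)

lemma height_Suc:
  "x < length p \<Longrightarrow> height p (Suc x) = height p x + (if p ! x = Rise then 1 else - 1)"
  by (simp add: height_def take_Suc_conv_app_nth split: step.splits)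

lemma even_height: "x \<le> length p \<Longrightarrow> even (height p x - int x)"
  by (induction x) (auto simp: height_Suc)

lemma height_lipschitz:
  assumes "x \<le> y" "y \<le> length p"
  shows "\<bar>height p y - height p x\<bar> \<le> int y - int x"
  using assms
proof (induction y rule: dec_induct)
  case (step m)
  then show ?case by (auto simp: height_Suc)
qed simp

lemma path_eqI_height:
  assumes "length p = length q" "\<And>x. x \<le> length p \<Longrightarrow> height p x = height q x"
  shows "p = q"
proof (rule nth_equalityI)
  fix x assume x: "x < length p"
  have "height p (Suc x) = height q (Suc x)" "height p x = height q x"
    using x assms(2) by auto
  then show "p ! x = q ! x"
    using x assms(1) by (cases "p ! x"; cases "q ! x") (auto simp: height_Suc)
qed (fact assms(1))

lemma path_of_height:
  assumes "h 0 = 0" "\<And>x. x < N \<Longrightarrow> h (Suc x) = h x + 1 \<or> h (Suc x) = h x - (1::int)"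
  obtains p where "length p = N" "\<And>x. x \<le> N \<Longrightarrow> height p x = h x"
proof
  let ?p = "map (\<lambda>x. if h x < h (Suc x) then Rise else Fall) [0..<N]"
  show "length ?p = N" by simp
  fix x assume "x \<le> N"
  then show "height ?p x = h x"
  proof (induction x)
    case (Suc x)
    then show ?case using assms(2)[of x] by (auto simp: height_Suc)
  qed (simp add: assms(1))
qed

text \<open>Nonnegativity is left out because the two readings of a lattice path differ by
  exchanging rises and falls, which negates all heights. The correspondence between paths and
  staircases of boxes uses the end points only.\<close>

definition balanced_paths :: "nat \<Rightarrow> step list set" where
  "balanced_paths n = {p. length p = 2 * n \<and> height p (2 * n) = 0}"

lemma dyck_balanced: "p \<in> dyck_paths n \<Longrightarrow> p \<in> balanced_paths n"
  by (simp add: dyck_paths_def balanced_paths_def)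

text \<open>
  A lattice path has the box \<open>(a, b)\<close> to its north-east iff its point after \<open>a + b + 1\<close> steps lies
  weakly south-west of the south-west corner of that box.
\<close>

definition pos_boxes :: "nat \<Rightarrow> step list \<Rightarrow> (nat \<times> nat) set" where
  "pos_boxes n p = {(a, b). a < n \<and> b < n \<and> height p (a + b + 1) \<le> int b - int a - 1}"

definition neg_boxes :: "nat \<Rightarrow> step list \<Rightarrow> (nat \<times> nat) set" where
  "neg_boxes n p = {(a, b). a < n \<and> b < n \<and> int a - int b + 1 \<le> height p (a + b + 1)}"

text \<open>Order filters of the array with the north-east corner on top. They are exactly the box
  sets cut off by lattice paths, by \<open>up_closed_pos_boxes\<close> and
  \<open>pos_boxes_surj\<close>.\<close>

definition up_closed :: "nat \<Rightarrow> (nat \<times> nat) set \<Rightarrow> bool" where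
  "up_closed n B \<longleftrightarrow> B \<subseteq> {..<n} \<times> {..<n} \<and>
     (\<forall>a b a' b'. (a, b) \<in> B \<and> a' \<le> a \<and> b \<le> b' \<and> b' < n \<longrightarrow> (a', b') \<in> B)"

lemma up_closedD:
  "up_closed n B \<Longrightarrow> (a, b) \<in> B \<Longrightarrow> a' \<le> a \<Longrightarrow> b \<le> b' \<Longrightarrow> b' < n \<Longrightarrow> (a', b') \<in> B"
  unfolding up_closed_def by blast

text \<open>One step north or east shifts the point of the path being tested by one and raises the
  bound by one, so the Lipschitz property of heights is enough.\<close>

lemma up_closed_pos_boxes:
  assumes "p \<in> balanced_paths n"
  shows "up_closed n (pos_boxes n p)"
  unfolding up_closed_def
proof (intro conjI allI impI)
  fix a b a' b' assume *: "(a, b) \<in> pos_boxes n p \<and> a' \<le> a \<and> b \<le> b' \<and> b' < n"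
  have l: "length p = 2 * n" using assms by (simp add: balanced_paths_def)
  have "\<bar>height p (a + b + 1) - height p (a' + b + 1)\<bar> \<le> int (a + b + 1) - int (a' + b + 1)"
    using * by (intro height_lipschitz) (auto simp: l pos_boxes_def)
  moreover have "\<bar>height p (a' + b' + 1) - height p (a' + b + 1)\<bar> \<le> int (a' + b' + 1) - int (a' + b + 1)"
    using * by (intro height_lipschitz) (auto simp: l pos_boxes_def)
  ultimately show "(a', b') \<in> pos_boxes n p"
    using * by (auto simp: pos_boxes_def)
qed (auto simp: pos_boxes_def)

text \<open>If \<open>r\<close> were higher than \<open>p\<close> at \<open>x\<close>, it would have
  made \<open>j\<close> falls there and \<open>p\<close> some \<open>i > j\<close>. The box in row
  \<open>j\<close> on the antidiagonal of \<open>x\<close> then belongs to \<open>p\<close> but not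
  to \<open>r\<close>.\<close>

lemma pos_boxes_le:
  assumes "p \<in> balanced_paths n" "r \<in> balanced_paths n" "pos_boxes n p \<subseteq> pos_boxes n r"
    and x: "x \<le> 2 * n"
  shows "height r x \<le> height p x"
proof (rule ccontr)
  assume neg: "\<not> ?thesis"
  have l: "length p = 2 * n" "length r = 2 * n" "height p (2 * n) = 0" "height r (2 * n) = 0"
    using assms by (auto simp: balanced_paths_def)
  have b: "\<bar>height p x\<bar> \<le> int x" "\<bar>height r x\<bar> \<le> int x"
    "\<bar>height p x\<bar> \<le> 2 * int n - int x" "\<bar>height r x\<bar> \<le> 2 * int n - int x"
    using height_lipschitz[of 0 x p] height_lipschitz[of 0 x r]
      height_lipschitz[of x "2 * n" p] height_lipschitz[of x "2 * n" r] x l by auto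
  have "even (height p x - int x)" "even (height r x - int x)"
    using even_height x l by auto
  then obtain i' j' where "height p x - int x = 2 * i'" "height r x - int x = 2 * j'"
    by (elim evenE) blast
  then have "height p x = int x - 2 * (- i')" "height r x = int x - 2 * (- j')" by auto
  then obtain i j where ij: "height p x = int x - 2 * i" "height r x = int x - 2 * j" by blast
  have j: "0 \<le> j" "j < i" "i \<le> int x" "i \<le> int n" "int x - j \<le> int n"
    using neg b ij by auto
  have e: "nat j + (x - 1 - nat j) + 1 = x" "x - 1 - nat j < n" "nat j < n" "nat j < x"
    using j by auto
  have "(nat j, x - 1 - nat j) \<in> pos_boxes n p"
    unfolding pos_boxes_def using e j ij(1) by (auto simp: of_nat_diff)
  then have "(nat j, x - 1 - nat j) \<in> pos_boxes n r" using assms by auto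
  then show False
    unfolding pos_boxes_def using e j ij(2) by (auto simp: of_nat_diff)
qed

lemma pos_boxes_inj:
  assumes "p \<in> balanced_paths n" "r \<in> balanced_paths n" "pos_boxes n p = pos_boxes n r"
  shows "p = r"
  using assms by (intro path_eqI_height) (auto simp: balanced_paths_def intro!: antisym pos_boxes_le)

lemma pos_boxes_surj:
  assumes B: "up_closed n B"
  obtains p where "p \<in> balanced_paths n" "pos_boxes n p = B"
proof -
  \<comment> \<open>\<open>D x\<close> will be an initial segment of the rows; its size is the number of south steps among the
    first \<open>x\<close> steps of the path.\<close>
  define D where "D x = {a. a < n \<and> a < x \<and> (n \<le> x - 1 - a \<or> (a, x - 1 - a) \<in> B)}" for x
  have fin: "finite (D x)" for x by (simp add: D_def)
  have up: "(a', b') \<in> B" if "(a, b) \<in> B" "a' \<le> a" "b \<le> b'" "b' < n" for a b a' b'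
    using B that unfolding up_closed_def by blast
  have down: "a' \<in> D x" if "a \<in> D x" "a' \<le> a" for a a' x
  proof (cases "n \<le> x - 1 - a'")
    case False
    then have "(a, x - 1 - a) \<in> B" using that unfolding D_def by auto
    then show ?thesis
      using that up[of a "x - 1 - a" a' "x - 1 - a'"] False diff_le_mono2[of a' a "x - 1"]
      by (simp add: D_def not_le)
  qed (use that in \<open>auto simp: D_def\<close>)
  have lt: "D x = {..<card (D x)}" for x
  proof -
    obtain k where "D x = {..<k}"
    proof (cases "D x = {}")
      case False
      have "D x = {..<Suc (Max (D x))}"
        using down[OF Max_in[OF fin False]] Max_ge[OF fin] by (auto simp only: less_Suc_eq_le lessThan_iff)
      then show ?thesis by (rule that)
    next
      case True
      then show ?thesis by (intro that[of 0]) auto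
    qed
    then show ?thesis by simp
  qed
  have sub: "D x \<subseteq> D (Suc x)" for x
  proof
    fix a assume a: "a \<in> D x"
    show "a \<in> D (Suc x)"
    proof (cases "n \<le> x - a")
      case False
      then have "(a, x - 1 - a) \<in> B" using a unfolding D_def by auto
      then have "(a, x - a) \<in> B" using up[of a "x - 1 - a" a "x - a"] False by auto
      then show ?thesis using a unfolding D_def by auto
    qed (use a in \<open>auto simp: D_def\<close>)
  qed
  have pred: "a \<in> D x" if "Suc a \<in> D (Suc x)" for a x
  proof -
    have *: "Suc a < n" "a < x" "n \<le> x - 1 - a \<or> (Suc a, x - 1 - a) \<in> B"
      using that unfolding D_def by auto
    then have "(a, x - 1 - a) \<in> B" if "\<not> n \<le> x - 1 - a"
      using that up[of "Suc a" "x - 1 - a" a "x - 1 - a"] by auto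
    then show ?thesis using * unfolding D_def by auto
  qed
  have step: "card (D (Suc x)) = card (D x) \<or> card (D (Suc x)) = Suc (card (D x))" for x
  proof -
    have "card (D x) \<le> card (D (Suc x))" using sub fin by (intro card_mono)
    moreover have "card (D (Suc x)) \<le> Suc (card (D x))"
    proof (rule ccontr)
      assume "\<not> ?thesis"
      then have "Suc (card (D x)) \<in> D (Suc x)" by (subst lt) auto
      then have "card (D x) \<in> D x" by (rule pred)
      then show False using lt[of x] by auto
    qed
    ultimately show ?thesis by auto
  qed
  obtain p where p: "length p = 2 * n"
    "\<And>x. x \<le> 2 * n \<Longrightarrow> height p x = int x - 2 * int (card (D x))"
  proof (rule path_of_height[of "\<lambda>x. int x - 2 * int (card (D x))" "2 * n"])
    show "int 0 - 2 * int (card (D 0)) = 0" by (simp add: D_def)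
  next
    fix x show "int (Suc x) - 2 * int (card (D (Suc x))) = int x - 2 * int (card (D x)) + 1 \<or>
          int (Suc x) - 2 * int (card (D (Suc x))) = int x - 2 * int (card (D x)) - 1"
      using step[of x] by auto
  qed blast
  \<comment> \<open>Positions past the right edge count as boxes of \<open>B\<close> in
    \<open>D\<close>; hence every row has been collected at the end.\<close>
  have "D (2 * n) = {..<n}" by (auto simp: D_def)
  then have bal: "p \<in> balanced_paths n" using p by (simp add: balanced_paths_def)
  have "(a, b) \<in> pos_boxes n p \<longleftrightarrow> (a, b) \<in> B" for a b
  proof (cases "a < n \<and> b < n")
    case True
    have "(a, b) \<in> pos_boxes n p \<longleftrightarrow> a < card (D (a + b + 1))"
      using True p(2)[of "a + b + 1"] by (auto simp: pos_boxes_def)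
    also have "\<dots> \<longleftrightarrow> a \<in> D (a + b + 1)" using lt[of "a + b + 1"] by blast
    also have "\<dots> \<longleftrightarrow> (a, b) \<in> B" using True by (auto simp: D_def)
    finally show ?thesis .
  qed (use B in \<open>auto simp: pos_boxes_def up_closed_def\<close>)
  then have "pos_boxes n p = B" by (simp only: set_eq_iff split_paired_All) blast
  with bal show thesis by (rule that)
qed

section \<open>Words in East and South steps, and their two readings as rises and falls\<close>

lemma count_take_Suc:
  "x < length w \<Longrightarrow> count_list (take (Suc x) w) s = count_list (take x w) s + (if w ! x = s then 1 else 0)"
  by (simp add: take_Suc_conv_app_nth)

lemma count_East_South: "x \<le> length w \<Longrightarrow> count_list (take x w) East + count_list (take x w) South = x"
proof (induction x)
  case (Suc x)
  then show ?case using lattice_step.exhaust[of "w ! x"] by (auto simp: count_take_Suc)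
qed simp

lemma count_take_mono: "x \<le> y \<Longrightarrow> count_list (take x w) s \<le> count_list (take y w) s"
  by (metis count_list_append le_add1 le_add_diff_inverse take_add)

abbreviation "east_rise \<equiv> map (\<lambda>s. case s of East \<Rightarrow> Rise | South \<Rightarrow> Fall)"
abbreviation "south_rise \<equiv> map (\<lambda>s. case s of South \<Rightarrow> Rise | East \<Rightarrow> Fall)"

lemma height_east_rise:
  "x \<le> length w \<Longrightarrow>
     height (east_rise w) x = int (count_list (take x w) East) - int (count_list (take x w) South)"
proof (induction x)
  case (Suc x)
  then show ?case by (cases "w ! x") (auto simp: height_Suc count_take_Suc)
qed simp

lemma height_south_rise:
  "x \<le> length w \<Longrightarrow> height (south_rise w) x = - height (east_rise w) x"
  by (induction x) (auto simp: height_Suc split: lattice_step.splits)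

lemma length_lattice: "w \<in> lattice_paths n \<Longrightarrow> length w = 2 * n"
  using count_East_South[of "length w" w] by (auto simp: lattice_paths_def)

lemma east_rise_balanced: "w \<in> lattice_paths n \<Longrightarrow> east_rise w \<in> balanced_paths n"
  using length_lattice[of w n] height_east_rise[of "2 * n" w]
  by (auto simp: balanced_paths_def lattice_paths_def)

text \<open>Among the first \<open>a + b + 1\<close> steps there are more than \<open>a\<close>
  south steps iff there are at most \<open>b\<close> east steps. So at that moment the path is
  already below row \<open>a\<close> and has not yet crossed column \<open>b\<close>, which is the
  condition at the crossing step.\<close>

lemma boxes_north_east_eq:
  assumes w: "w \<in> lattice_paths n"
  shows "boxes_north_east w = pos_boxes n (east_rise w)"
proof -
  have l: "length w = 2 * n" and cE: "count_list w East = n" and cS: "count_list w South = n"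
    using w length_lattice by (auto simp: lattice_paths_def)
  have *: "(a, b) \<in> pos_boxes n (east_rise w) \<longleftrightarrow>
      a < n \<and> b < n \<and> a < count_list (take (a + b + 1) w) South" for a b
    using height_east_rise[of "a + b + 1" w] count_East_South[of "a + b + 1" w] l
    by (auto simp: pos_boxes_def)
  have "(a, b) \<in> boxes_north_east w \<longleftrightarrow> (a, b) \<in> pos_boxes n (east_rise w)" for a b
  proof
    assume "(a, b) \<in> boxes_north_east w"
    then obtain x where x: "x < length w" "w ! x = East" "count_list (take x w) East = b"
      "a < count_list (take x w) South"
      by (auto simp: boxes_north_east_def)
    have "a + b + 1 \<le> x" using count_East_South[of x w] x by auto
    then have "count_list (take (a + b + 1) w) East \<le> b"
      using count_take_mono[of "a + b + 1" x w East] x by auto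
    then have 1: "a < count_list (take (a + b + 1) w) South"
      using count_East_South[of "a + b + 1" w] \<open>a + b + 1 \<le> x\<close> x by auto
    have "a < n" using x(4) cS count_take_mono[of x "length w" w South] x(1) by auto
    moreover have "b < n"
      using count_take_mono[of "Suc x" "length w" w East] x cE by (auto simp: count_take_Suc)
    ultimately show "(a, b) \<in> pos_boxes n (east_rise w)" using * 1 by blast
  next
    assume "(a, b) \<in> pos_boxes n (east_rise w)"
    then have ab: "a < n" "b < n" "a < count_list (take (a + b + 1) w) South" using * by auto
    \<comment> \<open>The last of the first \<open>x\<close> steps is the east step that crosses
      column \<open>b\<close>.\<close>
    define x where "x = (LEAST x. b < count_list (take x w) East)"
    have ex: "b < count_list (take (length w) w) East" using ab cE by auto
    then have xl: "x \<le> length w" unfolding x_def by (rule Least_le)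
    have b: "b < count_list (take x w) East" unfolding x_def by (rule LeastI, rule ex)
    then obtain y where y: "x = Suc y" by (cases x) auto
    have "\<not> b < count_list (take y w) East" using not_less_Least[of y "\<lambda>x. b < count_list (take x w) East"] y
      unfolding x_def by auto
    then have y2: "w ! y = East" "count_list (take y w) East = b"
      using b y xl by (auto simp: count_take_Suc split: if_splits)
    have "a + b + 1 \<le> y"
    proof (rule ccontr)
      assume "\<not> ?thesis"
      then have "Suc y \<le> a + b + 1" by auto
      then have "b < count_list (take (a + b + 1) w) East"
        using count_take_mono[of "Suc y" "a + b + 1" w East] b y by auto
      then show False using ab count_East_South[of "a + b + 1" w] l by auto
    qed
    then have "a < count_list (take y w) South" using count_take_mono[of "a + b + 1" y w South] ab by auto
    then show "(a, b) \<in> boxes_north_east w"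
      unfolding boxes_north_east_def mem_Collect_eq prod.case using y2 y xl by (intro exI[of _ y]) auto
  qed
  then show ?thesis by (simp only: set_eq_iff split_paired_All) blast
qed

lemma balanced_east_rise:
  assumes "p \<in> balanced_paths n"
  obtains w where "w \<in> lattice_paths n" "east_rise w = p"
proof
  let ?w = "map (\<lambda>s. case s of Rise \<Rightarrow> East | Fall \<Rightarrow> South) p"
  show e: "east_rise ?w = p" by (induction p) (auto split: step.splits)
  have "length ?w = 2 * n" using assms by (simp add: balanced_paths_def)
  then show "?w \<in> lattice_paths n"
    using height_east_rise[of "2 * n" ?w] count_East_South[of "2 * n" ?w] assms
    unfolding e balanced_paths_def lattice_paths_def by auto
qed

lemma path_of_boxes:
  assumes "p \<in> balanced_paths n"
  shows "path_of_boxes n (pos_boxes n p) \<in> lattice_paths n"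
    and "east_rise (path_of_boxes n (pos_boxes n p)) = p"
proof -
  obtain w where w: "w \<in> lattice_paths n" "east_rise w = p" using balanced_east_rise[OF assms] .
  have inj: "v = w" if "v \<in> lattice_paths n" "boxes_north_east v = pos_boxes n p" for v
  proof -
    have "east_rise v = east_rise w"
      using that w boxes_north_east_eq[OF that(1)]
      by (intro pos_boxes_inj[of _ n] east_rise_balanced) simp_all
    moreover have "inj (\<lambda>s. case s of East \<Rightarrow> Rise | South \<Rightarrow> Fall)"
      by (auto simp: inj_def split: lattice_step.splits)
    ultimately show ?thesis by (metis inj_map_eq_map)
  qed
  have "path_of_boxes n (pos_boxes n p) = w"
    unfolding path_of_boxes_def
  proof (rule the_equality)
    show "w \<in> lattice_paths n \<and> boxes_north_east w = pos_boxes n p"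
      using boxes_north_east_eq[OF w(1)] w by simp
  qed (use inj in blast)
  with w show "path_of_boxes n (pos_boxes n p) \<in> lattice_paths n"
    "east_rise (path_of_boxes n (pos_boxes n p)) = p" by simp_all
qed

lemma neg_boxes_south_rise:
  "w \<in> lattice_paths n \<Longrightarrow> neg_boxes n (south_rise w) = pos_boxes n (east_rise w)"
  using length_lattice[of w n] height_south_rise[of _ w] by (auto simp: neg_boxes_def pos_boxes_def)

lemma dyck_of_pos_iff:
  assumes "up_closed n (boxes_of_roots n S)" "p \<in> balanced_paths n"
  shows "dyck_of_pos n S = p \<longleftrightarrow> boxes_of_roots n S = pos_boxes n p"
proof -
  obtain r where r: "r \<in> balanced_paths n" "pos_boxes n r = boxes_of_roots n S"
    using pos_boxes_surj[OF assms(1)] .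
  have "dyck_of_pos n S = r" unfolding dyck_of_pos_def r(2)[symmetric] using path_of_boxes[OF r(1)] by simp
  then show ?thesis using r(2) pos_boxes_inj[OF r(1) assms(2)] by metis
qed

lemma dyck_of_neg_iff:
  assumes "up_closed n ({(a, b). a \<le> b \<and> b < n} \<union> boxes_of_roots n S)" "p \<in> balanced_paths n"
  shows "dyck_of_neg n S = p \<longleftrightarrow> {(a, b). a \<le> b \<and> b < n} \<union> boxes_of_roots n S = neg_boxes n p"
proof -
  obtain r where r: "r \<in> balanced_paths n"
    "pos_boxes n r = {(a, b). a \<le> b \<and> b < n} \<union> boxes_of_roots n S"
    using pos_boxes_surj[OF assms(1)] .
  define w where "w = path_of_boxes n (pos_boxes n r)"
  have w: "w \<in> lattice_paths n" "east_rise w = r" using path_of_boxes[OF r(1)] by (auto simp: w_def)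
  have d: "dyck_of_neg n S = south_rise w" unfolding dyck_of_neg_def r(2)[symmetric] w_def by simp
  have nb: "neg_boxes n (south_rise w) = pos_boxes n r" using neg_boxes_south_rise[OF w(1)] w by simp
  have inj: "neg_boxes n (south_rise w) = neg_boxes n p \<Longrightarrow> south_rise w = p"
  proof -
    assume eq: "neg_boxes n (south_rise w) = neg_boxes n p"
    \<comment> \<open>Exchanging rises and falls turns \<open>neg_boxes\<close> into
      \<open>pos_boxes\<close>, so that injectivity of the latter can be used.\<close>
    define flip where "flip = map (\<lambda>s. case s of Rise \<Rightarrow> Fall | Fall \<Rightarrow> Rise)"
    have len: "length (flip u) = length u" for u by (simp add: flip_def)
    have hflip: "x \<le> length u \<Longrightarrow> height (flip u) x = - height u x" for u x
      by (induction x) (auto simp: flip_def height_Suc split: step.splits)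
    have ff: "flip (flip u) = u" for u
      by (induction u) (auto simp: flip_def split: step.splits)
    note flip = hflip ff len
    have "length p = 2 * n" using assms by (simp add: balanced_paths_def)
    then have "pos_boxes n (flip p) = neg_boxes n p"
      by (auto simp: pos_boxes_def neg_boxes_def flip)
    moreover have "flip p \<in> balanced_paths n" using assms flip by (auto simp: balanced_paths_def)
    ultimately have "flip p = r" using eq nb by (intro pos_boxes_inj[OF _ r(1)]) simp_all
    then have "flip p = east_rise w" using w by simp
    then have "flip (flip p) = flip (east_rise w)" by (rule arg_cong)
    also have "\<dots> = south_rise w"
      unfolding flip_def map_map by (rule map_cong) (simp_all split: lattice_step.splits)
    finally show "south_rise w = p" unfolding ff by (rule sym)
  qed
  then show ?thesis unfolding d r(2)[symmetric] nb[symmetric] using inj by blast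
qed

subsection \<open>Extremal paths and outer peaks\<close>

lemma dyck_length: "p \<in> dyck_paths n \<Longrightarrow> length p = 2 * n"
  and dyck_nonneg: "p \<in> dyck_paths n \<Longrightarrow> x \<le> 2 * n \<Longrightarrow> 0 \<le> height p x"
  and dyck_end: "p \<in> dyck_paths n \<Longrightarrow> height p (2 * n) = 0"
  by (auto simp: dyck_paths_def)

lemma dyck_le:
  assumes "p \<in> dyck_paths n" "x \<le> 2 * n"
  shows "height p x \<le> int x" "height p x \<le> 2 * int n - int x"
  using height_lipschitz[of 0 x p] height_lipschitz[of x "2 * n" p]
    dyck_length[OF assms(1)] dyck_end[OF assms(1)] assms(2) by auto

lemma even_dyck: "p \<in> dyck_paths n \<Longrightarrow> x \<le> 2 * n \<Longrightarrow> even (height p x - int x)"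
  using even_height[of x p] by (simp only: dyck_length)

text \<open>A nonnegative path that touches the axis strictly inside must arrive by a fall and leave
  by a rise, and parity puts the contact at an even abscissa.\<close>

lemma zero_valleys_eq:
  assumes p: "p \<in> dyck_paths n"
  shows "zero_valleys p = {(2 * m, 0) | m. 1 \<le> m \<and> m < n \<and> height p (2 * m) = 0}"
proof (intro Set.set_eqI iffI)
  fix v assume "v \<in> zero_valleys p"
  then obtain x where x: "v = (Suc x, 0)" "Suc x < 2 * n" "height p (Suc x) = 0"
    unfolding zero_valleys_def valleys_def by (auto simp: dyck_length[OF p])
  then have "even (Suc x)" using even_dyck[OF p, of "Suc x"] by auto
  then obtain m where "Suc x = 2 * m" by (elim evenE)
  then show "v \<in> {(2 * m, 0) | m. 1 \<le> m \<and> m < n \<and> height p (2 * m) = 0}"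
    using x by auto
next
  fix v :: "nat \<times> int" assume "v \<in> {(2 * m, 0) | m. 1 \<le> m \<and> m < n \<and> height p (2 * m) = 0}"
  then obtain m where m: "v = (2 * m, 0)" "1 \<le> m" "m < n" "height p (2 * m) = 0" by blast
  define x where "x = 2 * m - 1"
  have x: "Suc x = 2 * m" using m by (simp add: x_def)
  have "p ! x = Fall"
    using height_Suc[of x p] dyck_nonneg[OF p, of x] m x dyck_length[OF p]
    by (cases "p ! x") auto
  moreover have "p ! Suc x = Rise"
    using height_Suc[of "Suc x" p] dyck_nonneg[OF p, of "Suc (Suc x)"] m x dyck_length[OF p]
    by (cases "p ! Suc x") auto
  ultimately show "v \<in> zero_valleys p"
    unfolding zero_valleys_def valleys_def using m x dyck_length[OF p]
    by (auto intro!: exI[of _ x])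
qed

lemma height_rising_prefix:
  assumes "x \<le> length p" "height p x = int x" "y \<le> x"
  shows "height p y = int y"
  using height_lipschitz[of y x p] height_lipschitz[of 0 y p] assms by auto

lemma height_max_path: "x \<le> 2 * n \<Longrightarrow> height (max_path n) x = (if x \<le> n then int x else 2 * int n - int x)"
  by (induction x) (auto simp: height_Suc max_path_def nth_append)

lemma dyck_eq_max_path_iff:
  assumes p: "p \<in> dyck_paths n"
  shows "p = max_path n \<longleftrightarrow> height p n = int n"
proof
  assume h: "height p n = int n"
  show "p = max_path n"
  proof (rule path_eqI_height)
    fix x assume "x \<le> length p"
    then have x: "x \<le> 2 * n" using dyck_length[OF p] by simp
    show "height p x = height (max_path n) x"
      using height_rising_prefix[of n p x] h dyck_le[OF p x] x dyck_length[OF p]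
        height_lipschitz[of n x p] by (auto simp: height_max_path)
  qed (simp add: dyck_length[OF p] max_path_def)
qed (simp add: height_max_path)

lemma nth_min_path: "x < 2 * n \<Longrightarrow> min_path n ! x = (if even x then Rise else Fall)"
proof (induction n arbitrary: x)
  case (Suc n)
  show ?case
  proof (cases "x < 2")
    case True
    then have "x = 0 \<or> x = 1" by auto
    then show ?thesis by (auto simp: min_path_def)
  next
    case False
    then obtain y where "x = Suc (Suc y)" by (metis add_2_eq_Suc le_add_diff_inverse not_less)
    then show ?thesis using Suc by (simp add: min_path_def)
  qed
qed simp

lemma length_min_path [simp]: "length (min_path n) = 2 * n"
  by (induction n) (auto simp: min_path_def)

lemma height_min_path: "x \<le> 2 * n \<Longrightarrow> height (min_path n) x = int (x mod 2)"
proof (induction x)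
  case (Suc x)
  then show ?case by (auto simp: height_Suc nth_min_path) presburger+
qed simp

lemma dyck_eq_min_path_iff:
  assumes p: "p \<in> dyck_paths n"
  shows "p = min_path n \<longleftrightarrow> (\<forall>m. 1 \<le> m \<and> m < n \<longrightarrow> height p (2 * m) = 0)"
proof
  assume h: "\<forall>m. 1 \<le> m \<and> m < n \<longrightarrow> height p (2 * m) = 0"
  have z: "height p (2 * m) = 0" if "m \<le> n" for m
    using h that dyck_end[OF p] by (cases "m = 0"; cases "m = n") auto
  show "p = min_path n"
  proof (rule path_eqI_height)
    fix x assume "x \<le> length p"
    then have x: "x \<le> 2 * n" using dyck_length[OF p] by simp
    show "height p x = height (min_path n) x"
    proof (cases "even x")
      case True
      then obtain m where "x = 2 * m" by (elim evenE)
      then show ?thesis using z x by (simp add: height_min_path)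
    next
      case False
      then obtain m where m: "x = 2 * m + 1" by (elim oddE)
      then have "\<bar>height p x - height p (2 * m)\<bar> \<le> 1"
        using height_lipschitz[of "2 * m" x p] x dyck_length[OF p] by auto
      moreover have "0 \<le> height p x" "odd (height p x)" 
        using dyck_nonneg[OF p x] even_dyck[OF p x] m by auto
      ultimately have "height p x = 1" using z[of m] m x by (auto simp: abs_le_iff) presburger
      then show ?thesis using x m by (simp add: height_min_path)
    qed
  qed (simp add: dyck_length[OF p])
qed (simp add: height_min_path)

lemma finite_peaks: "finite (fst ` peaks p)"
  by (rule finite_subset[of _ "{..length p}"]) (auto simp: peaks_def)

lemma first_peak_height_eqI:
  assumes "Suc k \<le> length p" "0 < k" "height p k = int k" "height p (Suc k) = int k - 1"
  shows "first_peak_height p = int k"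
proof -
  have up: "p ! x = Rise" if "x < k" for x
    using height_rising_prefix[of k p x] height_rising_prefix[of k p "Suc x"]
      height_Suc[of x p] assms that by (cases "p ! x") auto
  obtain j where j: "k = Suc j" using assms(2) by (cases k) auto
  have "p ! k = Fall" using height_Suc[of k p] assms by (cases "p ! k") auto
  then have "(k, height p k) \<in> peaks p" unfolding peaks_def using up[of j] j assms(1) by auto
  then have mem: "k \<in> fst ` peaks p" by force
  have "k \<le> x" if "x \<in> fst ` peaks p" for x
  proof (rule ccontr)
    assume "\<not> k \<le> x"
    then show False using that up[of x] by (auto simp: peaks_def)
  qed
  then have "Min (fst ` peaks p) = k" using mem finite_peaks by (intro Min_eqI) auto
  then show ?thesis by (simp add: first_peak_height_def assms)
qed

lemma last_peak_height_eqI: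
  assumes p: "p \<in> dyck_paths n" and "0 < k" "k < 2 * n"
    "height p (2 * n - k) = int k" "height p (2 * n - k - 1) = int k - 1"
  shows "last_peak_height p = int k"
proof -
  have run: "height p x = 2 * int n - int x" if "2 * n - k \<le> x" "x \<le> 2 * n" for x
    using height_lipschitz[of "2 * n - k" x p] dyck_le(2)[OF p that(2)] that assms(2-4)
      dyck_length[OF p] by (auto simp: of_nat_diff)
  have down: "p ! x = Fall" if "2 * n - k \<le> x" "x < 2 * n" for x
    using run[of x] run[of "Suc x"] height_Suc[of x p] that dyck_length[OF p] by (cases "p ! x") auto
  obtain j where j: "2 * n - k = Suc j" using assms(3) by (cases "2 * n - k") auto
  have "p ! j = Rise" using height_Suc[of j p] assms j dyck_length[OF p] by (cases "p ! j") auto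
  then have "(Suc j, height p (Suc j)) \<in> peaks p"
    unfolding peaks_def using down[of "Suc j"] j assms(2,3) dyck_length[OF p] by auto
  then have mem: "Suc j \<in> fst ` peaks p" by force
  have "x \<le> Suc j" if "x \<in> fst ` peaks p" for x
  proof (rule ccontr)
    assume "\<not> x \<le> Suc j"
    then show False using that down[of "x - 1"] j dyck_length[OF p] by (auto simp: peaks_def)
  qed
  then have "Max (fst ` peaks p) = Suc j" using mem finite_peaks by (intro Max_eqI) auto
  then show ?thesis using j by (simp add: last_peak_height_def flip: assms(4))
qed

lemma dyck_first_run:
  assumes p: "p \<in> dyck_paths n" and n: "0 < n"
  obtains k where "0 < k" "k \<le> n" "height p k = int k" "height p (Suc k) = int k - 1"
proof -
  let ?P = "\<lambda>k. k \<le> 2 * n \<and> height p k = int k"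
  have p1: "?P 1"
    using height_Suc[of 0 p] dyck_nonneg[OF p, of 1] n dyck_length[OF p]
    by (auto split: if_splits)
  \<comment> \<open>The length of the initial run of rises.\<close>
  define k where "k = Greatest ?P"
  have k: "?P k" and ge: "\<And>j. ?P j \<Longrightarrow> j \<le> k"
    unfolding k_def using GreatestI_nat[of ?P 1 "2 * n"] Greatest_le_nat[of ?P _ "2 * n"] p1 by auto
  have kn: "k \<le> n" using dyck_le(2)[OF p, of k] k by auto
  have "\<not> ?P (Suc k)" using ge[of "Suc k"] by auto
  then have "height p (Suc k) = int k - 1"
    using height_Suc[of k p] k kn n dyck_length[OF p] by (auto split: if_splits)
  then show thesis using that[of k] k kn ge[OF p1] by auto
qed

lemma dyck_last_run:
  assumes p: "p \<in> dyck_paths n" and n: "0 < n"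
  obtains k where "0 < k" "k \<le> n" "height p (2 * n - k) = int k" "height p (2 * n - k - 1) = int k - 1"
proof -
  let ?P = "\<lambda>k. k \<le> 2 * n \<and> height p (2 * n - k) = int k"
  \<comment> \<open>The height before the last step is odd by parity, hence nonzero: the path ends
    with a fall from height 1.\<close>
  have e: "even (height p (2 * n - 1) - int (2 * n - 1))" using even_dyck[OF p, of "2 * n - 1"] by simp
  have p1: "?P 1"
    using height_lipschitz[of "2 * n - 1" "2 * n" p] dyck_nonneg[OF p, of "2 * n - 1"] e
      n dyck_length[OF p] dyck_end[OF p]
    by (auto simp: abs_le_iff of_nat_diff) presburger
  define k where "k = Greatest ?P"
  have k: "?P k" and ge: "\<And>j. ?P j \<Longrightarrow> j \<le> k"
    unfolding k_def using GreatestI_nat[of ?P 1 "2 * n"] Greatest_le_nat[of ?P _ "2 * n"] p1 by auto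
  have kn: "k \<le> n" using dyck_le(1)[OF p, of "2 * n - k"] k by auto
  have "\<not> ?P (Suc k)" using ge[of "Suc k"] by auto
  moreover have "Suc (2 * n - k - 1) = 2 * n - k" using kn n by auto
  ultimately have "height p (2 * n - k - 1) = int k - 1"
    using height_Suc[of "2 * n - k - 1" p] k kn n dyck_length[OF p] by (auto split: if_splits)
  then show thesis using that[of k] k kn ge[OF p1] by auto
qed

text \<open>This and its mirror image replace the minimum and maximum over \<open>peaks\<close> by
  the value of one height: the first peak reaches \<open>k\<close> iff the first \<open>k\<close>
  steps all rise.\<close>

lemma first_peak_height_ge:
  assumes p: "p \<in> dyck_paths n" "0 < n" and k: "k \<le> n"
  shows "int k \<le> first_peak_height p \<longleftrightarrow> height p k = int k"
proof -
  obtain j where j: "0 < j" "j \<le> n" "height p j = int j" "height p (Suc j) = int j - 1"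
    using dyck_first_run[OF p] .
  have f: "first_peak_height p = int j"
    using j dyck_length[OF p(1)] p(2) by (intro first_peak_height_eqI) auto
  show ?thesis unfolding f
    using height_rising_prefix[of j p k] height_rising_prefix[of k p "Suc j"] j k dyck_length[OF p(1)]
    by (cases "k \<le> j") auto
qed

lemma last_peak_height_ge:
  assumes p: "p \<in> dyck_paths n" "0 < n" and k: "k \<le> n"
  shows "int k \<le> last_peak_height p \<longleftrightarrow> height p (2 * n - k) = int k"
proof -
  obtain j where j: "0 < j" "j \<le> n" "height p (2 * n - j) = int j" "height p (2 * n - j - 1) = int j - 1"
    using dyck_last_run[OF p] .
  have f: "last_peak_height p = int j"
    using j p by (intro last_peak_height_eqI) auto
  show ?thesis unfolding f
  proof
    assume kj: "int k \<le> int j"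
    then have "\<bar>height p (2 * n - k) - height p (2 * n - j)\<bar> \<le> int (2 * n - k) - int (2 * n - j)"
      using dyck_length[OF p(1)] by (intro height_lipschitz) auto
    then show "height p (2 * n - k) = int k"
      using kj j k dyck_le(2)[OF p(1), of "2 * n - k"] height_lipschitz[of "2 * n - k" "2 * n" p]
        dyck_end[OF p(1)] dyck_length[OF p(1)]
        height_lipschitz[of "2 * n - j" "2 * n - k" p] by (auto simp: of_nat_diff)
  next
    assume kh: "height p (2 * n - k) = int k"
    show "int k \<le> int j"
    proof (rule ccontr)
      assume "\<not> int k \<le> int j"
      then have jk: "j < k" by simp
      then have "\<bar>height p (2 * n - j - 1) - height p (2 * n - k)\<bar> \<le> int (2 * n - j - 1) - int (2 * n - k)"
        using dyck_length[OF p(1)] by (intro height_lipschitz) auto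
      then show False using jk kh j k by (auto simp: of_nat_diff)
    qed
  qed
qed

lemma peak_height_bounds:
  assumes p: "p \<in> dyck_paths n" "0 < n"
  obtains i j where "first_peak_height p = int i" "last_peak_height p = int j"
    "0 < i" "i \<le> n" "0 < j" "j \<le> n" "i = n \<longleftrightarrow> p = max_path n" "j = n \<longleftrightarrow> p = max_path n"
proof -
  obtain i where i: "0 < i" "i \<le> n" "height p i = int i" "height p (Suc i) = int i - 1"
    using dyck_first_run[OF p] .
  obtain j where j: "0 < j" "j \<le> n" "height p (2 * n - j) = int j" "height p (2 * n - j - 1) = int j - 1"
    using dyck_last_run[OF p] .
  have f: "first_peak_height p = int i"
    using i dyck_length[OF p(1)] p(2) by (intro first_peak_height_eqI) auto
  have l: "last_peak_height p = int j" using j p by (intro last_peak_height_eqI) auto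
  have "i = n \<longleftrightarrow> p = max_path n"
    using first_peak_height_ge[OF p, of n] i f dyck_eq_max_path_iff[OF p(1)] by auto
  moreover have "j = n \<longleftrightarrow> p = max_path n"
    using last_peak_height_ge[OF p, of n] j l dyck_eq_max_path_iff[OF p(1)] by auto
  ultimately show thesis using that f l i j by blast
qed

text \<open>The path lies below all Dyck paths whose outer peaks are at least as high, not only
  below those with equal peaks. Comparison with it therefore tests two peaks and nothing else. The
  bounds by \<open>n\<close> are essential, since an outer peak of height \<open>n\<close> forces
  the maximal path and with it the other peak.\<close>

lemma least_path_with_peaks:
  assumes A: "0 < A" "A < n" and B: "0 < B" "B < n"
  obtains r where "r \<in> dyck_paths n" "first_peak_height r = int A" "last_peak_height r = int B"
    "\<And>q. q \<in> dyck_paths n \<Longrightarrow> path_le r q \<longleftrightarrow> int A \<le> first_peak_height q \<and> int B \<le> last_peak_height q"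
proof -
  \<comment> \<open>The Lipschitz lower bounds forced by nonnegativity and by the two outer peaks.\<close>
  define h where "h x = max (int (x mod 2))
      (max (int A - \<bar>int x - int A\<bar>) (int B - \<bar>2 * int n - int B - int x\<bar>))" for x
  have step: "h (Suc x) = h x + 1 \<or> h (Suc x) = h x - 1" for x
  proof -
    have par: "even (int (x mod 2) - int x)" "even (int A - \<bar>int x - int A\<bar> - int x)"
      "even (int B - \<bar>2 * int n - int B - int x\<bar> - int x)" for x
    proof -
      show "even (int (x mod 2) - int x)" by (cases "even x") (auto simp: mod_2_eq_odd)
    qed (auto simp: abs_if)
    \<comment> \<open>Two integers of equal parity are equal or at least 2 apart, so the maximum of
      two sequences with steps of size 1 and equal parity has steps of size 1 again.\<close>
    have max: "max a' b' = max a b + 1 \<or> max a' b' = max a b - 1"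
      if "a' = a + 1 \<or> a' = a - 1" "b' = b + 1 \<or> b' = b - 1" "even (a - b)" for a b a' b' :: int
    proof -
      obtain k where "a - b = 2 * k" using \<open>even (a - b)\<close> by (elim evenE)
      then consider "a = b" | "a + 2 \<le> b" | "b + 2 \<le> a" by (cases "k = 0"; cases "k < 0") auto
      then show ?thesis using that by cases auto
    qed
    have evmax: "even (max a b - c)" if "even (a - c)" "even (b - c)" for a b c :: int
      using that by (simp add: max_def)
    have ediff: "even (a - b)" if "even (a - c)" "even (b - c)" for a b c :: int
      using that by simp
    show ?thesis unfolding h_def
    proof (intro max)
      show "int (Suc x mod 2) = int (x mod 2) + 1 \<or> int (Suc x mod 2) = int (x mod 2) - 1" by presburger
      show "even (int (x mod 2) - max (int A - \<bar>int x - int A\<bar>) (int B - \<bar>2 * int n - int B - int x\<bar>))"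
        by (rule ediff[OF par(1) evmax[OF par(2,3)]])
      show "even (int A - \<bar>int x - int A\<bar> - (int B - \<bar>2 * int n - int B - int x\<bar>))"
        by (rule ediff[OF par(2,3)])
    qed auto
  qed
  obtain r where len: "length r = 2 * n" and hr: "\<And>x. x \<le> 2 * n \<Longrightarrow> height r x = h x"
    using path_of_height[of h "2 * n"] step A B by (auto simp: h_def)
  have r: "r \<in> dyck_paths n"
    unfolding dyck_paths_def using len hr A B by (auto simp: h_def)
  have mod2_le: "int (x mod 2) \<le> 1" for x :: nat by auto
  have "first_peak_height r = int A"
  proof (rule first_peak_height_eqI)
    show "height r A = int A" using A B by (subst hr) (auto simp: h_def)
    \<comment> \<open>Because \<open>B < n\<close>, the tent of the last peak is at most
      \<open>A - 1\<close> here. The zigzag term is at most 1, which suffices unless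
      \<open>A = 1\<close>, where its exact value 0 is needed.\<close>
    show "height r (Suc A) = int A - 1"
    proof (cases "A = 1")
      case True
      then show ?thesis using A B by (subst hr) (auto simp: h_def)
    next
      case False
      then have "int (Suc A mod 2) \<le> int A - 1" using A mod2_le[of "Suc A"] by linarith
      then show ?thesis using A B by (subst hr) (auto simp: h_def)
    qed
  qed (use A len in auto)
  moreover have "last_peak_height r = int B"
  proof (rule last_peak_height_eqI[OF r])
    have "int ((2 * n - B) mod 2) \<le> int B" using B mod2_le[of "2 * n - B"] by linarith
    then show "height r (2 * n - B) = int B" using A B by (subst hr) (auto simp: h_def of_nat_diff)
    show "height r (2 * n - B - 1) = int B - 1"
    proof (cases "B = 1")
      case True
      then have "2 * n - B - 1 = 2 * (n - 1)" using A by simp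
      then have "int ((2 * n - B - 1) mod 2) = 0" by simp
      then show ?thesis using A B True by (subst hr) (auto simp: h_def of_nat_diff)
    next
      case False
      then have "int ((2 * n - B - 1) mod 2) \<le> int B - 1" using B mod2_le[of "2 * n - B - 1"] by linarith
      then show ?thesis using A B False by (subst hr) (auto simp: h_def of_nat_diff)
    qed
  qed (use B in auto)
  moreover have "path_le r q \<longleftrightarrow> int A \<le> first_peak_height q \<and> int B \<le> last_peak_height q"
    if q: "q \<in> dyck_paths n" for q
  proof -
    have n: "0 < n" using A by simp
    have eq: "int A \<le> first_peak_height q \<and> int B \<le> last_peak_height q \<longleftrightarrow>
        height q A = int A \<and> height q (2 * n - B) = int B"
      using first_peak_height_ge[OF q n, of A] last_peak_height_ge[OF q n, of B] A B by auto
    show ?thesis unfolding eq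
    proof
      assume le: "path_le r q"
      have "int A \<le> height r A" "int B \<le> height r (2 * n - B)"
        using A B by (auto simp: hr h_def of_nat_diff)
      moreover have "height r A \<le> height q A" "height r (2 * n - B) \<le> height q (2 * n - B)"
        using le len A B unfolding path_le_def by auto
      ultimately show "height q A = int A \<and> height q (2 * n - B) = int B"
        using dyck_le[OF q, of A] dyck_le[OF q, of "2 * n - B"] A B by (auto simp: of_nat_diff)
    next
      assume hq: "height q A = int A \<and> height q (2 * n - B) = int B"
      have "h x \<le> height q x" if x: "x \<le> 2 * n" for x
      proof -
        have "int (x mod 2) \<le> height q x"
          using even_dyck[OF q x] dyck_nonneg[OF q x] by presburger
        moreover have "int A - \<bar>int x - int A\<bar> \<le> height q x"
          using height_lipschitz[of x A q] height_lipschitz[of A x q] hq x A dyck_length[OF q]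
          by (cases "x \<le> A") auto
        moreover have "int B - \<bar>2 * int n - int B - int x\<bar> \<le> height q x"
          using height_lipschitz[of x "2 * n - B" q] height_lipschitz[of "2 * n - B" x q] hq x B
            dyck_length[OF q]
          by (cases "x \<le> 2 * n - B") (auto simp: of_nat_diff)
        ultimately show ?thesis unfolding h_def by (intro max.boundedI)
      qed
      then show "path_le r q" unfolding path_le_def using len hr dyck_length[OF q] by auto
    qed
  qed
  ultimately show thesis using that r by blast
qed

lemma path_le_antisym: "path_le p q \<Longrightarrow> path_le q p \<Longrightarrow> p = q"
  by (intro path_eqI_height) (auto simp: path_le_def intro: order_antisym)

lemma bar_path_le_iff_peaks:
  assumes n: "1 < n" and p: "p \<in> dyck_paths n" and q: "q \<in> dyck_paths n"
  shows "path_le (bar_path n p) q \<longleftrightarrow>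
    int n \<le> first_peak_height q + last_peak_height p \<and> int n \<le> last_peak_height q + first_peak_height p"
proof -
  have n0: "0 < n" using n by simp
  obtain i j where ij: "first_peak_height p = int i" "last_peak_height p = int j"
    "0 < i" "i \<le> n" "0 < j" "j \<le> n" "i = n \<longleftrightarrow> p = max_path n" "j = n \<longleftrightarrow> p = max_path n"
    using peak_height_bounds[OF p n0] .
  obtain i' j' where ij': "first_peak_height q = int i'" "last_peak_height q = int j'" "0 < i'" "0 < j'"
    using peak_height_bounds[OF q n0] .
  \<comment> \<open>For the maximal path, \<open>i = j = n\<close>, the convention for the pair
    \<open>(0, 0)\<close> gives \<open>(1, 1)\<close>. Every Dyck path has outer peaks at least 1,
    just as the two inequalities of the claim are vacuous then, so the claim needs no
    exception.\<close>
  define A B where "A = (if i = n then 1 else n - j)" and "B = (if i = n then 1 else n - i)"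
  have "0 < A" "A < n" "0 < B" "B < n" using ij n by (auto simp: A_def B_def)
  then obtain r where r: "r \<in> dyck_paths n" "first_peak_height r = int A" "last_peak_height r = int B"
    "\<And>q. q \<in> dyck_paths n \<Longrightarrow> path_le r q \<longleftrightarrow> int A \<le> first_peak_height q \<and> int B \<le> last_peak_height q"
    using least_path_with_peaks by blast
  have D: "dyck_paths_ij n (int n - last_peak_height p) (int n - first_peak_height p) =
      {s \<in> dyck_paths n. first_peak_height s = int A \<and> last_peak_height s = int B}"
    using ij by (auto simp: dyck_paths_ij_def A_def B_def of_nat_diff)
  have "bar_path n p = r"
    unfolding bar_path_def Let_def D
  proof (rule the_equality)
    show "r \<in> {s \<in> dyck_paths n. first_peak_height s = int A \<and> last_peak_height s = int B} \<and>
      (\<forall>s\<in>{s \<in> dyck_paths n. first_peak_height s = int A \<and> last_peak_height s = int B}. path_le s r \<longrightarrow> s = r)"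
      using r by (auto intro: path_le_antisym)
  next
    fix s assume s: "s \<in> {s \<in> dyck_paths n. first_peak_height s = int A \<and> last_peak_height s = int B} \<and>
      (\<forall>t\<in>{s \<in> dyck_paths n. first_peak_height s = int A \<and> last_peak_height s = int B}. path_le t s \<longrightarrow> t = s)"
    then have "path_le r s" using r(4)[of s] by simp
    then show "s = r" using s r by auto
  qed
  then show ?thesis using r(4)[OF q] ij ij' by (auto simp: A_def B_def of_nat_diff)
qed

text \<open>The first row of \<open>p\<close> starts at the column given by its first peak, and the
  last row of \<open>q\<close> reaches as many columns to the left from the right edge as its last
  peak is high. The transfer of boxes from row to row is therefore one of the two peak inequalities;
  the columns give the other.\<close>

lemma bar_path_le_iff:
  assumes n: "1 < n" and p: "p \<in> dyck_paths n" and q: "q \<in> dyck_paths n"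
  shows "path_le (bar_path n p) q \<longleftrightarrow>
    (\<forall>b. (0, b) \<in> pos_boxes n p \<longrightarrow> (n - 1, b) \<in> neg_boxes n q) \<and>
    (\<forall>a. (a, n - 1) \<in> pos_boxes n p \<longrightarrow> (a, 0) \<in> neg_boxes n q)"
proof -
  have n0: "0 < n" using n by simp
  obtain i j where ij: "first_peak_height p = int i" "last_peak_height p = int j"
    "0 < i" "i \<le> n" "0 < j" "j \<le> n"
    using peak_height_bounds[OF p n0] .
  obtain i' j' where ij': "first_peak_height q = int i'" "last_peak_height q = int j'"
    "i' \<le> n" "j' \<le> n"
    using peak_height_bounds[OF q n0] .
  have p0: "(0, b) \<in> pos_boxes n p \<longleftrightarrow> i \<le> b \<and> b < n" for b
  proof -
    \<comment> \<open>The height is at most \<open>b + 1\<close> and has its parity, so it is either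
      equal to that bound or smaller by at least 2.\<close>
    have "height p (b + 1) \<le> int b - 1 \<longleftrightarrow> height p (b + 1) \<noteq> int (b + 1)" if "b < n"
    proof -
      obtain t where "height p (b + 1) - int (b + 1) = 2 * t"
        using evenE[OF even_dyck[OF p, of "b + 1"]] \<open>b < n\<close> by auto
      then show ?thesis using dyck_le(1)[OF p, of "b + 1"] \<open>b < n\<close> by (cases "t = 0") auto
    qed
    then show ?thesis
      using first_peak_height_ge[OF p n0, of "b + 1"] ij by (auto simp: pos_boxes_def)
  qed
  have pn: "(a, n - 1) \<in> pos_boxes n p \<longleftrightarrow> a + j < n" for a
  proof -
    have "height p (a + n) \<le> int n - int a - 2 \<longleftrightarrow> height p (a + n) \<noteq> int (n - a)" if "a < n"
    proof -
      obtain t where "height p (a + n) - int (a + n) = 2 * t"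
        using evenE[OF even_dyck[OF p, of "a + n"]] \<open>a < n\<close> by auto
      then have "height p (a + n) = int n - int a + 2 * (t + int a)" by simp
      then show ?thesis using dyck_le(2)[OF p, of "a + n"] \<open>a < n\<close>
        by (cases "t + int a = 0") (auto simp: of_nat_diff)
    qed
    moreover have "2 * n - (n - a) = a + n" if "a < n" using that by auto
    ultimately show ?thesis
      using last_peak_height_ge[OF p n0, of "n - a"] ij n0
      by (auto simp: pos_boxes_def of_nat_diff add.commute[of n a])
  qed
  have q0: "(a, 0) \<in> neg_boxes n q \<longleftrightarrow> a < i'" for a
    using first_peak_height_ge[OF q n0, of "a + 1"] dyck_le(1)[OF q, of "a + 1"] ij'
    by (auto simp: neg_boxes_def)
  have qn: "(n - 1, b) \<in> neg_boxes n q \<longleftrightarrow> n - b \<le> j' \<and> b < n" for b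
  proof -
    have "2 * n - (n - b) = n + b" if "b < n" using that by auto
    then show ?thesis
      using last_peak_height_ge[OF q n0, of "n - b"] dyck_le(2)[OF q, of "n + b"] ij' n0
      by (auto simp: neg_boxes_def of_nat_diff)
  qed
  have "(\<forall>b. i \<le> b \<and> b < n \<longrightarrow> n - b \<le> j' \<and> b < n) \<longleftrightarrow> n \<le> j' + i"
    using ij by (cases "i < n") (auto dest: spec[of _ i])
  moreover have "(\<forall>a. a + j < n \<longrightarrow> a < i') \<longleftrightarrow> n \<le> i' + j"
    using ij by (cases "j < n") (auto dest: spec[of _ "n - j - 1"])
  ultimately show ?thesis
    unfolding bar_path_le_iff_peaks[OF n p q] p0 pn q0 qn ij ij' by (simp flip: of_nat_add) blast
qed

subsection \<open>Root spaces and supports\<close>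

lemma affine_eqI:
  assumes "\<And>k. loop x k = loop y k" "c_coord x = c_coord y" "d_coord x = d_coord y"
  shows "x = y"
  using assms by (intro affine.expand) auto

definition mat_unit :: "nat \<Rightarrow> nat \<Rightarrow> nat \<Rightarrow> complex mat" where
  "mat_unit n a b = mat n n (\<lambda>(r, s). if r = a \<and> s = b then 1 else 0)"

lemma mat_unit_carrier [simp]: "mat_unit n a b \<in> carrier_mat n n"
  by (simp add: mat_unit_def)

lemma mat_unit_index [simp]: "r < n \<Longrightarrow> s < n \<Longrightarrow> mat_unit n a b $$ (r, s) = (if r = a \<and> s = b then 1 else 0)"
  by (simp add: mat_unit_def)

lemma dim_mat_unit [simp]: "dim_row (mat_unit n a b) = n" "dim_col (mat_unit n a b) = n"
  by (simp_all add: mat_unit_def)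

lemma mult_index:
  fixes A B :: "complex mat"
  assumes "A \<in> carrier_mat n n" "B \<in> carrier_mat n n" "r < n" "s < n"
  shows "(A * B) $$ (r, s) = (\<Sum>j<n. A $$ (r, j) * B $$ (j, s))"
  using assms by (auto simp: scalar_prod_def lessThan_atLeast0 intro!: sum.cong)

lemma mat_unit_mult_index:
  assumes "A \<in> carrier_mat n n" "r < n" "s < n" "a < n" "b < n"
  shows "(mat_unit n a b * A) $$ (r, s) = (if r = a then A $$ (b, s) else 0)"
    "(A * mat_unit n a b) $$ (r, s) = (if s = b then A $$ (r, a) else 0)"
proof -
  have "(mat_unit n a b * A) $$ (r, s) = (\<Sum>j<n. if j = b then (if r = a then A $$ (b, s) else 0) else 0)"
    unfolding mult_index[OF mat_unit_carrier assms(1-3)] mult_index[OF assms(1) mat_unit_carrier assms(2,3)]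
    using assms by (intro sum.cong) auto
  then show "(mat_unit n a b * A) $$ (r, s) = (if r = a then A $$ (b, s) else 0)"
    using assms by simp
  have "(A * mat_unit n a b) $$ (r, s) = (\<Sum>j<n. if j = a then (if s = b then A $$ (r, a) else 0) else 0)"
    unfolding mult_index[OF mat_unit_carrier assms(1-3)] mult_index[OF assms(1) mat_unit_carrier assms(2,3)]
    using assms by (intro sum.cong) auto
  then show "(A * mat_unit n a b) $$ (r, s) = (if s = b then A $$ (r, a) else 0)"
    using assms by simp
qed

lemma trace_eq: "A \<in> carrier_mat n n \<Longrightarrow> mat_trace A = (\<Sum>i<n. A $$ (i, i))"
  by (auto simp: mat_trace_def)

lemma mat_unit_sl: "a \<noteq> b \<Longrightarrow> mat_unit n a b \<in> sl n"
  by (auto simp: sl_def trace_eq[of _ n] intro!: sum.neutral)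

lemma zero_sl [simp]: "0\<^sub>m n n \<in> sl n"
  by (auto simp: sl_def trace_eq[of _ n])

lemma sl_carrier: "A \<in> sl n \<Longrightarrow> A \<in> carrier_mat n n"
  by (simp add: sl_def)

lemma loop_tens [simp]: "loop (tens n A k) l = (if l = k then A else 0\<^sub>m n n)"
  and coord_tens [simp]: "c_coord (tens n A k) = 0" "d_coord (tens n A k) = 0"
  by (simp_all add: tens_def)

lemma loop_aff_zero [simp]: "loop (aff_zero n) l = 0\<^sub>m n n"
  and coord_aff_zero [simp]: "c_coord (aff_zero n) = 0" "d_coord (aff_zero n) = 0"
  by (simp_all add: aff_zero_def)

lemma loop_aff_add [simp]: "loop (aff_add x y) l = loop x l + loop y l"
  and coord_aff_add [simp]: "c_coord (aff_add x y) = c_coord x + c_coord y"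
    "d_coord (aff_add x y) = d_coord x + d_coord y"
  by (simp_all add: aff_add_def)

lemma loop_aff_scale [simp]: "loop (aff_scale z x) l = z \<cdot>\<^sub>m loop x l"
  and coord_aff_scale [simp]: "c_coord (aff_scale z x) = z * c_coord x"
    "d_coord (aff_scale z x) = z * d_coord x"
  by (simp_all add: aff_scale_def)

lemma tens_sl_hat: "A \<in> sl n \<Longrightarrow> tens n A k \<in> sl_hat n"
  by (auto simp: sl_hat_def intro: finite_subset[of _ "{k}"])

lemma tens_n_hat_pos:
  "A \<in> sl n \<Longrightarrow> 0 < k \<or> k = 0 \<and> A \<in> n_pos n \<Longrightarrow> tens n A k \<in> n_hat_pos n"
  using tens_sl_hat[of A n k] by (auto simp: n_hat_pos_def n_pos_def)

lemma mat_unit_n_pos: "a < b \<Longrightarrow> mat_unit n a b \<in> n_pos n"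
  by (auto simp: n_pos_def mat_unit_sl)

lemma zero_h_hat: "aff_zero n \<in> h_hat n"
  by (auto simp: h_hat_def sl_hat_def diagonal_mat_def)

lemma n_hat_pos_b_hat: "n_hat_pos n \<subseteq> b_hat n"
proof
  fix x assume x: "x \<in> n_hat_pos n"
  then have "x = aff_add (aff_zero n) x"
    by (intro affine_eqI) (auto simp: n_hat_pos_def sl_hat_def sl_def)
  then show "x \<in> b_hat n" unfolding b_hat_def using x zero_h_hat by blast
qed

text \<open>Degrees are nonnegative, so \<open>k + l = 0\<close> only for \<open>k = 0\<close>,
  where the factor \<open>k\<close> of the cocycle kills the central term. A zero \<open>A\<close>
  is separated in the proof because the bracket sums over the support of its first argument, which
  is then empty instead of \<open>{k}\<close>.\<close>

lemma bracket_tens: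
  assumes A: "A \<in> carrier_mat n n" and B: "B \<in> carrier_mat n n" and kl: "0 \<le> k" "0 \<le> l"
  shows "aff_bracket n (tens n A k) (tens n B l) = tens n (A * B - B * A) (k + l)"
proof (cases "A = 0\<^sub>m n n")
  case True
  then show ?thesis
    using B by (intro affine_eqI) (auto simp: aff_bracket_def)
next
  case False
  then have s: "{i. loop (tens n A k) i \<noteq> 0\<^sub>m n n} = {k}" by auto
  show ?thesis
  proof (rule affine_eqI)
    fix m
    show "loop (aff_bracket n (tens n A k) (tens n B l)) m = loop (tens n (A * B - B * A) (k + l)) m"
      using A B unfolding aff_bracket_def s by (auto intro!: eq_matI)
  next
    have "k = 0 \<or> - k \<noteq> l" using kl by auto
    then show "c_coord (aff_bracket n (tens n A k) (tens n B l)) = c_coord (tens n (A * B - B * A) (k + l))"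
      unfolding aff_bracket_def s using A by (auto simp: mat_trace_def intro!: sum.neutral)
  qed (simp add: aff_bracket_def)
qed

text \<open>The functional \<open>epsilon_a - epsilon_b + k delta\<close>. One family covers the
  real roots and, for \<open>a = b\<close>, the multiples of \<open>delta\<close>; the value 0 off
  \<open>h_hat n\<close> matches the representatives chosen in \<open>h_hat_dual\<close>.\<close>

definition weight :: "nat \<Rightarrow> nat \<Rightarrow> nat \<Rightarrow> int \<Rightarrow> affine \<Rightarrow> complex" where
  "weight n a b k = (\<lambda>h. if h \<in> h_hat n
     then loop h 0 $$ (a, a) - loop h 0 $$ (b, b) + of_int k * d_coord h else 0)"

lemma bracket_h_hat:
  assumes h: "h \<in> h_hat n" and x: "x \<in> sl_hat n"
  shows "aff_bracket n h x = Affine (\<lambda>k. mat n n (\<lambda>(r, s). weight n r s k h * loop x k $$ (r, s))) 0 0"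
proof (rule affine_eqI)
  have H: "loop h 0 \<in> carrier_mat n n" "diagonal_mat (loop h 0)" "\<And>k. k \<noteq> 0 \<Longrightarrow> loop h k = 0\<^sub>m n n"
    using h by (auto simp: h_hat_def sl_hat_def sl_def)
  have X: "loop x k \<in> carrier_mat n n" for k using x by (auto simp: sl_hat_def sl_def)
  have off: "loop h 0 $$ (r, s) = 0" if "r < n" "s < n" "r \<noteq> s" for r s
    using H that unfolding diagonal_mat_def by auto
  have s: "{i. loop h i \<noteq> 0\<^sub>m n n} = (if loop h 0 = 0\<^sub>m n n then {} else {0})"
  proof -
    have "i = 0" if "loop h i \<noteq> 0\<^sub>m n n" for i using H(3)[of i] that by auto
    then show ?thesis by force
  qed
  have comm: "(loop h 0 * loop x k - loop x k * loop h 0) $$ (r, s)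
      = (loop h 0 $$ (r, r) - loop h 0 $$ (s, s)) * loop x k $$ (r, s)" if rs: "r < n" "s < n" for r s k
  proof -
    have "(loop h 0 * loop x k) $$ (r, s)
        = (\<Sum>j<n. if j = r then loop h 0 $$ (r, r) * loop x k $$ (r, s) else 0)"
      unfolding mult_index[OF H(1) X rs] using rs by (intro sum.cong) (auto simp: off)
    moreover have "(loop x k * loop h 0) $$ (r, s)
        = (\<Sum>j<n. if j = s then loop x k $$ (r, s) * loop h 0 $$ (s, s) else 0)"
      unfolding mult_index[OF X H(1) rs] using rs by (intro sum.cong) (auto simp: off)
    ultimately show ?thesis using rs H(1) X[of k] by (simp add: algebra_simps)
  qed
  fix k
  have "of_int k * loop h k $$ (r, s) = 0" if "r < n" "s < n" for r s
    using H(3)[of k] that by (cases "k = 0") auto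
  then show "loop (aff_bracket n h x) k =
      loop (Affine (\<lambda>k. mat n n (\<lambda>(r, s). weight n r s k h * loop x k $$ (r, s))) 0 0) k"
    unfolding aff_bracket_def s
    using h comm by (auto intro!: eq_matI simp: weight_def algebra_simps)
  show "c_coord (aff_bracket n h x) =
      c_coord (Affine (\<lambda>k. mat n n (\<lambda>(r, s). weight n r s k h * loop x k $$ (r, s))) 0 0)"
    by (auto simp: aff_bracket_def s)
qed (simp add: aff_bracket_def)

lemma root_space_iff:
  "x \<in> root_space n \<alpha> \<longleftrightarrow> x \<in> sl_hat n \<and> (\<forall>h\<in>h_hat n. \<alpha> h * c_coord x = 0 \<and> \<alpha> h * d_coord x = 0 \<and>
     (\<forall>k. \<forall>r<n. \<forall>s<n. loop x k $$ (r, s) \<noteq> 0 \<longrightarrow> weight n r s k h = \<alpha> h))"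
proof (cases "x \<in> sl_hat n")
  case True
  then have X: "loop x k \<in> carrier_mat n n" for k by (auto simp: sl_hat_def sl_def)
  have "aff_bracket n h x = aff_scale (\<alpha> h) x \<longleftrightarrow> \<alpha> h * c_coord x = 0 \<and> \<alpha> h * d_coord x = 0 \<and>
     (\<forall>k. \<forall>r<n. \<forall>s<n. loop x k $$ (r, s) \<noteq> 0 \<longrightarrow> weight n r s k h = \<alpha> h)"
    if h: "h \<in> h_hat n" for h
  proof -
    have "mat n n (\<lambda>(r, s). weight n r s k h * loop x k $$ (r, s)) = \<alpha> h \<cdot>\<^sub>m loop x k \<longleftrightarrow>
        (\<forall>r<n. \<forall>s<n. loop x k $$ (r, s) \<noteq> 0 \<longrightarrow> weight n r s k h = \<alpha> h)" for k
      using X[of k] by (auto simp: mat_eq_iff)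
    then show ?thesis
      unfolding bracket_h_hat[OF h True] aff_scale_def by (auto simp: fun_eq_iff)
  qed
  then show ?thesis using True by (auto simp: root_space_def)
qed (simp add: root_space_def)

lemma weight_h_hat_dual: "a < n \<Longrightarrow> b < n \<Longrightarrow> weight n a b k \<in> h_hat_dual n"
proof -
  assume ab: "a < n" "b < n"
  have add: "aff_add x y \<in> h_hat n" if "x \<in> h_hat n" "y \<in> h_hat n" for x y
  proof -
    have c: "loop x k \<in> sl n" "loop y k \<in> sl n" for k
      using that by (auto simp: h_hat_def sl_hat_def)
    have "loop x k + loop y k \<in> sl n" for k
      using c[of k] by (auto simp: sl_def trace_eq[of _ n] sum.distrib)
    moreover have "{k. loop x k + loop y k \<noteq> 0\<^sub>m n n} \<subseteq> {0}" using that by (auto simp: h_hat_def)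
    moreover have "diagonal_mat (loop x 0 + loop y 0)"
      using that c[of 0] by (auto simp: h_hat_def diagonal_mat_def sl_def)
    ultimately show ?thesis using that by (auto simp: h_hat_def sl_hat_def intro: finite_subset)
  qed
  have scale: "aff_scale z x \<in> h_hat n" if "x \<in> h_hat n" for z x
  proof -
    have c: "loop x k \<in> sl n" for k using that by (auto simp: h_hat_def sl_hat_def)
    have "z \<cdot>\<^sub>m loop x k \<in> sl n" for k
      using c[of k] by (auto simp: sl_def trace_eq[of _ n] simp flip: sum_distrib_left)
    moreover have "{k. z \<cdot>\<^sub>m loop x k \<noteq> 0\<^sub>m n n} \<subseteq> {0}" using that by (auto simp: h_hat_def)
    moreover have "diagonal_mat (z \<cdot>\<^sub>m loop x 0)"
      using that c[of 0] by (auto simp: h_hat_def diagonal_mat_def sl_def)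
    ultimately show ?thesis using that by (auto simp: h_hat_def sl_hat_def intro: finite_subset)
  qed
  have c: "dim_row (loop x 0) = n" "dim_col (loop x 0) = n" if "x \<in> h_hat n" for x
    using that by (auto simp: h_hat_def sl_hat_def sl_def)
  show ?thesis
    unfolding h_hat_dual_def using ab add scale c
    by (auto simp: weight_def algebra_simps)
qed

section \<open>Test elements that separate the weights, and the resulting root spaces\<close>

definition d_elt :: "nat \<Rightarrow> affine" where "d_elt n = Affine (\<lambda>k. 0\<^sub>m n n) 0 1"

definition coroot_mat :: "nat \<Rightarrow> nat \<Rightarrow> nat \<Rightarrow> complex mat" where
  "coroot_mat n a b = mat_unit n a a - mat_unit n b b"

lemma coroot_mat_carrier [simp]: "coroot_mat n a b \<in> carrier_mat n n"
  by (auto simp: coroot_mat_def)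

lemma coroot_mat_index:
  "r < n \<Longrightarrow> s < n \<Longrightarrow> coroot_mat n a b $$ (r, s) =
    (if r = s then (if r = a then 1 else 0) - (if r = b then 1 else 0) else 0)"
  by (simp add: coroot_mat_def)

lemma coroot_mat_sl: "a < n \<Longrightarrow> b < n \<Longrightarrow> coroot_mat n a b \<in> sl n"
  by (simp add: sl_def trace_eq[of _ n] coroot_mat_index sum_subtractf)

lemma d_elt_h_hat: "d_elt n \<in> h_hat n"
  by (auto simp: d_elt_def h_hat_def sl_hat_def diagonal_mat_def)

lemma coroot_h_hat: "a < n \<Longrightarrow> b < n \<Longrightarrow> tens n (coroot_mat n a b) 0 \<in> h_hat n"
  by (auto simp: h_hat_def tens_sl_hat coroot_mat_sl diagonal_mat_def coroot_mat_index carrier_matD[OF coroot_mat_carrier])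

text \<open>The element \<open>d\<close> reads off the degree. A coroot takes the value 2 on its own
  root and on no other \<open>epsilon_r - epsilon_s\<close>, which identifies the positions.\<close>

lemma weight_inj:
  assumes eq: "\<And>h. h \<in> h_hat n \<Longrightarrow> weight n r s k h = weight n a b l h"
    and lt: "a < n" "b < n" "r < n" "s < n"
  shows "k = l" "a \<noteq> b \<Longrightarrow> r = a \<and> s = b" "a = b \<Longrightarrow> r = s"
proof -
  show "k = l" using eq[OF d_elt_h_hat] lt d_elt_h_hat[of n] by (simp add: weight_def d_elt_def)
  have *: "weight n r s k (tens n (coroot_mat n i j) 0) = weight n a b l (tens n (coroot_mat n i j) 0)"
    if "i < n" "j < n" for i j using eq coroot_h_hat that by blast
  show "r = a \<and> s = b" if "a \<noteq> b"
    using *[OF lt(1,2)] lt that coroot_h_hat[OF lt(1,2)]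
    by (auto simp: weight_def coroot_mat_index split: if_splits)
  show "r = s" if "a = b"
    using *[OF lt(3,4)] lt that coroot_h_hat[OF lt(3,4)]
    by (auto simp: weight_def coroot_mat_index split: if_splits)
qed

lemma simple_root_eq: "simple_root n i = weight n i (Suc i) 0"
  by (simp add: simple_root_def weight_def fun_eq_iff)

lemma sum_simple_roots: "a \<le> b \<Longrightarrow> (\<Sum>i\<in>{a..<b}. simple_root n i) = weight n a b 0"
proof (induction b rule: dec_induct)
  case base
  then show ?case by (auto simp: weight_def fun_eq_iff)
next
  case (step m)
  then show ?case by (auto simp: weight_def simple_root_eq fun_eq_iff)
qed

lemma box_root_eq: "box_root n (a, b) = weight n a b 0"
proof (cases "a < b")
  case True
  then show ?thesis by (simp add: box_root_def sum_simple_roots)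
next
  case False
  then show ?thesis by (auto simp: box_root_def sum_simple_roots weight_def fun_eq_iff)
qed

lemma weight_add_delta: "weight n a b k + delta n = weight n a b (k + 1)"
  by (auto simp: weight_def delta_def fun_eq_iff algebra_simps)

lemma delta_eq: "delta n = weight n a a 1"
  by (auto simp: weight_def delta_def fun_eq_iff)

lemma weight_nonzero:
  assumes "a < n" "b < n" "a \<noteq> b \<or> k \<noteq> 0"
  shows "weight n a b k \<noteq> 0"
proof
  assume "weight n a b k = 0"
  then have *: "weight n a b k h = weight n a a 0 h" for h by (simp add: weight_def)
  then show False using weight_inj(1,3)[of n a b k a a 0] assms by auto
qed

lemma root_space_tens_mat_unit:
  assumes "a < n" "b < n" "a \<noteq> b"
  shows "tens n (mat_unit n a b) k \<in> root_space n (weight n a b k)"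
  using assms by (auto simp: root_space_iff tens_sl_hat mat_unit_sl split: if_splits)

lemma tens_mat_unit_nonzero: "a < n \<Longrightarrow> b < n \<Longrightarrow> tens n (mat_unit n a b) k \<noteq> aff_zero n"
proof
  assume ab: "a < n" "b < n" and "tens n (mat_unit n a b) k = aff_zero n"
  then have "loop (tens n (mat_unit n a b) k) k $$ (a, b) = loop (aff_zero n) k $$ (a, b)" by simp
  then show False using ab by simp
qed

lemma root_space_real:
  assumes x: "x \<in> root_space n (weight n a b k)" and ab: "a < n" "b < n" "a \<noteq> b"
  obtains z where "x = aff_scale z (tens n (mat_unit n a b) k)"
proof -
  have X: "loop x m \<in> carrier_mat n n" for m using x by (auto simp: root_space_iff sl_hat_def sl_def)
  have z: "loop x m $$ (r, s) = 0" if "\<not> (r = a \<and> s = b \<and> m = k)" "r < n" "s < n" for r s m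
    using weight_inj(1,2)[of n r s m a b k] x that ab by (auto simp: root_space_iff)
  \<comment> \<open>Some element on which the root does not vanish removes the components along
    \<open>c\<close> and \<open>d\<close>. It has to be a coroot, because \<open>d\<close> gives 0
    when \<open>k = 0\<close>.\<close>
  have "weight n a b k (tens n (coroot_mat n a b) 0) = 2"
    using ab coroot_h_hat by (simp add: weight_def coroot_mat_index)
  then have cd: "c_coord x = 0" "d_coord x = 0"
    using x coroot_h_hat[OF ab(1,2)] by (auto simp: root_space_iff)
  have "x = aff_scale (loop x k $$ (a, b)) (tens n (mat_unit n a b) k)"
  proof (rule affine_eqI)
    fix m show "loop x m = loop (aff_scale (loop x k $$ (a, b)) (tens n (mat_unit n a b) k)) m"
      using X[of m] ab by (intro eq_matI) (auto simp: z)
  qed (simp_all add: cd)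
  then show thesis by (rule that)
qed

lemma root_space_delta:
  assumes x: "x \<in> root_space n (delta n)" and n: "0 < n"
  obtains D where "x = tens n D 1" "D \<in> sl n" "diagonal_mat D"
proof -
  have X: "loop x m \<in> sl n" for m using x by (auto simp: root_space_iff sl_hat_def)
  have z: "r = s \<and> m = 1" if "loop x m $$ (r, s) \<noteq> 0" "r < n" "s < n" for r s m
    using weight_inj(1,3)[of n r s m 0 0 1] x that n by (auto simp: root_space_iff delta_eq[of n 0])
  have "delta n (d_elt n) = 1" using d_elt_h_hat by (simp add: delta_def d_elt_def)
  moreover have "delta n (d_elt n) * c_coord x = 0" "delta n (d_elt n) * d_coord x = 0"
    using x d_elt_h_hat unfolding root_space_iff by blast+
  ultimately have cd: "c_coord x = 0" "d_coord x = 0" by simp_all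
  have "x = tens n (loop x 1) 1"
  proof (rule affine_eqI)
    fix m show "loop x m = loop (tens n (loop x 1) 1) m"
      using sl_carrier[OF X[of m]] z[where m = m] by (cases "m = 1") (auto intro!: eq_matI, metis)
  qed (simp_all add: cd)
  moreover have "diagonal_mat (loop x 1)"
    using sl_carrier[OF X[of 1]] z[of 1] by (auto simp: diagonal_mat_def)
  ultimately show thesis using that X by blast
qed

lemma root_space_tens_diag:
  assumes "D \<in> sl n" "diagonal_mat D"
  shows "tens n D 1 \<in> root_space n (delta n)"
  using assms by (auto simp: root_space_iff tens_sl_hat delta_def weight_def diagonal_mat_def sl_def split: if_splits)

lemma box_root_pos_roots: "a < n \<Longrightarrow> b < n \<Longrightarrow> a \<noteq> b \<Longrightarrow> box_root n (a, b) \<in> pos_roots n \<longleftrightarrow> a < b"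
proof
  assume ab: "a < n" "b < n" "a \<noteq> b"
  { assume "box_root n (a, b) \<in> pos_roots n"
    then obtain A where A: "A \<in> n_pos n" "tens n A 0 \<in> root_space n (weight n a b 0)"
      "tens n A 0 \<noteq> aff_zero n"
      unfolding pos_roots_def roots_of_def box_root_eq by blast
    from root_space_real[OF A(2) ab] obtain z where z: "tens n A 0 = aff_scale z (tens n (mat_unit n a b) 0)" .
    then have "loop (tens n A 0) 0 = loop (aff_scale z (tens n (mat_unit n a b) 0)) 0" by simp
    then have Az: "A = z \<cdot>\<^sub>m mat_unit n a b" by simp
    have "z \<noteq> 0"
      using A(3) z by (auto intro!: affine_eqI eq_matI)
    then have "A $$ (a, b) \<noteq> 0" using ab Az by simp
    then show "a < b" using A(1) ab by (force simp: n_pos_def not_le[symmetric]) }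
  { assume "a < b"
    then have "tens n (mat_unit n a b) 0 \<in> (\<lambda>A. tens n A 0) ` n_pos n" by (simp add: mat_unit_n_pos)
    then show "box_root n (a, b) \<in> pos_roots n"
      unfolding pos_roots_def roots_of_def box_root_eq
      using root_space_tens_mat_unit[OF ab] tens_mat_unit_nonzero[OF ab(1,2)] weight_h_hat_dual weight_nonzero ab by blast }
qed

lemma box_root_neg_roots: "a < n \<Longrightarrow> b < n \<Longrightarrow> a \<noteq> b \<Longrightarrow> box_root n (a, b) \<in> neg_roots n \<longleftrightarrow> b < a"
proof
  assume ab: "a < n" "b < n" "a \<noteq> b"
  { assume "box_root n (a, b) \<in> neg_roots n"
    then obtain A where A: "A \<in> n_neg n" "tens n A 0 \<in> root_space n (weight n a b 0)"
      "tens n A 0 \<noteq> aff_zero n"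
      unfolding neg_roots_def roots_of_def box_root_eq by blast
    from root_space_real[OF A(2) ab] obtain z where z: "tens n A 0 = aff_scale z (tens n (mat_unit n a b) 0)" .
    then have "loop (tens n A 0) 0 = loop (aff_scale z (tens n (mat_unit n a b) 0)) 0" by simp
    then have Az: "A = z \<cdot>\<^sub>m mat_unit n a b" by simp
    have "z \<noteq> 0"
      using A(3) z by (auto intro!: affine_eqI eq_matI)
    then have "A $$ (a, b) \<noteq> 0" using ab Az by simp
    then show "b < a" using A(1) ab by (force simp: n_neg_def not_le[symmetric]) }
  { assume "b < a"
    then have "mat_unit n a b \<in> n_neg n" by (auto simp: n_neg_def mat_unit_sl)
    then have "tens n (mat_unit n a b) 0 \<in> (\<lambda>A. tens n A 0) ` n_neg n" by simp
    then show "box_root n (a, b) \<in> neg_roots n"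
      unfolding neg_roots_def roots_of_def box_root_eq
      using root_space_tens_mat_unit[OF ab] tens_mat_unit_nonzero[OF ab(1,2)] weight_h_hat_dual weight_nonzero ab by blast }
qed

section \<open>Supports of ideals in terms of matrix units\<close>

lemma supp_iff:
  assumes I: "is_subspace n I" "I \<subseteq> n_hat_pos n" and \<alpha>: "\<alpha> \<in> h_hat_dual n" "\<alpha> \<noteq> 0"
  shows "\<alpha> \<in> supp n I \<longleftrightarrow> (\<exists>x \<in> I \<inter> root_space n \<alpha>. x \<noteq> aff_zero n)"
proof -
  have "aff_zero n \<in> root_space n \<alpha>"
    by (auto simp: root_space_iff sl_hat_def)
  moreover have "aff_zero n \<in> I" using I by (simp add: is_subspace_def)
  ultimately show ?thesis
    unfolding supp_def pos_roots_hat_def roots_of_def using I(2) \<alpha> by blast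
qed

text \<open>Real root spaces are lines, so any nonzero vector of one can be rescaled to the matrix
  unit.\<close>

lemma supp_weight_iff:
  assumes I: "is_subspace n I" "I \<subseteq> n_hat_pos n" and ab: "a < n" "b < n" "a \<noteq> b"
  shows "weight n a b k \<in> supp n I \<longleftrightarrow> tens n (mat_unit n a b) k \<in> I"
proof -
  have w: "weight n a b k \<in> h_hat_dual n" "weight n a b k \<noteq> 0"
    using weight_h_hat_dual weight_nonzero ab by auto
  show ?thesis unfolding supp_iff[OF I w]
  proof
    assume "\<exists>x\<in>I \<inter> root_space n (weight n a b k). x \<noteq> aff_zero n"
    then obtain x where x: "x \<in> I" "x \<in> root_space n (weight n a b k)" "x \<noteq> aff_zero n" by blast
    from root_space_real[OF x(2) ab] obtain z where z: "x = aff_scale z (tens n (mat_unit n a b) k)" .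
    then have "z \<noteq> 0" using x(3) by (auto intro!: affine_eqI eq_matI)
    then have "tens n (mat_unit n a b) k = aff_scale (1 / z) x"
      by (auto simp: z intro!: affine_eqI eq_matI)
    then show "tens n (mat_unit n a b) k \<in> I" using I(1) x(1) by (simp add: is_subspace_def)
  qed (use root_space_tens_mat_unit[OF ab] tens_mat_unit_nonzero[OF ab(1,2)] in blast)
qed

text \<open>Minimality is automatic for the smallest positive integer, and the root space of
  \<open>delta\<close> consists of the traceless diagonal matrices in degree 1.\<close>

lemma has_level_1_iff:
  assumes I: "is_subspace n I" "I \<subseteq> n_hat_pos n" and n: "0 < n"
  shows "has_level n I 1 \<longleftrightarrow> (\<exists>D \<in> sl n. diagonal_mat D \<and> D \<noteq> 0\<^sub>m n n \<and> tens n D 1 \<in> I)"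
proof -
  have w: "delta n \<in> h_hat_dual n" "delta n \<noteq> 0"
    using weight_h_hat_dual[of 0 n 0 1] weight_nonzero[of 0 n 0 1] n by (auto simp: delta_eq[of n 0])
  have "has_level n I 1 \<longleftrightarrow> (\<exists>x \<in> I \<inter> root_space n (delta n). x \<noteq> aff_zero n)"
    unfolding supp_iff[OF I w, symmetric] by (auto simp: has_level_def supp_iff[OF I w])
  also have "\<dots> \<longleftrightarrow> (\<exists>D \<in> sl n. diagonal_mat D \<and> D \<noteq> 0\<^sub>m n n \<and> tens n D 1 \<in> I)"
  proof
    assume "\<exists>x \<in> I \<inter> root_space n (delta n). x \<noteq> aff_zero n"
    then obtain x where x: "x \<in> I" "x \<in> root_space n (delta n)" "x \<noteq> aff_zero n" by blast
    from root_space_delta[OF x(2) n] obtain D where D: "x = tens n D 1" "D \<in> sl n" "diagonal_mat D" .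
    then have "D \<noteq> 0\<^sub>m n n" using x(3) by (auto intro!: affine_eqI)
    then show "\<exists>D \<in> sl n. diagonal_mat D \<and> D \<noteq> 0\<^sub>m n n \<and> tens n D 1 \<in> I" using x D by blast
  next
    assume "\<exists>D \<in> sl n. diagonal_mat D \<and> D \<noteq> 0\<^sub>m n n \<and> tens n D 1 \<in> I"
    then obtain D where D: "D \<in> sl n" "diagonal_mat D" "D \<noteq> 0\<^sub>m n n" "tens n D 1 \<in> I" by blast
    have "tens n D 1 \<noteq> aff_zero n"
    proof
      assume "tens n D 1 = aff_zero n"
      then have "loop (tens n D 1) 1 = loop (aff_zero n) 1" by simp
      then show False using D by simp
    qed
    then show "\<exists>x \<in> I \<inter> root_space n (delta n). x \<noteq> aff_zero n"
      using root_space_tens_diag D by blast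
  qed
  finally show ?thesis .
qed

lemma boxes_of_support:
  assumes I: "is_subspace n I" "I \<subseteq> n_hat_pos n"
  shows "boxes_of_roots n (a_pos n I) = {(a, b). a < b \<and> b < n \<and> tens n (mat_unit n a b) 0 \<in> I}"
    "boxes_of_roots n (a_neg n I) = {(a, b). b < a \<and> a < n \<and> tens n (mat_unit n a b) 1 \<in> I}"
    "boxes_of_roots n (a_pos' n I) = {(a, b). a < b \<and> b < n \<and> tens n (mat_unit n a b) 1 \<in> I}"
    "boxes_of_roots n (a_neg' n I) = {(a, b). b < a \<and> a < n \<and> tens n (mat_unit n a b) 2 \<in> I}"
proof -
  note pos = box_root_pos_roots[unfolded box_root_eq] and neg = box_root_neg_roots[unfolded box_root_eq]
  show "boxes_of_roots n (a_pos n I) = {(a, b). a < b \<and> b < n \<and> tens n (mat_unit n a b) 0 \<in> I}"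
    "boxes_of_roots n (a_neg n I) = {(a, b). b < a \<and> a < n \<and> tens n (mat_unit n a b) 1 \<in> I}"
    "boxes_of_roots n (a_pos' n I) = {(a, b). a < b \<and> b < n \<and> tens n (mat_unit n a b) 1 \<in> I}"
    "boxes_of_roots n (a_neg' n I) = {(a, b). b < a \<and> a < n \<and> tens n (mat_unit n a b) 2 \<in> I}"
    unfolding boxes_of_roots_def a_pos_def a_neg_def a_pos'_def a_neg'_def box_root_eq
      mem_Collect_eq weight_add_delta
    by (auto simp: pos neg supp_weight_iff[OF I])
qed

subsection \<open>Necessary conditions on an ideal of level one\<close>

definition diag_boxes :: "nat \<Rightarrow> (nat \<times> nat) set" where
  "diag_boxes n = {(a, b). a \<le> b \<and> b < n}"

text \<open>
  The vector \<open>v\<close> is the diagonal of a nonzero element of \<open>I \<inter> h \<otimes> t\<close>. The four conditions relating \<open>P\<close> to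
  \<open>Q\<close> and \<open>P'\<close> to \<open>Q'\<close> come from bracketing with the affine simple root vector, the last two clauses
  from the coroots which the roots of \<open>Q\<close> and \<open>P\<close> produce in \<open>I \<inter> h \<otimes> t\<close>.
\<close>

definition level_one_data ::
  "nat \<Rightarrow> (nat \<times> nat) set \<Rightarrow> (nat \<times> nat) set \<Rightarrow> (nat \<times> nat) set \<Rightarrow> (nat \<times> nat) set \<Rightarrow> bool" where
  "level_one_data n P Q P' Q' \<longleftrightarrow>
     up_closed n P \<and> up_closed n Q \<and> up_closed n P' \<and> up_closed n Q' \<and>
     P \<subseteq> {(a, b). a < b} \<and> P' \<subseteq> {(a, b). a < b} \<and> diag_boxes n \<subseteq> Q \<and> diag_boxes n \<subseteq> Q' \<and>
     (\<forall>b. (0, b) \<in> P \<longrightarrow> (n - 1, b) \<in> Q) \<and> (\<forall>a. (a, n - 1) \<in> P \<longrightarrow> (a, 0) \<in> Q) \<and>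
     (\<forall>b. (0, b) \<in> P' \<longrightarrow> (n - 1, b) \<in> Q') \<and> (\<forall>a. (a, n - 1) \<in> P' \<longrightarrow> (a, 0) \<in> Q') \<and>
     (\<exists>v :: nat \<Rightarrow> complex. (\<exists>i<n. v i \<noteq> 0) \<and> (\<Sum>i<n. v i) = 0 \<and>
        (\<forall>i. Suc i < n \<and> v i \<noteq> v (Suc i) \<longrightarrow> (i, Suc i) \<in> P') \<and>
        (v 0 \<noteq> v (n - 1) \<longrightarrow> (n - 1, 0) \<in> Q')) \<and>
     (\<forall>s. (Suc s, s) \<in> Q \<longrightarrow>
        (\<forall>r. Suc r < n \<and> s \<le> Suc r \<and> r \<le> Suc s \<longrightarrow> (r, Suc r) \<in> P') \<and>
        (s = 0 \<or> Suc (Suc s) = n \<longrightarrow> (n - 1, 0) \<in> Q')) \<and>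
     (P \<noteq> {} \<longrightarrow> (0, 1) \<in> P' \<and> (n - 2, n - 1) \<in> P' \<and> (n - 1, 0) \<in> Q')"

lemma mat_unit_commutator_eqI:
  assumes "A \<in> carrier_mat n n" "M \<in> carrier_mat n n" "a < n" "b < n"
    and "\<And>r s. r < n \<Longrightarrow> s < n \<Longrightarrow>
      M $$ (r, s) = (if r = a then A $$ (b, s) else 0) - (if s = b then A $$ (r, a) else 0)"
  shows "mat_unit n a b * A - A * mat_unit n a b = M"
proof (rule eq_matI)
  fix r s assume "r < dim_row M" "s < dim_col M"
  then have rs: "r < n" "s < n" using assms(2) by auto
  then have "(mat_unit n a b * A - A * mat_unit n a b) $$ (r, s) = (mat_unit n a b * A) $$ (r, s) - (A * mat_unit n a b) $$ (r, s)"
    using assms(1) by (intro index_minus_mat) auto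
  then show "(mat_unit n a b * A - A * mat_unit n a b) $$ (r, s) = M $$ (r, s)"
    using mat_unit_mult_index[OF assms(1) rs assms(3,4)] assms(5)[OF rs] by simp
qed (use assms in auto)

lemma mat_unit_bracket:
  assumes "i < n" "j < n" "A \<in> carrier_mat n n" "0 < k \<or> k = 0 \<and> i < j" "i \<noteq> j"
    and I: "is_ideal_of_b_hat n I" "tens n A m \<in> I" "0 \<le> m"
  shows "tens n (mat_unit n i j * A - A * mat_unit n i j) (k + m) \<in> I"
proof -
  have "tens n (mat_unit n i j) k \<in> n_hat_pos n"
    using assms(4,5) by (intro tens_n_hat_pos mat_unit_sl) (auto intro: mat_unit_n_pos)
  then have "aff_bracket n (tens n (mat_unit n i j) k) (tens n A m) \<in> I"
    using I n_hat_pos_b_hat unfolding is_ideal_of_b_hat_def by blast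
  then show ?thesis using assms by (subst (asm) bracket_tens) auto
qed

lemma level_one_dataI:
  assumes n: "1 < n" and I: "is_ideal_of_b_hat n I" "I \<subseteq> n_hat_pos n" "has_level n I 1"
  shows "level_one_data n (boxes_of_roots n (a_pos n I)) (diag_boxes n \<union> boxes_of_roots n (a_neg n I))
     (boxes_of_roots n (a_pos' n I)) (diag_boxes n \<union> boxes_of_roots n (a_neg' n I))"
proof -
  have sub: "is_subspace n I" using I by (simp add: is_ideal_of_b_hat_def)
  define R where "R k a b \<longleftrightarrow> tens n (mat_unit n a b) k \<in> I" for k a b
  have boxes: "boxes_of_roots n (a_pos n I) = {(a, b). a < b \<and> b < n \<and> R 0 a b}"
    "boxes_of_roots n (a_neg n I) = {(a, b). b < a \<and> a < n \<and> R 1 a b}"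
    "boxes_of_roots n (a_pos' n I) = {(a, b). a < b \<and> b < n \<and> R 1 a b}"
    "boxes_of_roots n (a_neg' n I) = {(a, b). b < a \<and> a < n \<and> R 2 a b}"
    unfolding R_def using boxes_of_support[OF sub I(2)] by auto
  have unscale: "R k a b" if "tens n (z \<cdot>\<^sub>m mat_unit n a b) k \<in> I" "z \<noteq> 0" for z k a b
  proof -
    have "tens n (mat_unit n a b) k = aff_scale (1 / z) (tens n (z \<cdot>\<^sub>m mat_unit n a b) k)"
      using that(2) by (auto intro!: affine_eqI eq_matI)
    then show ?thesis using sub that(1) by (simp add: is_subspace_def R_def)
  qed
  have left: "R (k + m) i l"
    if "R m j l" "i < n" "j < n" "l < n" "0 < k \<or> k = 0 \<and> i < j" "i \<noteq> j" "i \<noteq> l" "0 \<le> m" for k m i j l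
  proof -
    have "mat_unit n i j * mat_unit n j l - mat_unit n j l * mat_unit n i j = mat_unit n i l"
      using that by (intro mat_unit_commutator_eqI) auto
    then show ?thesis using mat_unit_bracket[of i n j "mat_unit n j l" k I m] that I(1) by (simp add: R_def)
  qed
  have right: "R (k + m) l j"
    if "R m l i" "i < n" "j < n" "l < n" "0 < k \<or> k = 0 \<and> i < j" "i \<noteq> j" "l \<noteq> j" "0 \<le> m" for k m i j l
  proof -
    have "mat_unit n i j * mat_unit n l i - mat_unit n l i * mat_unit n i j = (- 1) \<cdot>\<^sub>m mat_unit n l j"
      using that by (intro mat_unit_commutator_eqI) auto
    then have "tens n ((- 1) \<cdot>\<^sub>m mat_unit n l j) (k + m) \<in> I"
      using mat_unit_bracket[of i n j "mat_unit n l i" k I m] that I(1) by (simp add: R_def)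
    from unscale[OF this] show ?thesis by simp
  qed
  have coroot: "tens n (coroot_mat n i j) (k + m) \<in> I"
    if "R m j i" "i < n" "j < n" "0 < k \<or> k = 0 \<and> i < j" "i \<noteq> j" "0 \<le> m" for k m i j
  proof -
    have "mat_unit n i j * mat_unit n j i - mat_unit n j i * mat_unit n i j = coroot_mat n i j"
      using that by (intro mat_unit_commutator_eqI) (auto simp: coroot_mat_index)
    then show ?thesis using mat_unit_bracket[of i n j "mat_unit n j i" k I m] that I(1) by (simp add: R_def)
  qed
  have diag: "R (k + m) i j"
    if "tens n D m \<in> I" "D \<in> carrier_mat n n" "diagonal_mat D" "D $$ (i, i) \<noteq> D $$ (j, j)"
      "i < n" "j < n" "0 < k \<or> k = 0 \<and> i < j" "i \<noteq> j" "0 \<le> m" for k m i j D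
  proof -
    have "mat_unit n i j * D - D * mat_unit n i j = (D $$ (j, j) - D $$ (i, i)) \<cdot>\<^sub>m mat_unit n i j"
      using that by (intro mat_unit_commutator_eqI) (auto simp: diagonal_mat_def)
    then have "tens n ((D $$ (j, j) - D $$ (i, i)) \<cdot>\<^sub>m mat_unit n i j) (k + m) \<in> I"
      using mat_unit_bracket[of i n j D k I m] that I(1) by simp
    from unscale[OF this] that show ?thesis by simp
  qed
  have coroot_diag: "diagonal_mat (coroot_mat n a b)" for a b
    by (auto simp: diagonal_mat_def coroot_mat_index carrier_matD[OF coroot_mat_carrier])
  \<comment> \<open>The route goes up column \<open>b\<close> and then along row \<open>a'\<close>.
    The implication forbids starting below the diagonal and ending above it, and thereby keeps the
    corner \<open>(a', b)\<close> of the route off the diagonal, where there is no root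
    vector.\<close>
  have move: "R m a' b'" if "R m a b" "a' \<le> a" "b \<le> b'" "a < n" "b' < n" "a \<noteq> b"
      "a' < b' \<Longrightarrow> a < b" "a' \<noteq> b'" "0 \<le> m" for m a b a' b'
  proof -
    have "a' \<noteq> b" using that by auto
    then have "R m a' b"
      using that left[of m a b a' 0] by (cases "a' = a") auto
    then show ?thesis
      using that \<open>a' \<noteq> b\<close> right[of m a' b b' 0] by (cases "b' = b") auto
  qed
  have up_pos: "up_closed n {(a, b). a < b \<and> b < n \<and> R m a b}" if "0 \<le> m" for m
    unfolding up_closed_def using move[of m] that by (auto 0 3)
  have up_neg: "up_closed n (diag_boxes n \<union> {(a, b). b < a \<and> a < n \<and> R m a b})" if "0 \<le> m" for m
    unfolding up_closed_def
  proof (intro conjI allI impI)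
    fix a b a' b'
    assume *: "(a, b) \<in> diag_boxes n \<union> {(a, b). b < a \<and> a < n \<and> R m a b} \<and> a' \<le> a \<and> b \<le> b' \<and> b' < n"
    show "(a', b') \<in> diag_boxes n \<union> {(a, b). b < a \<and> a < n \<and> R m a b}"
    proof (cases "a' \<le> b'")
      case False
      then have "R m a b" "a < n" "a \<noteq> b" using * by (auto simp: diag_boxes_def)
      then show ?thesis using move[of m a b a' b'] * False that by auto
    qed (use * in \<open>auto simp: diag_boxes_def\<close>)
  qed (auto simp: diag_boxes_def)
  obtain D where D: "D \<in> sl n" "diagonal_mat D" "D \<noteq> 0\<^sub>m n n" "tens n D 1 \<in> I"
    using I(3) has_level_1_iff[OF sub I(2)] n by auto
  have Dc: "D \<in> carrier_mat n n" using D sl_carrier by blast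
  \<comment> \<open>For \<open>b = n - 1\<close> the bracket would be a coroot, but the resulting
    box \<open>(n - 1, n - 1)\<close> is in \<open>diag_boxes\<close> anyway. The same happens at
    \<open>(0, 0)\<close> in the mirror image.\<close>
  have e0_left: "R (m + 1) (n - 1) b" if "R m 0 b" "b < n - 1" "0 \<le> m" for m b
    using left[of m 0 b "n - 1" 1] that n by (simp add: add.commute)
  have e0_right: "R (m + 1) a 0" if "R m a (n - 1)" "0 < a" "a < n" "0 \<le> m" for m a
    using right[of m a "n - 1" 0 1] that n by (simp add: add.commute)
  \<comment> \<open>Bracketing with the opposite simple root vector puts a simple coroot into degree
    1. It is nonzero on its own simple root and on the neighbours in the Dynkin diagram, and on the
    highest root if it sits at an end of the diagram.\<close>
  have lower: "(\<forall>r. Suc r < n \<and> s \<le> Suc r \<and> r \<le> Suc s \<longrightarrow> R 1 r (Suc r)) \<and>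
      (s = 0 \<or> Suc (Suc s) = n \<longrightarrow> R 2 (n - 1) 0)" if s: "R 1 (Suc s) s" "Suc s < n" for s
  proof -
    have c: "tens n (coroot_mat n s (Suc s)) 1 \<in> I"
      using coroot[of 1 "Suc s" s 0] s by simp
    have "R 1 r (Suc r)" if "Suc r < n" "s \<le> Suc r" "r \<le> Suc s" for r
      using diag[OF c coroot_mat_carrier coroot_diag, of r "Suc r" 0] that s
      by (auto simp: coroot_mat_index)
    moreover have "R 2 (n - 1) 0" if "s = 0 \<or> Suc (Suc s) = n"
      using diag[OF c coroot_mat_carrier coroot_diag, of "n - 1" 0 1] that s
      by (auto simp: coroot_mat_index)
    ultimately show ?thesis by blast
  qed
  have P_nonempty: "R 1 0 1 \<and> R 1 (n - 2) (n - 1) \<and> R 2 (n - 1) 0"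
    if ab: "a < b" "b < n" "R 0 a b" for a b
  proof -
    \<comment> \<open>Any root in degree 0 can be raised to the highest root. The affine simple root
      vector turns that one into the highest coroot in degree 1, which is nonzero on the first, the
      last and the highest root.\<close>
    have "R 0 0 (n - 1)" using move[of 0 a b 0 "n - 1"] ab by auto
    then have c: "tens n (coroot_mat n (n - 1) 0) 1 \<in> I"
      using coroot[of 0 0 "n - 1" 1] n by simp
    show ?thesis
      using diag[OF c coroot_mat_carrier coroot_diag, of 0 1 0]
        diag[OF c coroot_mat_carrier coroot_diag, of "n - 2" "n - 1" 0]
        diag[OF c coroot_mat_carrier coroot_diag, of "n - 1" 0 1] n
      by (auto simp: coroot_mat_index split: if_splits)
  qed
  define v where "v i = D $$ (i, i)" for i
  have v: "\<exists>i<n. v i \<noteq> 0" "(\<Sum>i<n. v i) = 0"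
    "\<And>i. Suc i < n \<Longrightarrow> v i \<noteq> v (Suc i) \<Longrightarrow> R 1 i (Suc i)"
    "v 0 \<noteq> v (n - 1) \<Longrightarrow> R 2 (n - 1) 0"
  proof -
    show "\<exists>i<n. v i \<noteq> 0"
    proof (rule ccontr)
      assume "\<not> ?thesis"
      then have "D = 0\<^sub>m n n" using D(2) Dc by (intro eq_matI) (auto simp: v_def diagonal_mat_def)
      then show False using D by simp
    qed
    show "(\<Sum>i<n. v i) = 0" using D(1) trace_eq[OF Dc] by (simp add: v_def sl_def)
    show "R 1 i (Suc i)" if "Suc i < n" "v i \<noteq> v (Suc i)" for i
      using diag[OF D(4) Dc D(2), of i "Suc i" 0] that by (simp add: v_def)
    show "R 2 (n - 1) 0" if "v 0 \<noteq> v (n - 1)"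
      using diag[OF D(4) Dc D(2), of "n - 1" 0 1] that n by (auto simp: v_def)
  qed
  show ?thesis
    unfolding level_one_data_def boxes
  proof (intro conjI)
    show "\<exists>v :: nat \<Rightarrow> complex. (\<exists>i<n. v i \<noteq> 0) \<and> (\<Sum>i<n. v i) = 0 \<and>
        (\<forall>i. Suc i < n \<and> v i \<noteq> v (Suc i) \<longrightarrow> (i, Suc i) \<in> {(a, b). a < b \<and> b < n \<and> R 1 a b}) \<and>
        (v 0 \<noteq> v (n - 1) \<longrightarrow> (n - 1, 0) \<in> diag_boxes n \<union> {(a, b). b < a \<and> a < n \<and> R 2 a b})"
      using v n by (intro exI[of _ v]) auto
  qed (use up_pos up_neg e0_left[of 0] e0_left[of 1] e0_right[of 0] e0_right[of 1] lower P_nonempty n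
      in \<open>auto simp: diag_boxes_def\<close>)
qed

subsection \<open>The ideal with prescribed boxes\<close>

lemma commutator_index:
  fixes A B :: "complex mat"
  assumes "A \<in> carrier_mat n n" "B \<in> carrier_mat n n" "r < n" "s < n"
  shows "(A * B - B * A) $$ (r, s) = (\<Sum>j<n. A $$ (r, j) * B $$ (j, s) - B $$ (r, j) * A $$ (j, s))"
proof -
  have "(A * B - B * A) $$ (r, s) = (A * B) $$ (r, s) - (B * A) $$ (r, s)"
    using assms by (intro index_minus_mat) auto
  then show ?thesis
    unfolding mult_index[OF assms] mult_index[OF assms(2,1,3,4)] by (simp add: sum_subtractf)
qed

lemma sum_commutator_diag:
  fixes A B :: "complex mat"
  assumes "A \<in> carrier_mat n n" "B \<in> carrier_mat n n"
  shows "(\<Sum>r<n. (A * B - B * A) $$ (r, r)) = 0"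
proof -
  have "(\<Sum>r<n. (A * B - B * A) $$ (r, r)) =
      (\<Sum>r<n. \<Sum>j<n. A $$ (r, j) * B $$ (j, r)) - (\<Sum>r<n. \<Sum>j<n. B $$ (r, j) * A $$ (j, r))"
    using assms by (simp add: commutator_index sum_subtractf del: index_minus_mat(1))
  also have "(\<Sum>r<n. \<Sum>j<n. B $$ (r, j) * A $$ (j, r)) = (\<Sum>r<n. \<Sum>j<n. A $$ (r, j) * B $$ (j, r))"
    by (subst sum.swap) (simp add: mult.commute)
  finally show ?thesis by simp
qed

lemma sl_sum_diag: "A \<in> sl n \<Longrightarrow> (\<Sum>r<n. A $$ (r, r)) = 0"
  using trace_eq[of A n] by (simp add: sl_def)

lemma telescope_neq:
  fixes y :: "nat \<Rightarrow> 'a"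
  assumes "r \<le> s" "y r \<noteq> y s"
  obtains k where "r \<le> k" "k < s" "y k \<noteq> y (Suc k)"
proof -
  have "\<exists>k\<ge>r. k < s \<and> y k \<noteq> y (Suc k)"
    using assms
  proof (induction s rule: dec_induct)
    case (step m)
    then show ?case by (cases "y r = y m") (auto simp: less_Suc_eq)
  qed simp
  then show thesis using that by blast
qed

locale level_one =
  fixes n :: nat and P Q P' Q' :: "(nat \<times> nat) set"
  assumes n: "1 < n" and data: "level_one_data n P Q P' Q'"
begin

text \<open>Degree 1 has to distinguish the two sides of the diagonal, because \<open>Q\<close>
  contains every box above it by convention. Diagonal positions are open from degree 1 on;
  \<open>admissible\<close> restricts them in degree 1, and degree 0 has none since \<open>P\<close>
  is strictly upper triangular.\<close>

definition allowed :: "int \<Rightarrow> nat \<Rightarrow> nat \<Rightarrow> bool" where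
  "allowed k a b \<longleftrightarrow> k = 0 \<and> (a, b) \<in> P \<or> k = 1 \<and> (if a < b then (a, b) \<in> P' else (a, b) \<in> Q)
     \<or> k = 2 \<and> (a, b) \<in> Q' \<or> 3 \<le> k"

text \<open>For \<open>r\<close> good, row and column \<open>r\<close> are unrestricted on the positive side in degree \<open>1\<close> and from
  degree \<open>2\<close> on.\<close>

definition good :: "nat \<Rightarrow> bool" where
  "good r \<longleftrightarrow> (Suc r < n \<longrightarrow> (r, Suc r) \<in> P') \<and> (0 < r \<longrightarrow> (r - 1, r) \<in> P') \<and>
     (r = 0 \<or> Suc r = n \<longrightarrow> (n - 1, 0) \<in> Q')"

definition admissible :: "(nat \<Rightarrow> complex) \<Rightarrow> bool" where
  "admissible v \<longleftrightarrow> (\<forall>i. Suc i < n \<and> v i \<noteq> v (Suc i) \<longrightarrow> (i, Suc i) \<in> P') \<and>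
     (v 0 \<noteq> v (n - 1) \<longrightarrow> (n - 1, 0) \<in> Q')"

text \<open>
  The largest ideal with the given data: in degree \<open>1\<close> its Cartan part is cut out by all equations
  that the data force, and nothing is imposed beyond degree \<open>2\<close>.
\<close>

definition the_ideal :: "affine set" where
  "the_ideal = {x \<in> n_hat_pos n. (\<forall>k. \<forall>a<n. \<forall>b<n. loop x k $$ (a, b) \<noteq> 0 \<longrightarrow> allowed k a b) \<and>
     admissible (\<lambda>i. loop x 1 $$ (i, i))}"

lemma data_parts:
  shows up: "up_closed n P" "up_closed n Q" "up_closed n P'" "up_closed n Q'"
    and sub: "P \<subseteq> {(a, b). a < b}" "P' \<subseteq> {(a, b). a < b}" "diag_boxes n \<subseteq> Q" "diag_boxes n \<subseteq> Q'"
    and e0: "\<forall>b. (0, b) \<in> P \<longrightarrow> (n - 1, b) \<in> Q" "\<forall>a. (a, n - 1) \<in> P \<longrightarrow> (a, 0) \<in> Q"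
      "\<forall>b. (0, b) \<in> P' \<longrightarrow> (n - 1, b) \<in> Q'" "\<forall>a. (a, n - 1) \<in> P' \<longrightarrow> (a, 0) \<in> Q'"
    and cartan: "\<exists>v :: nat \<Rightarrow> complex. (\<exists>i<n. v i \<noteq> 0) \<and> (\<Sum>i<n. v i) = 0 \<and>
        (\<forall>i. Suc i < n \<and> v i \<noteq> v (Suc i) \<longrightarrow> (i, Suc i) \<in> P') \<and>
        (v 0 \<noteq> v (n - 1) \<longrightarrow> (n - 1, 0) \<in> Q')"
    and adjacent: "\<forall>s. (Suc s, s) \<in> Q \<longrightarrow>
        (\<forall>r. Suc r < n \<and> s \<le> Suc r \<and> r \<le> Suc s \<longrightarrow> (r, Suc r) \<in> P') \<and>
        (s = 0 \<or> Suc (Suc s) = n \<longrightarrow> (n - 1, 0) \<in> Q')"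
    and nonempty: "P \<noteq> {} \<longrightarrow> (0, 1) \<in> P' \<and> (n - 2, n - 1) \<in> P' \<and> (n - 1, 0) \<in> Q'"
  using data unfolding level_one_data_def by - (elim conjE, assumption)+

section \<open>How boxes propagate between the four sets\<close>

lemma P_up: "(a, b) \<in> P \<Longrightarrow> a' \<le> a \<Longrightarrow> b \<le> b' \<Longrightarrow> b' < n \<Longrightarrow> (a', b') \<in> P"
  and Q_up: "(a, b) \<in> Q \<Longrightarrow> a' \<le> a \<Longrightarrow> b \<le> b' \<Longrightarrow> b' < n \<Longrightarrow> (a', b') \<in> Q"
  and P'_up: "(a, b) \<in> P' \<Longrightarrow> a' \<le> a \<Longrightarrow> b \<le> b' \<Longrightarrow> b' < n \<Longrightarrow> (a', b') \<in> P'"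
  and Q'_up: "(a, b) \<in> Q' \<Longrightarrow> a' \<le> a \<Longrightarrow> b \<le> b' \<Longrightarrow> b' < n \<Longrightarrow> (a', b') \<in> Q'"
  using up_closedD up by blast+

lemma admissible_combination:
  assumes v: "admissible v" and w: "admissible w" and u: "\<And>i. i < n \<Longrightarrow> u i = a * v i + b * w i"
  shows "admissible u"
  unfolding admissible_def
proof (intro conjI allI impI)
  fix i assume i: "Suc i < n \<and> u i \<noteq> u (Suc i)"
  then have "v i \<noteq> v (Suc i) \<or> w i \<noteq> w (Suc i)" using u[of i] u[of "Suc i"] by auto
  then show "(i, Suc i) \<in> P'" using v w i unfolding admissible_def by blast
next
  assume "u 0 \<noteq> u (n - 1)"
  moreover have "u 0 = a * v 0 + b * w 0" "u (n - 1) = a * v (n - 1) + b * w (n - 1)"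
    using n by (intro u; simp)+
  ultimately have "v 0 \<noteq> v (n - 1) \<or> w 0 \<noteq> w (n - 1)" by metis
  then show "(n - 1, 0) \<in> Q'" using v w unfolding admissible_def by blast
qed

lemma P_less: "(a, b) \<in> P \<Longrightarrow> a < b \<and> b < n"
  and P'_less: "(a, b) \<in> P' \<Longrightarrow> a < b \<and> b < n"
  and Q_less: "(a, b) \<in> Q \<Longrightarrow> a < n \<and> b < n"
  and Q'_less: "(a, b) \<in> Q' \<Longrightarrow> a < n \<and> b < n"
  using up sub unfolding up_closed_def by auto

lemma Q_diag: "a \<le> b \<Longrightarrow> b < n \<Longrightarrow> (a, b) \<in> Q"
  and Q'_diag: "a \<le> b \<Longrightarrow> b < n \<Longrightarrow> (a, b) \<in> Q'"
  using sub unfolding diag_boxes_def by auto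

text \<open>Move up to the first row, jump to the last row of \<open>Q\<close> by the affine simple
  root, and move up again: one box of \<open>P\<close> fills its whole column of \<open>Q\<close>.
  In the same way it fills its row, and \<open>P'\<close> acts so on \<open>Q'\<close>.\<close>

lemma P_Q_left: "(a, b) \<in> P \<Longrightarrow> r < n \<Longrightarrow> (r, b) \<in> Q"
  using e0 P_up[of a b 0 b] P_less[of a b] Q_up[of "n - 1" b r b] by auto

lemma P_Q_right: "(a, b) \<in> P \<Longrightarrow> s < n \<Longrightarrow> (a, s) \<in> Q"
  using e0 P_up[of a b a "n - 1"] P_less[of a b] Q_up[of a 0 a s] by auto

lemma P'_Q'_left: "(a, b) \<in> P' \<Longrightarrow> r < n \<Longrightarrow> (r, b) \<in> Q'"
  using e0 P'_up[of a b 0 b] P'_less[of a b] Q'_up[of "n - 1" b r b] by auto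

lemma P'_Q'_right: "(a, b) \<in> P' \<Longrightarrow> s < n \<Longrightarrow> (a, s) \<in> Q'"
  using e0 P'_up[of a b a "n - 1"] P'_less[of a b] Q'_up[of a 0 a s] by auto

lemma corner_Q': "(n - 1, 0) \<in> Q' \<Longrightarrow> a < n \<Longrightarrow> b < n \<Longrightarrow> (a, b) \<in> Q'"
  using Q'_up[of "n - 1" 0 a b] by auto

lemma P_nonempty: "(a, b) \<in> P \<Longrightarrow> (0, 1) \<in> P' \<and> (n - 2, n - 1) \<in> P' \<and> (n - 1, 0) \<in> Q'"
  using nonempty by blast

lemma Q_adjacent:
  assumes "(Suc s, s) \<in> Q"
  shows "Suc r < n \<Longrightarrow> s \<le> Suc r \<Longrightarrow> r \<le> Suc s \<Longrightarrow> (r, Suc r) \<in> P'"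
    "s = 0 \<or> Suc (Suc s) = n \<Longrightarrow> (n - 1, 0) \<in> Q'"
  using adjacent assms by blast+

text \<open>The staircase below a box \<open>(a, b)\<close> under the diagonal contains the
  subdiagonal boxes in row \<open>a\<close> and in column \<open>b\<close>. The clause on negative
  simple roots at these two boxes gives all that \<open>good\<close> asks for.\<close>

lemma Q_good:
  assumes "(a, b) \<in> Q" "b < a"
  shows "good a" "good b"
proof -
  have an: "a < n" using assms Q_less by blast
  have b: "(Suc b, b) \<in> Q" using Q_up[OF assms(1), of "Suc b" b] assms an by auto
  obtain c where c: "a = Suc c" using assms by (cases a) auto
  have a: "(Suc c, c) \<in> Q" using Q_up[OF assms(1), of a c] assms an c by auto
  show "good b" unfolding good_def
    using Q_adjacent(1)[OF b, of b] Q_adjacent(1)[OF b, of "b - 1"] Q_adjacent(2)[OF b] assms an by auto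
  show "good a" unfolding good_def
    using Q_adjacent(1)[OF a, of a] Q_adjacent(1)[OF a, of c] Q_adjacent(2)[OF a] c an by auto
qed

text \<open>A box \<open>(a, b)\<close> of \<open>P\<close> fills row \<open>a\<close> of
  \<open>Q\<close>, so for \<open>a > 0\<close> the box \<open>(a, 0)\<close> lies under the
  diagonal and \<open>Q_good\<close> applies. For \<open>a = 0\<close> that box is diagonal and says
  nothing; there the clause for nonempty \<open>P\<close> takes over. Column \<open>b\<close> is
  symmetric, with exception \<open>b = n - 1\<close>.\<close>

lemma P_good:
  assumes "(a, b) \<in> P"
  shows "good a" "good b"
proof -
  have ab: "a < b" "b < n" using P_less assms by auto
  have ne: "(0, 1) \<in> P'" "(n - 2, n - 1) \<in> P'" "(n - 1, 0) \<in> Q'" using P_nonempty[OF assms] by auto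
  show "good a"
  proof (cases "a = 0")
    case True
    then show ?thesis using ne ab by (auto simp: good_def)
  next
    case False
    then show ?thesis using Q_good(1)[of a 0] P_Q_right[OF assms, of 0] n by auto
  qed
  show "good b"
  proof (cases "b = n - 1")
    case True
    then show ?thesis using ne ab by (auto simp: good_def numeral_2_eq_2)
  next
    case False
    then show ?thesis using Q_good(2)[of "n - 1" b] P_Q_left[OF assms, of "n - 1"] ab by auto
  qed
qed

lemma good_P':
  assumes "good r" "r < n" "s < n" 
  shows "r < s \<Longrightarrow> (r, s) \<in> P'" "s < r \<Longrightarrow> (s, r) \<in> P'"
  using assms P'_up[of r "Suc r" r s] P'_up[of "r - 1" r s r] by (auto simp: good_def)

text \<open>The box of \<open>P'\<close> next to the diagonal in row \<open>r\<close> fills row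
  \<open>r\<close> of \<open>Q'\<close>. The last row and the first column have no such neighbour;
  this is why \<open>good\<close> contains the corner condition at both ends.\<close>

lemma good_Q':
  assumes "good r" "r < n" "s < n"
  shows "(r, s) \<in> Q'" "(s, r) \<in> Q'"
proof -
  show "(r, s) \<in> Q'"
    using assms corner_Q'[of r s] P'_Q'_right[of r "Suc r" s] unfolding good_def by (cases "Suc r = n") auto
  show "(s, r) \<in> Q'"
    using assms corner_Q'[of s r] P'_Q'_left[of "r - 1" r s] unfolding good_def by (cases "r = 0") auto
qed

lemma good_allowed:
  assumes "good r" "r < n" "s < n" "r \<noteq> s" "1 \<le> k" "k = 1 \<Longrightarrow> (r, s) \<in> Q"
  shows "allowed k r s"
  using assms good_P'[of r s] good_Q'[of r s] unfolding allowed_def by auto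

lemma good_allowed':
  assumes "good s" "r < n" "s < n" "r \<noteq> s" "1 \<le> k" "k = 1 \<Longrightarrow> (r, s) \<in> Q"
  shows "allowed k r s"
  using assms good_P'[of s r] good_Q'[of s r] unfolding allowed_def by auto

text \<open>The contribution of an entry \<open>(r, j)\<close> of degree \<open>k\<close> in the
  Borel algebra times an entry \<open>(j, s)\<close> of degree \<open>l\<close>. All three matrix
  positions \<open>(r, s)\<close>, \<open>(j, s)\<close> of the ideal are kept off the diagonal
  here, because the Cartan part obeys equations instead of membership in a set of boxes.\<close>

lemma allowed_left:
  assumes allowed: "allowed l j s" and "j < n" "s < n" "r < n" "j \<noteq> s" "r \<noteq> s" and k: "k = 0 \<and> r \<le> j \<or> 1 \<le> k"
  shows "allowed (k + l) r s"
proof -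
  consider "l = 0" "(j, s) \<in> P" | "l = 1" "j < s" "(j, s) \<in> P'" | "l = 1" "s < j" "(j, s) \<in> Q"
    | "l = 2" "(j, s) \<in> Q'" | "3 \<le> l"
    using allowed assms(5) unfolding allowed_def by (auto split: if_splits)
  then show ?thesis
  proof cases
    case 1
    show ?thesis
    proof (cases "k = 0")
      case True
      then show ?thesis using 1 k P_up[of j s r s] assms by (auto simp: allowed_def)
    next
      case False
      then show ?thesis using 1 k good_allowed'[of s r k] P_good(2)[of j s] P_Q_left[of j s r] assms by auto
    qed
  next
    case 2
    then show ?thesis using k P'_up[of j s r s] P'_Q'_left[of j s r] assms by (auto simp: allowed_def)
  next
    case 3
    \<comment> \<open>In degree 1 the product may cross the diagonal and land in the region governed
      by \<open>P'\<close>, which monotonicity of \<open>Q\<close> does not control; goodness of the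
      column does.\<close>
    have "good s" using 3 Q_good by blast
    then show ?thesis using 3 k good_allowed'[of s r "k + l"] Q_up[of j s r s] assms by auto
  next
    case 4
    then show ?thesis using k Q'_up[of j s r s] assms by (auto simp: allowed_def)
  next
    case 5
    then show ?thesis using k by (auto simp: allowed_def)
  qed
qed

lemma allowed_right:
  assumes allowed: "allowed l r j" and "j < n" "s < n" "r < n" "r \<noteq> j" "r \<noteq> s" and k: "k = 0 \<and> j \<le> s \<or> 1 \<le> k"
  shows "allowed (k + l) r s"
proof -
  consider "l = 0" "(r, j) \<in> P" | "l = 1" "r < j" "(r, j) \<in> P'" | "l = 1" "j < r" "(r, j) \<in> Q"
    | "l = 2" "(r, j) \<in> Q'" | "3 \<le> l"
    using allowed assms(5) unfolding allowed_def by (auto split: if_splits)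
  then show ?thesis
  proof cases
    case 1
    show ?thesis
    proof (cases "k = 0")
      case True
      then show ?thesis using 1 k P_up[of r j r s] assms by (auto simp: allowed_def)
    next
      case False
      then show ?thesis using 1 k good_allowed[of r s k] P_good(1)[of r j] P_Q_right[of r j s] assms by auto
    qed
  next
    case 2
    then show ?thesis using k P'_up[of r j r s] P'_Q'_right[of r j s] assms by (auto simp: allowed_def)
  next
    case 3
    have "good r" using 3 Q_good by blast
    then show ?thesis using 3 k good_allowed[of r s "k + l"] Q_up[of r j r s] assms by auto
  next
    case 4
    then show ?thesis using k Q'_up[of r j r s] assms by (auto simp: allowed_def)
  next
    case 5
    then show ?thesis using k by (auto simp: allowed_def)
  qed
qed

text \<open>With total degree 1 a coroot can arise only from a root in \<open>P\<close> against
  degree 1, or from a negative root in \<open>Q\<close> against degree 0. Both indices of such a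
  coroot are good.\<close>

lemma allowed_diag_good:
  assumes "allowed l a b" "a < n" "b < n" "a \<noteq> b" "k + l = 1" "k = 0 \<and> b \<le> a \<or> 1 \<le> k"
  shows "good a" "good b"
proof -
  have "l = 0 \<and> (a, b) \<in> P \<or> l = 1 \<and> b < a \<and> (a, b) \<in> Q"
    using assms unfolding allowed_def by auto
  then show "good a" "good b" using P_good Q_good by blast+
qed

text \<open>A difference \<open>v r \<noteq> v s\<close> contains a jump between neighbours, hence a
  box of \<open>P'\<close> that reaches \<open>(r, s)\<close> if \<open>r < s\<close>. Under the
  diagonal, if the corner of \<open>Q'\<close> is missing, then \<open>v 0 = v (n - 1)\<close>. So
  \<open>v 0\<close> differs from \<open>v s\<close>, or \<open>v r\<close> from
  \<open>v (n - 1)\<close>, and the resulting box of \<open>P'\<close> fills column \<open>s\<close>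
  or row \<open>r\<close> of \<open>Q'\<close>.\<close>

lemma admissible_allowed:
  assumes v: "admissible v" and "r < n" "s < n" "v r \<noteq> v s" and k: "k = 0 \<and> r < s \<or> 1 \<le> k"
  shows "allowed (k + 1) r s"
proof -
  have up: "(r, s) \<in> P'" if rs: "r < s" "s < n" "v r \<noteq> v s" for r s
  proof -
    obtain i where i: "r \<le> i" "i < s" "v i \<noteq> v (Suc i)" using telescope_neq[of r s v] rs by auto
    then have "(i, Suc i) \<in> P'" using v rs unfolding admissible_def by auto
    then show ?thesis using P'_up[of i "Suc i" r s] i rs by auto
  qed
  have Q': "(r, s) \<in> Q'" if "s < r"
  proof (cases "(n - 1, 0) \<in> Q'")
    case True
    then show ?thesis using corner_Q' assms by blast
  next
    case False
    then have "v 0 = v (n - 1)" using v unfolding admissible_def by auto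
    then consider "v 0 \<noteq> v s" | "v r \<noteq> v (n - 1)" using assms by metis
    then show ?thesis
    proof cases
      case 1
      then have "(0, s) \<in> P'" using up[of 0 s] assms by (cases "s = 0") auto
      then show ?thesis using P'_Q'_left assms by blast
    next
      case 2
      then have "(r, n - 1) \<in> P'" using up[of r "n - 1"] assms by (cases "r = n - 1") auto
      then show ?thesis using P'_Q'_right assms by blast
    qed
  qed
  consider "r < s" | "s < r" using assms(4) by (metis nat_neq_iff)
  then show ?thesis
    using k up[of r s] Q' Q'_diag[of r s] assms unfolding allowed_def by cases auto
qed

text \<open>If \<open>(r, s)\<close> were not allowed, all products with an off-diagonal entry of
  \<open>B\<close> would vanish. What is left is \<open>A $$ (r, s)\<close> times a difference of
  two diagonal entries of \<open>B\<close>, which is the situation of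
  \<open>admissible_allowed\<close> for \<open>l = 1\<close> and harmless for larger
  \<open>l\<close>.\<close>

lemma commutator_allowed:
  assumes c: "A \<in> carrier_mat n n" "B \<in> carrier_mat n n"
    and A: "\<And>r s. r < n \<Longrightarrow> s < n \<Longrightarrow> A $$ (r, s) \<noteq> 0 \<Longrightarrow> k = 0 \<and> r \<le> s \<or> 1 \<le> k"
    and B: "\<And>r s. r < n \<Longrightarrow> s < n \<Longrightarrow> B $$ (r, s) \<noteq> 0 \<Longrightarrow> allowed l r s"
    and bal: "l = 1 \<Longrightarrow> admissible (\<lambda>i. B $$ (i, i))"
    and rs: "r < n" "s < n" "r \<noteq> s" and nz: "(A * B - B * A) $$ (r, s) \<noteq> 0"
  shows "allowed (k + l) r s"
proof (rule ccontr)
  assume no: "\<not> allowed (k + l) r s"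
  have 1: "A $$ (r, j) * B $$ (j, s) = 0" if "j < n" "j \<noteq> s" for j
    using A[of r j] B[of j s] allowed_left[of l j s r k] that rs no by auto
  have 2: "B $$ (r, j) * A $$ (j, s) = 0" if "j < n" "j \<noteq> r" for j
    using A[of j s] B[of r j] allowed_right[of l r j s k] that rs no by auto
  have "(A * B - B * A) $$ (r, s) = (\<Sum>j<n. (if j = s then A $$ (r, s) * B $$ (s, s) else 0)
      - (if j = r then B $$ (r, r) * A $$ (r, s) else 0))"
    unfolding commutator_index[OF c rs(1,2)]
  proof (intro sum.cong refl)
    fix j assume "j \<in> {..<n}"
    then show "A $$ (r, j) * B $$ (j, s) - B $$ (r, j) * A $$ (j, s) =
        (if j = s then A $$ (r, s) * B $$ (s, s) else 0) - (if j = r then B $$ (r, r) * A $$ (r, s) else 0)"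
      using 1[of j] 2[of j] rs(3) by (cases "j = s"; cases "j = r") (auto simp del: mult_eq_0_iff)
  qed
  also have "\<dots> = A $$ (r, s) * (B $$ (s, s) - B $$ (r, r))"
    using rs by (simp add: sum_subtractf algebra_simps)
  finally have nz: "A $$ (r, s) \<noteq> 0" "B $$ (r, r) \<noteq> B $$ (s, s)" using nz by auto
  have k: "k = 0 \<and> r < s \<or> 1 \<le> k" using A[OF rs(1,2) nz(1)] rs by auto
  have "allowed l r r \<or> allowed l s s" using nz B rs by (metis (full_types))
  then consider "l = 1" | "2 \<le> l" using P_less by (force simp: allowed_def)
  then show False
  proof cases
    case 1
    then show False using admissible_allowed[OF bal rs(1,2) nz(2) k] no by simp
  next
    case 2
    then show False using k no Q'_diag[of r s] rs by (auto simp: allowed_def)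
  qed
qed

text \<open>Diagonal entries of \<open>B\<close> cancel in a diagonal entry of the commutator, so
  only products of opposite off-diagonal entries matter, and those need a good index.\<close>

lemma commutator_diag_good:
  fixes A B :: "complex mat"
  assumes c: "A \<in> carrier_mat n n" "B \<in> carrier_mat n n"
    and A: "\<And>r s. r < n \<Longrightarrow> s < n \<Longrightarrow> A $$ (r, s) \<noteq> 0 \<Longrightarrow> k = 0 \<and> r \<le> s \<or> 1 \<le> k"
    and B: "\<And>r s. r < n \<Longrightarrow> s < n \<Longrightarrow> B $$ (r, s) \<noteq> 0 \<Longrightarrow> allowed l r s"
    and kl: "k + l = 1" and r: "r < n" and nz: "(A * B - B * A) $$ (r, r) \<noteq> 0"
  shows "good r"
proof (rule ccontr)
  assume no: "\<not> good r"
  have 1: "A $$ (r, j) * B $$ (j, r) = 0" if "j < n" "j \<noteq> r" for j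
    using A[of r j] B[of j r] allowed_diag_good(2)[of l j r k] that r no kl
    by (cases "A $$ (r, j) = 0"; cases "B $$ (j, r) = 0") auto
  have 2: "B $$ (r, j) * A $$ (j, r) = 0" if "j < n" "j \<noteq> r" for j
    using A[of j r] B[of r j] allowed_diag_good(1)[of l r j k] that r no kl
    by (cases "A $$ (j, r) = 0"; cases "B $$ (r, j) = 0") auto
  have "(A * B - B * A) $$ (r, r) = 0"
    unfolding commutator_index[OF c r r]
  proof (intro sum.neutral ballI)
    fix j assume "j \<in> {..<n}"
    then show "A $$ (r, j) * B $$ (j, r) - B $$ (r, j) * A $$ (j, r) = 0"
      using 1[of j] 2[of j] by (cases "j = r") (simp_all del: mult_eq_0_iff)
  qed
  then show False using nz by simp
qed

section \<open>The constructed set is an ideal of level one with the prescribed boxes\<close>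

lemma b_hat_loop:
  assumes "x \<in> b_hat n"
  shows "loop x k \<in> carrier_mat n n" "finite {k. loop x k \<noteq> 0\<^sub>m n n}"
    "r < n \<Longrightarrow> s < n \<Longrightarrow> loop x k $$ (r, s) \<noteq> 0 \<Longrightarrow> k = 0 \<and> r \<le> s \<or> 1 \<le> k"
proof -
  obtain h y where x: "x = aff_add h y" and h: "h \<in> h_hat n" and y: "y \<in> n_hat_pos n"
    using assms by (auto simp: b_hat_def)
  have H: "loop h k \<in> carrier_mat n n" "loop y k \<in> carrier_mat n n" for k
    using h y by (auto simp: h_hat_def n_hat_pos_def sl_hat_def sl_def)
  show "loop x k \<in> carrier_mat n n" using H by (simp add: x)
  have "{k. loop x k \<noteq> 0\<^sub>m n n} \<subseteq> {k. loop h k \<noteq> 0\<^sub>m n n} \<union> {k. loop y k \<noteq> 0\<^sub>m n n}"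
    by (auto simp: x)
  then show "finite {k. loop x k \<noteq> 0\<^sub>m n n}"
    using h y by (auto simp: h_hat_def n_hat_pos_def sl_hat_def intro: finite_subset)
  assume rs: "r < n" "s < n" and nz: "loop x k $$ (r, s) \<noteq> 0"
  then have nz: "loop h k $$ (r, s) \<noteq> 0 \<or> loop y k $$ (r, s) \<noteq> 0" using H[of k] by (auto simp: x)
  have "k < 0 \<Longrightarrow> loop h k = 0\<^sub>m n n \<and> loop y k = 0\<^sub>m n n"
    using h y by (auto simp: h_hat_def n_hat_pos_def)
  then have "\<not> k < 0" using nz rs by auto
  moreover have "r \<le> s" if "k = 0"
  proof (rule ccontr)
    assume "\<not> r \<le> s"
    then have "loop h k $$ (r, s) = 0" "loop y k $$ (r, s) = 0"
      using h y H[of 0] rs that by (auto simp: h_hat_def n_hat_pos_def n_pos_def diagonal_mat_def)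
    then show False using nz by simp
  qed
  ultimately show "k = 0 \<and> r \<le> s \<or> 1 \<le> k" by auto
qed

lemma n_hat_posI:
  assumes "\<And>k. loop x k \<in> carrier_mat n n" "\<And>k. (\<Sum>r<n. loop x k $$ (r, r)) = 0"
    "finite {k. loop x k \<noteq> 0\<^sub>m n n}" "c_coord x = 0" "d_coord x = 0"
    "\<And>k r s. r < n \<Longrightarrow> s < n \<Longrightarrow> loop x k $$ (r, s) \<noteq> 0 \<Longrightarrow> allowed k r s"
  shows "x \<in> n_hat_pos n"
proof -
  have sl: "loop x k \<in> sl n" for k using assms(1,2) by (auto simp: sl_def trace_eq[of _ n])
  have "loop x k = 0\<^sub>m n n" if "k < 0" for k
    using assms(1)[of k] assms(6)[of _ _ k] that by (intro eq_matI) (auto simp: allowed_def)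
  moreover have "loop x 0 $$ (i, j) = 0" if "i < n" "j < n" "j \<le> i" for i j
    using assms(6)[of i j 0] that P_less[of i j] by (auto simp: allowed_def)
  ultimately show ?thesis
    using assms(3-5) sl by (auto simp: n_hat_pos_def sl_hat_def n_pos_def)
qed

lemma the_ideal_bracket:
  assumes x: "x \<in> b_hat n" and y: "y \<in> the_ideal"
  shows "aff_bracket n x y \<in> the_ideal"
proof -
  note X = b_hat_loop[OF x]
  have yn: "y \<in> n_hat_pos n" and y_allowed: "\<And>k r s. r < n \<Longrightarrow> s < n \<Longrightarrow> loop y k $$ (r, s) \<noteq> 0 \<Longrightarrow> allowed k r s"
    and yb: "admissible (\<lambda>i. loop y 1 $$ (i, i))"
    using y by (auto simp: the_ideal_def)
  have ysl: "loop y k \<in> sl n" for k using yn by (auto simp: n_hat_pos_def sl_hat_def)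
  note Y = sl_carrier[OF ysl] sl_sum_diag[OF ysl]
  have fy: "finite {k. loop y k \<noteq> 0\<^sub>m n n}" using yn by (simp add: n_hat_pos_def sl_hat_def)
  have cd: "c_coord y = 0" "d_coord y = 0" using yn by (auto simp: n_hat_pos_def)
  define F where "F = {i. loop x i \<noteq> 0\<^sub>m n n}"
  define C where "C i m = loop x i * loop y (m - i) - loop y (m - i) * loop x i" for i m
  have z: "loop (aff_bracket n x y) m = mat n n (\<lambda>(r, s). (\<Sum>i\<in>F. C i m $$ (r, s))
      + d_coord x * of_int m * loop y m $$ (r, s))" for m
    by (simp add: aff_bracket_def cd F_def C_def)
  have zi: "loop (aff_bracket n x y) m $$ (r, s) = (\<Sum>i\<in>F. C i m $$ (r, s))
      + d_coord x * of_int m * loop y m $$ (r, s)" if "r < n" "s < n" for m r s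
    using that by (simp add: z)
  have neg: "loop x k = 0\<^sub>m n n" if "k < 0" for k
    using X(1)[of k] X(3)[of _ _ k] that by (intro eq_matI) auto
  have negy: "loop y k = 0\<^sub>m n n" if "k < 0" for k
    using yn that by (auto simp: n_hat_pos_def)
  have C0: "C i m $$ (r, s) = 0" if "loop y (m - i) = 0\<^sub>m n n" "r < n" "s < n" for i m r s
    using that X(1)[of i] by (simp add: C_def)
  have z_allowed: "allowed m r s" if rs: "r < n" "s < n" and nz: "loop (aff_bracket n x y) m $$ (r, s) \<noteq> 0" for m r s
  proof (cases "r = s")
    case True
    have "0 < m"
    proof (rule ccontr)
      assume m: "\<not> 0 < m"
      \<comment> \<open>Only degrees \<open>0 + 0\<close> could contribute here; an upper triangular
        and a strictly upper triangular matrix have products with zero diagonal.\<close>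
      have "C i m $$ (r, r) = 0" if i: "i \<in> F" for i
      proof (cases "i = 0 \<and> m = 0")
        case True
        have "loop x 0 $$ (r, j) * loop y 0 $$ (j, r) - loop y 0 $$ (r, j) * loop x 0 $$ (j, r) = 0"
          if j: "j < n" for j
          using X(3)[of r j 0] X(3)[of j r 0] y_allowed[of j r 0] y_allowed[of r j 0] P_less[of j r] P_less[of r j] rs j
          by (force simp: allowed_def)
        then show ?thesis
          using True by (simp add: C_def commutator_index[OF X(1) Y(1) rs(1) rs(1)] del: index_minus_mat(1))
      next
        case False
        then have "m - i < 0" using neg[of i] i m by (cases "i < 0") (auto simp: F_def)
        then show ?thesis using C0 negy rs by blast
      qed
      moreover have "of_int m * loop y m $$ (r, r) = 0" using negy[of m] m rs by (cases "m = 0") auto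
      ultimately show False using nz zi[OF rs, of m] True by simp
    qed
    then show ?thesis using True rs Q_diag[of r r] Q'_diag[of r r] by (auto simp: allowed_def)
  next
    case False
    show ?thesis
    proof (cases "loop y m $$ (r, s) = 0")
      case True
      then obtain i where "i \<in> F" "C i m $$ (r, s) \<noteq> 0"
        using nz unfolding zi[OF rs] by (auto elim: sum.not_neutral_contains_not_neutral)
      then have "allowed (i + (m - i)) r s"
        using False rs yb
        by (intro commutator_allowed[of "loop x i" "loop y (m - i)"] X(1) Y(1) X(3) y_allowed) (auto simp: C_def)
      then show ?thesis by simp
    qed (use y_allowed rs in blast)
  qed
  \<comment> \<open>At an index that is not good the bracket merely rescales the diagonal entry of
    \<open>y\<close>, by the same factor at all such indices. Equations between two such entries are
    therefore preserved.\<close>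
  have zgood: "loop (aff_bracket n x y) 1 $$ (r, r) = d_coord x * loop y 1 $$ (r, r)"
    if r: "r < n" "\<not> good r" for r
  proof -
    have "C i 1 $$ (r, r) = 0" for i
    proof (rule ccontr)
      assume "C i 1 $$ (r, r) \<noteq> 0"
      then have "good r"
        using r by (intro commutator_diag_good[of "loop x i" "loop y (1 - i)" i "1 - i"] X(1) Y(1) X(3) y_allowed)
          (auto simp: C_def)
      then show False using r by simp
    qed
    then show ?thesis using zi[OF r(1) r(1), of 1] by simp
  qed
  have "aff_bracket n x y \<in> n_hat_pos n"
  proof (rule n_hat_posI)
    fix m
    show "loop (aff_bracket n x y) m \<in> carrier_mat n n" by (simp add: z)
    have "(\<Sum>r<n. loop (aff_bracket n x y) m $$ (r, r)) =
        (\<Sum>r<n. \<Sum>i\<in>F. C i m $$ (r, r)) + d_coord x * of_int m * (\<Sum>r<n. loop y m $$ (r, r))"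
      by (simp add: zi sum.distrib sum_distrib_left)
    also have "(\<Sum>r<n. \<Sum>i\<in>F. C i m $$ (r, r)) = (\<Sum>i\<in>F. \<Sum>r<n. C i m $$ (r, r))"
      by (rule sum.swap)
    also have "\<dots> = 0"
      unfolding C_def by (simp only: sum_commutator_diag[OF X(1) Y(1)] sum.neutral_const)
    finally show "(\<Sum>r<n. loop (aff_bracket n x y) m $$ (r, r)) = 0" using Y(2) by simp
  next
    let ?G = "{k. loop y k \<noteq> 0\<^sub>m n n}"
    have "m \<in> (\<lambda>(i, j). i + j) ` (F \<times> ?G) \<union> ?G" if m: "loop (aff_bracket n x y) m \<noteq> 0\<^sub>m n n" for m
    proof (rule ccontr)
      assume no: "m \<notin> (\<lambda>(i, j). i + j) ` (F \<times> ?G) \<union> ?G"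
      then have ym: "loop y m = 0\<^sub>m n n" by simp
      have "loop y (m - i) = 0\<^sub>m n n" if "i \<in> F" for i
      proof (rule ccontr)
        assume "loop y (m - i) \<noteq> 0\<^sub>m n n"
        then have "(i, m - i) \<in> F \<times> ?G" using that by simp
        then have "m \<in> (\<lambda>(i, j). i + j) ` (F \<times> ?G)" by (rule rev_image_eqI) simp
        then show False using no by blast
      qed
      then have "loop (aff_bracket n x y) m = 0\<^sub>m n n"
        using C0 ym by (intro eq_matI) (auto simp: z intro!: sum.neutral)
      then show False using m by blast
    qed
    then have "{m. loop (aff_bracket n x y) m \<noteq> 0\<^sub>m n n} \<subseteq> (\<lambda>(i, j). i + j) ` (F \<times> ?G) \<union> ?G"
      by blast
    then show "finite {m. loop (aff_bracket n x y) m \<noteq> 0\<^sub>m n n}"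
      using X(2) fy by (elim finite_subset) (simp add: F_def)
  next
    \<comment> \<open>No central term appears: for \<open>i > 0\<close> the other factor has
      negative degree, and for \<open>i = 0\<close> the cocycle has the factor 0.\<close>
    have "of_int i * mat_trace (loop x i * loop y (- i)) = 0" if "i \<in> F" for i
    proof (cases "0 < i")
      case True
      then show ?thesis using negy[of "- i"] X(1)[of i] by (simp add: mat_trace_def)
    next
      case False
      then show ?thesis using neg[of i] that by (cases "i = 0") (auto simp: F_def)
    qed
    then have "(\<Sum>i\<in>F. of_int i * mat_trace (loop x i * loop y (- i))) = 0" by (rule sum.neutral[rule_format])
    then show "c_coord (aff_bracket n x y) = 0" by (simp add: aff_bracket_def F_def)
  next
    fix k r s assume "r < n" "s < n" "loop (aff_bracket n x y) k $$ (r, s) \<noteq> 0"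
    then show "allowed k r s" by (rule z_allowed)
  qed (simp add: aff_bracket_def)
  moreover have "admissible (\<lambda>i. loop (aff_bracket n x y) 1 $$ (i, i))"
    unfolding admissible_def
  proof (intro conjI allI impI)
    fix i assume i: "Suc i < n \<and> loop (aff_bracket n x y) 1 $$ (i, i) \<noteq> loop (aff_bracket n x y) 1 $$ (Suc i, Suc i)"
    show "(i, Suc i) \<in> P'"
    proof (rule ccontr)
      assume no: "(i, Suc i) \<notin> P'"
      then have "\<not> good i" "\<not> good (Suc i)" using i by (auto simp: good_def)
      moreover have "loop y 1 $$ (i, i) = loop y 1 $$ (Suc i, Suc i)"
        using yb no i unfolding admissible_def by blast
      ultimately show False using i zgood[of i] zgood[of "Suc i"] by simp
    qed
  next
    assume i: "loop (aff_bracket n x y) 1 $$ (0, 0) \<noteq> loop (aff_bracket n x y) 1 $$ (n - 1, n - 1)"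
    show "(n - 1, 0) \<in> Q'"
    proof (rule ccontr)
      assume no: "(n - 1, 0) \<notin> Q'"
      then have "\<not> good 0" "\<not> good (n - 1)" using n by (auto simp: good_def)
      moreover have "loop y 1 $$ (0, 0) = loop y 1 $$ (n - 1, n - 1)"
        using yb no unfolding admissible_def by blast
      ultimately show False using i zgood[of 0] zgood[of "n - 1"] n by simp
    qed
  qed
  ultimately show ?thesis unfolding the_ideal_def using z_allowed by blast
qed

lemma the_ideal_subspace: "is_subspace n the_ideal"
  unfolding is_subspace_def
proof (intro conjI ballI allI)
  have car: "loop x k \<in> carrier_mat n n" "(\<Sum>r<n. loop x k $$ (r, r)) = 0"
    "finite {k. loop x k \<noteq> 0\<^sub>m n n}" "c_coord x = 0" "d_coord x = 0"
    if "x \<in> the_ideal" for x k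
    using that by (auto simp: the_ideal_def n_hat_pos_def sl_hat_def intro: sl_carrier sl_sum_diag)
  have allowed: "allowed k r s" if "x \<in> the_ideal" "r < n" "s < n" "loop x k $$ (r, s) \<noteq> 0" for x k r s
    using that by (auto simp: the_ideal_def)
  have bal: "admissible (\<lambda>i. loop x 1 $$ (i, i))" if "x \<in> the_ideal" for x using that by (auto simp: the_ideal_def)
  show "aff_zero n \<in> the_ideal"
    unfolding the_ideal_def mem_Collect_eq
  proof (intro conjI)
    show "aff_zero n \<in> n_hat_pos n" by (rule n_hat_posI) auto
    show "admissible (\<lambda>i. loop (aff_zero n) 1 $$ (i, i))" using n by (auto simp: admissible_def)
  qed auto
  fix x y assume x: "x \<in> the_ideal" and y: "y \<in> the_ideal"
  have ix: "loop (aff_add x y) k $$ (r, s) = loop x k $$ (r, s) + loop y k $$ (r, s)" if "r < n" "s < n" for k r s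
    using car(1)[OF x, of k] car(1)[OF y, of k] that by simp
  have nz_allowed: "allowed k r s" if "r < n" "s < n" "loop (aff_add x y) k $$ (r, s) \<noteq> 0" for k r s
    using allowed[OF x that(1,2), of k] allowed[OF y that(1,2), of k] that ix by force
  have "aff_add x y \<in> n_hat_pos n"
  proof (rule n_hat_posI)
    have "{k. loop (aff_add x y) k \<noteq> 0\<^sub>m n n} \<subseteq> {k. loop x k \<noteq> 0\<^sub>m n n} \<union> {k. loop y k \<noteq> 0\<^sub>m n n}" by auto
    then show "finite {k. loop (aff_add x y) k \<noteq> 0\<^sub>m n n}"
      using car(3)[OF x] car(3)[OF y] by (auto elim: finite_subset)
    show "(\<Sum>r<n. loop (aff_add x y) k $$ (r, r)) = 0" for k
      by (simp add: ix sum.distrib car(2)[OF x] car(2)[OF y] del: loop_aff_add)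
    show "loop (aff_add x y) k \<in> carrier_mat n n" for k
      using car(1)[OF x, of k] car(1)[OF y, of k] by simp
    show "allowed k r s" if "r < n" "s < n" "loop (aff_add x y) k $$ (r, s) \<noteq> 0" for k r s
      using nz_allowed that by blast
  qed (use car x y in auto)
  moreover have "admissible (\<lambda>i. loop (aff_add x y) 1 $$ (i, i))"
    by (rule admissible_combination[OF bal[OF x] bal[OF y], of _ 1 1]) (simp add: ix del: loop_aff_add)
  ultimately show "aff_add x y \<in> the_ideal" unfolding the_ideal_def using nz_allowed by blast
next
  fix z x assume x: "x \<in> the_ideal"
  have sl: "loop x k \<in> sl n" for k using x by (auto simp: the_ideal_def n_hat_pos_def sl_hat_def)
  note car = sl_carrier[OF sl]
  have ix: "loop (aff_scale z x) k $$ (r, s) = z * loop x k $$ (r, s)" if "r < n" "s < n" for k r s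
    using car[of k] that by simp
  have bal: "admissible (\<lambda>i. loop x 1 $$ (i, i))" using x by (simp add: the_ideal_def)
  have nz_allowed: "allowed k r s" if "r < n" "s < n" "loop (aff_scale z x) k $$ (r, s) \<noteq> 0" for k r s
    using x that ix[OF that(1,2), of k] by (auto simp: the_ideal_def)
  have "aff_scale z x \<in> n_hat_pos n"
  proof (rule n_hat_posI)
    have "{k. loop (aff_scale z x) k \<noteq> 0\<^sub>m n n} \<subseteq> {k. loop x k \<noteq> 0\<^sub>m n n}" by auto
    then show "finite {k. loop (aff_scale z x) k \<noteq> 0\<^sub>m n n}"
      using x by (auto elim: finite_subset simp: the_ideal_def n_hat_pos_def sl_hat_def)
    show "(\<Sum>r<n. loop (aff_scale z x) k $$ (r, r)) = 0" for k
      using sl_sum_diag[OF sl, of k] by (simp add: ix del: loop_aff_scale flip: sum_distrib_left)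
    show "allowed k r s" if "r < n" "s < n" "loop (aff_scale z x) k $$ (r, s) \<noteq> 0" for k r s
      using nz_allowed that by blast
  qed (use x car in \<open>auto simp: the_ideal_def n_hat_pos_def\<close>)
  moreover have "admissible (\<lambda>i. loop (aff_scale z x) 1 $$ (i, i))"
    by (rule admissible_combination[OF bal bal, of _ z 0]) (simp add: ix del: loop_aff_scale)
  ultimately show "aff_scale z x \<in> the_ideal" unfolding the_ideal_def using nz_allowed by blast
qed

lemma the_ideal_ideal: "is_ideal_of_b_hat n the_ideal"
  using the_ideal_bracket the_ideal_subspace n_hat_pos_b_hat unfolding is_ideal_of_b_hat_def the_ideal_def by blast

lemma the_ideal_sub: "the_ideal \<subseteq> n_hat_pos n"
  by (auto simp: the_ideal_def)

lemma tens_mat_unit_the_ideal: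
  assumes "a < n" "b < n" "a \<noteq> b"
  shows "tens n (mat_unit n a b) k \<in> the_ideal \<longleftrightarrow> allowed k a b"
proof
  assume "tens n (mat_unit n a b) k \<in> the_ideal"
  then have "loop (tens n (mat_unit n a b) k) k $$ (a, b) \<noteq> 0 \<longrightarrow> allowed k a b"
    unfolding the_ideal_def using assms by blast
  then show "allowed k a b" using assms by simp
next
  assume allowed: "allowed k a b"
  then have "0 < k \<or> k = 0 \<and> a < b" using P_less by (auto simp: allowed_def)
  then have "tens n (mat_unit n a b) k \<in> n_hat_pos n"
    using assms by (intro tens_n_hat_pos mat_unit_sl) (auto intro: mat_unit_n_pos)
  moreover have "admissible (\<lambda>i. loop (tens n (mat_unit n a b) k) 1 $$ (i, i))"
    using assms n by (auto simp: admissible_def split: if_splits)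
  ultimately show "tens n (mat_unit n a b) k \<in> the_ideal"
    using allowed assms by (auto simp: the_ideal_def)
qed

lemma the_ideal_level: "has_level n the_ideal 1"
proof -
  have n0: "0 < n" using n by simp
  obtain v :: "nat \<Rightarrow> complex" where v: "\<exists>i<n. v i \<noteq> 0" "(\<Sum>i<n. v i) = 0" "admissible v"
    using cartan unfolding admissible_def by auto
  define D where "D = mat n n (\<lambda>(r, s). if r = s then v r else 0)"
  have D: "D \<in> sl n" "diagonal_mat D" using v(2) by (auto simp: D_def sl_def trace_eq[of _ n] diagonal_mat_def)
  have "D \<noteq> 0\<^sub>m n n"
  proof
    assume "D = 0\<^sub>m n n"
    then have "D $$ (i, i) = 0" if "i < n" for i using that by simp
    then show False using v(1) by (auto simp: D_def)
  qed
  moreover have "tens n D 1 \<in> the_ideal"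
  proof -
    have "tens n D 1 \<in> n_hat_pos n" using D by (intro tens_n_hat_pos) auto
    moreover have "admissible (\<lambda>i. loop (tens n D 1) 1 $$ (i, i))"
      using v(3) n by (auto simp: D_def admissible_def)
    moreover have "allowed k a b" if "a < n" "b < n" "loop (tens n D 1) k $$ (a, b) \<noteq> 0" for k a b
      using that Q_diag[of a a] by (auto simp: D_def allowed_def split: if_splits)
    ultimately show ?thesis unfolding the_ideal_def by blast
  qed
  ultimately show ?thesis unfolding has_level_1_iff[OF the_ideal_subspace the_ideal_sub n0] using D by blast
qed

lemma the_ideal_boxes:
  "boxes_of_roots n (a_pos n the_ideal) = P"
  "diag_boxes n \<union> boxes_of_roots n (a_neg n the_ideal) = Q"
  "boxes_of_roots n (a_pos' n the_ideal) = P'"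
  "diag_boxes n \<union> boxes_of_roots n (a_neg' n the_ideal) = Q'"
proof -
  note boxes = boxes_of_support[OF the_ideal_subspace the_ideal_sub]
  have "a < b \<and> b < n \<and> tens n (mat_unit n a b) 0 \<in> the_ideal \<longleftrightarrow> (a, b) \<in> P" for a b
    using tens_mat_unit_the_ideal[of a b 0] P_less[of a b] by (auto simp: allowed_def)
  then show "boxes_of_roots n (a_pos n the_ideal) = P" unfolding boxes by simp
  have "a < b \<and> b < n \<and> tens n (mat_unit n a b) 1 \<in> the_ideal \<longleftrightarrow> (a, b) \<in> P'" for a b
    using tens_mat_unit_the_ideal[of a b 1] P'_less[of a b] by (auto simp: allowed_def)
  then show "boxes_of_roots n (a_pos' n the_ideal) = P'" unfolding boxes by simp
  have "b < a \<and> a < n \<and> tens n (mat_unit n a b) 1 \<in> the_ideal \<or> (a, b) \<in> diag_boxes n \<longleftrightarrow> (a, b) \<in> Q" for a b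
    using tens_mat_unit_the_ideal[of a b 1] Q_less[of a b] Q_diag[of a b]
    by (cases "b < a"; cases "a < n"; cases "b < n") (simp_all add: allowed_def diag_boxes_def, blast+)
  then show "diag_boxes n \<union> boxes_of_roots n (a_neg n the_ideal) = Q" unfolding boxes by (simp add: set_eq_iff disj_commute)
  have "b < a \<and> a < n \<and> tens n (mat_unit n a b) 2 \<in> the_ideal \<or> (a, b) \<in> diag_boxes n \<longleftrightarrow> (a, b) \<in> Q'" for a b
    using tens_mat_unit_the_ideal[of a b 2] Q'_less[of a b] Q'_diag[of a b]
    by (cases "b < a"; cases "a < n"; cases "b < n") (simp_all add: allowed_def diag_boxes_def, blast+)
  then show "diag_boxes n \<union> boxes_of_roots n (a_neg' n the_ideal) = Q'" unfolding boxes by (simp add: set_eq_iff disj_commute)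
qed

end

subsection \<open>Translation to valleys\<close>

lemma up_closed_neg_boxes:
  assumes "p \<in> balanced_paths n"
  shows "up_closed n (neg_boxes n p)"
  unfolding up_closed_def
proof (intro conjI allI impI)
  fix a b a' b' assume *: "(a, b) \<in> neg_boxes n p \<and> a' \<le> a \<and> b \<le> b' \<and> b' < n"
  have l: "length p = 2 * n" using assms by (simp add: balanced_paths_def)
  have "\<bar>height p (a + b + 1) - height p (a' + b + 1)\<bar> \<le> int (a + b + 1) - int (a' + b + 1)"
    using * by (intro height_lipschitz) (auto simp: l neg_boxes_def)
  moreover have "\<bar>height p (a' + b' + 1) - height p (a' + b + 1)\<bar> \<le> int (a' + b' + 1) - int (a' + b + 1)"
    using * by (intro height_lipschitz) (auto simp: l neg_boxes_def)
  ultimately show "(a', b') \<in> neg_boxes n p"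
    using * by (auto simp: neg_boxes_def)
qed (auto simp: neg_boxes_def)

lemma pos_boxes_dyck:
  assumes p: "p \<in> dyck_paths n"
  shows "pos_boxes n p \<subseteq> {(a, b). a < b}"
proof
  fix x assume x: "x \<in> pos_boxes n p"
  obtain a b where ab: "x = (a, b)" by (cases x)
  have "0 \<le> height p (a + b + 1)" using x ab by (intro dyck_nonneg[OF p]) (auto simp: pos_boxes_def)
  then show "x \<in> {(a, b). a < b}" using x ab by (auto simp: pos_boxes_def)
qed

lemma neg_boxes_dyck:
  assumes p: "p \<in> dyck_paths n"
  shows "diag_boxes n \<subseteq> neg_boxes n p"
proof
  fix x assume "x \<in> diag_boxes n"
  then obtain a b where x: "x = (a, b)" "a \<le> b" "b < n" by (auto simp: diag_boxes_def)
  have h: "0 \<le> height p (a + b + 1)" "even (height p (a + b + 1) - int (a + b + 1))"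
    using dyck_nonneg[OF p, of "a + b + 1"] even_dyck[OF p, of "a + b + 1"] x by auto
  have "1 \<le> height p (a + b + 1)" if "a = b"
  proof -
    have "height p (a + b + 1) \<noteq> 0" using h(2) that by auto
    then show ?thesis using h(1) by simp
  qed
  then show "x \<in> neg_boxes n p" using h(1) x by (cases "a = b") (auto simp: neg_boxes_def)
qed

text \<open>The link between simple roots and valleys: the bound for a superdiagonal box is height
  0. The valley carries the one-based index of the simple root, hence \<open>Suc m\<close>. For
  negative simple roots, below, the condition is the opposite one because parity excludes height
  1.\<close>

lemma pos_boxes_superdiagonal:
  assumes p: "p \<in> dyck_paths n" and m: "Suc m < n"
  shows "(m, Suc m) \<in> pos_boxes n p \<longleftrightarrow> height p (2 * Suc m) = 0"
proof -
  have "m + Suc m + 1 = 2 * Suc m" by simp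
  then show ?thesis using m dyck_nonneg[OF p, of "2 * Suc m"] by (auto simp: pos_boxes_def mult_2)
qed

lemma neg_boxes_subdiagonal:
  assumes p: "p \<in> dyck_paths n" and m: "Suc m < n"
  shows "(Suc m, m) \<in> neg_boxes n p \<longleftrightarrow> height p (2 * Suc m) \<noteq> 0"
proof -
  have e: "Suc m + m + 1 = 2 * Suc m" by simp
  have "even (height p (2 * Suc m))" using even_dyck[OF p, of "2 * Suc m"] m by auto
  then have "height p (2 * Suc m) \<noteq> 1" by auto
  then show ?thesis using m dyck_nonneg[OF p, of "2 * Suc m"] e by (auto simp: neg_boxes_def mult_2)
qed

lemma neg_boxes_corner:
  assumes p: "p \<in> dyck_paths n" and n: "0 < n"
  shows "(n - 1, 0) \<in> neg_boxes n p \<longleftrightarrow> p = max_path n"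
  using dyck_le(1)[OF p, of n] n by (auto simp: neg_boxes_def dyck_eq_max_path_iff[OF p] of_nat_diff)

lemma pos_boxes_empty_iff:
  assumes p: "p \<in> dyck_paths n" and n: "0 < n"
  shows "pos_boxes n p = {} \<longleftrightarrow> p = max_path n"
proof
  assume "pos_boxes n p = {}"
  then have "(0, n - 1) \<notin> pos_boxes n p" by blast
  then have "int n - 2 < height p n" using n by (auto simp: pos_boxes_def of_nat_diff)
  moreover have "even (height p n - int n)" using even_dyck[OF p, of n] by simp
  then obtain t where "height p n - int n = 2 * t" by (elim evenE)
  ultimately have "height p n = int n" using dyck_le(1)[OF p, of n]
    by (cases "t = 0"; cases "t < 0") auto
  then show "p = max_path n" using dyck_eq_max_path_iff[OF p] by simp
next
  assume "p = max_path n"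
  then show "pos_boxes n p = {}"
    using height_max_path[of _ n] by (auto simp: pos_boxes_def split: if_splits)
qed

lemma neg_boxes_max_path:
  assumes "max_path n \<in> dyck_paths n" "a < n" "b < n"
  shows "(a, b) \<in> neg_boxes n (max_path n)"
  using up_closedD[OF up_closed_neg_boxes[OF dyck_balanced[OF assms(1)]], of "n - 1" 0 a b]
    neg_boxes_corner[OF assms(1)] assms by auto

text \<open>Zero valleys, indexed by half their abscissa. For \<open>p'\<close> these are the
  one-based numbers of the simple roots that are present, for \<open>q\<close> those of the negative
  simple roots that are absent.\<close>

definition zeros :: "nat \<Rightarrow> step list \<Rightarrow> nat set" where
  "zeros n p = {m. 1 \<le> m \<and> m < n \<and> height p (2 * m) = 0}"

lemma zero_valleys_zeros:
  assumes "p \<in> dyck_paths n"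
  shows "zero_valleys p = (\<lambda>m. (2 * m, 0)) ` zeros n p"
  unfolding zero_valleys_eq[OF assms] zeros_def by blast

lemma mem_zero_valleys:
  assumes "p \<in> dyck_paths n"
  shows "(2 * m, 0) \<in> zero_valleys p \<longleftrightarrow> m \<in> zeros n p"
  unfolding zero_valleys_zeros[OF assms] by auto

lemma card_zero_valleys:
  assumes "p \<in> dyck_paths n"
  shows "card (zero_valleys p) = card (zeros n p)"
  unfolding zero_valleys_zeros[OF assms] by (rule card_image) (auto simp: inj_on_def)

text \<open>Membership in \<open>m_set\<close> asks for a missing neighbour among
  \<open>k - 1\<close>, \<open>k\<close>, \<open>k + 1\<close>. Read from the missing index
  \<open>m\<close>, it demands the indices at distance at most one from \<open>m\<close>, which are
  the simple roots not vanishing on the coroot of \<open>alpha_m\<close>.\<close>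

lemma m_set_subset_iff:
  assumes p: "p \<in> dyck_paths n" and r: "r \<in> dyck_paths n"
  shows "m_set n p \<subseteq> zero_valleys r \<longleftrightarrow>
    (\<forall>m k. 1 \<le> m \<and> m < n \<and> m \<notin> zeros n p \<and> 1 \<le> k \<and> k < n \<and> k \<le> Suc m \<and> m \<le> Suc k \<longrightarrow> k \<in> zeros n r)"
proof -
  have ev: "(2 * k - 2, 0) = (2 * (k - 1), 0)" "(2 * k + 2, 0) = (2 * Suc k, 0)" for k :: nat by auto
  have mem: "(2 * k, 0) \<in> m_set n p \<longleftrightarrow> 1 \<le> k \<and> k < n \<and>
      (\<exists>m. 1 \<le> m \<and> m < n \<and> m \<notin> zeros n p \<and> k \<le> Suc m \<and> m \<le> Suc k)" for k
  proof -
    have "(2 * k, 0) \<in> m_set n p \<longleftrightarrow> 1 \<le> k \<and> k \<le> n - 1 \<and>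
        {(2 * (k - 1), 0), (2 * k, 0), (2 * Suc k, 0)} - (zero_valleys p \<union> {(0, 0), (2 * n, 0)}) \<noteq> {}"
      unfolding m_set_def ev by auto
    also have "\<dots> \<longleftrightarrow> 1 \<le> k \<and> k < n \<and>
        (\<exists>m\<in>{k - 1, k, Suc k}. m \<notin> zeros n p \<and> m \<noteq> 0 \<and> m \<noteq> n)"
    proof -
      have "A - B \<noteq> {} \<longleftrightarrow> (\<exists>x\<in>A. x \<notin> B)" for A B :: "(nat \<times> int) set" by blast
      then have "{(2 * (k - 1), 0), (2 * k, 0), (2 * Suc k, 0)} - (zero_valleys p \<union> {(0, 0), (2 * n, 0)}) \<noteq> {} \<longleftrightarrow>
          (\<exists>m\<in>{k - 1, k, Suc k}. (2 * m, 0) \<notin> zero_valleys p \<union> {(0, 0), (2 * n, 0)})"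
        by (simp only: bex_simps)
      moreover have "(2 * m, 0) \<notin> zero_valleys p \<union> {(0, 0), (2 * n, 0)} \<longleftrightarrow> m \<notin> zeros n p \<and> m \<noteq> 0 \<and> m \<noteq> n"
        for m using mem_zero_valleys[OF p, of m] by auto
      moreover have "k \<le> n - 1 \<longleftrightarrow> k < n" if "1 \<le> k" using that by auto
      ultimately show ?thesis by (simp only: cong: conj_cong)
    qed
    also have "\<dots> \<longleftrightarrow> 1 \<le> k \<and> k < n \<and>
      (\<exists>m. 1 \<le> m \<and> m < n \<and> m \<notin> zeros n p \<and> k \<le> Suc m \<and> m \<le> Suc k)"
    proof (intro conj_cong refl)
      assume k: "1 \<le> k" "k < n"
      have "m \<in> {k - 1, k, Suc k} \<longleftrightarrow> k \<le> Suc m \<and> m \<le> Suc k" for m using k by auto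
      then have "(\<exists>m\<in>{k - 1, k, Suc k}. m \<notin> zeros n p \<and> m \<noteq> 0 \<and> m \<noteq> n) \<longleftrightarrow>
          (\<exists>m. k \<le> Suc m \<and> m \<le> Suc k \<and> m \<notin> zeros n p \<and> m \<noteq> 0 \<and> m \<noteq> n)" by (simp only: Bex_def conj_assoc)
      also have "\<dots> \<longleftrightarrow> (\<exists>m. 1 \<le> m \<and> m < n \<and> m \<notin> zeros n p \<and> k \<le> Suc m \<and> m \<le> Suc k)"
        using k by (intro iff_exI) auto
      finally show "(\<exists>m\<in>{k - 1, k, Suc k}. m \<notin> zeros n p \<and> m \<noteq> 0 \<and> m \<noteq> n) \<longleftrightarrow>
        (\<exists>m. 1 \<le> m \<and> m < n \<and> m \<notin> zeros n p \<and> k \<le> Suc m \<and> m \<le> Suc k)" .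
    qed
    finally show ?thesis .
  qed
  have "m_set n p \<subseteq> zero_valleys r \<longleftrightarrow> (\<forall>k. (2 * k, 0) \<in> m_set n p \<longrightarrow> (2 * k, 0) \<in> zero_valleys r)"
    unfolding m_set_def by blast
  then show ?thesis unfolding mem mem_zero_valleys[OF r] by blast
qed

text \<open>All clauses become conditions on the paths except the existence of the Cartan vector,
  which \<open>level_one_data_iff\<close> eliminates case by case.\<close>

lemma level_one_data_iff_zeros:
  assumes n: "1 < n" and p: "p \<in> dyck_paths n" and q: "q \<in> dyck_paths n"
    and p': "p' \<in> dyck_paths n" and q': "q' \<in> dyck_paths n"
  shows "level_one_data n (pos_boxes n p) (neg_boxes n q) (pos_boxes n p') (neg_boxes n q') \<longleftrightarrow>
    path_le (bar_path n p) q \<and> path_le (bar_path n p') q' \<and>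
    (\<exists>v :: nat \<Rightarrow> complex. (\<exists>i<n. v i \<noteq> 0) \<and> (\<Sum>i<n. v i) = 0 \<and>
        (\<forall>i. Suc i < n \<and> v i \<noteq> v (Suc i) \<longrightarrow> Suc i \<in> zeros n p') \<and>
        (v 0 \<noteq> v (n - 1) \<longrightarrow> q' = max_path n)) \<and>
    m_set n q \<subseteq> zero_valleys p' \<and>
    (1 \<notin> zeros n q \<or> n - 1 \<notin> zeros n q \<longrightarrow> q' = max_path n) \<and>
    (p \<noteq> max_path n \<longrightarrow> 1 \<in> zeros n p' \<and> n - 1 \<in> zeros n p' \<and> q' = max_path n)"
proof -
  have n0: "0 < n" using n by simp
  have up: "up_closed n (pos_boxes n r)" "up_closed n (neg_boxes n r)" if "r \<in> dyck_paths n" for r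
    using that up_closed_pos_boxes up_closed_neg_boxes dyck_balanced by blast+
  have pos: "(i, Suc i) \<in> pos_boxes n p' \<longleftrightarrow> Suc i \<in> zeros n p'" for i
    using pos_boxes_superdiagonal[OF p', of i] by (cases "Suc i < n") (auto simp: zeros_def pos_boxes_def)
  have neg: "(Suc s, s) \<in> neg_boxes n q \<longleftrightarrow> Suc s < n \<and> Suc s \<notin> zeros n q" for s
    using neg_boxes_subdiagonal[OF q, of s] by (cases "Suc s < n") (auto simp: zeros_def neg_boxes_def)
  have "(n - 2, n - 1) = (n - 2, Suc (n - 2))" using n by auto
  then have pos_last: "(n - 2, n - 1) \<in> pos_boxes n p' \<longleftrightarrow> n - 1 \<in> zeros n p'"
    using pos[of "n - 2"] n by (simp add: Suc_diff_Suc numeral_2_eq_2)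
  have pos_first: "(0, 1) \<in> pos_boxes n p' \<longleftrightarrow> 1 \<in> zeros n p'"
    using pos[of 0] by simp
  have adj: "(\<forall>s. (Suc s, s) \<in> neg_boxes n q \<longrightarrow>
        (\<forall>r. Suc r < n \<and> s \<le> Suc r \<and> r \<le> Suc s \<longrightarrow> (r, Suc r) \<in> pos_boxes n p') \<and>
        (s = 0 \<or> Suc (Suc s) = n \<longrightarrow> (n - 1, 0) \<in> neg_boxes n q')) \<longleftrightarrow>
      m_set n q \<subseteq> zero_valleys p' \<and> (1 \<notin> zeros n q \<or> n - 1 \<notin> zeros n q \<longrightarrow> q' = max_path n)"
    (is "?L \<longleftrightarrow> ?R1 \<and> ?R2")
  proof -
    have L: "?L \<longleftrightarrow> (\<forall>s r. Suc s < n \<and> Suc s \<notin> zeros n q \<and> Suc r < n \<and> s \<le> Suc r \<and> r \<le> Suc s \<longrightarrow> Suc r \<in> zeros n p')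
       \<and> (\<forall>s. Suc s < n \<and> Suc s \<notin> zeros n q \<and> (s = 0 \<or> Suc (Suc s) = n) \<longrightarrow> q' = max_path n)"
      unfolding neg pos neg_boxes_corner[OF q' n0] by blast
    have R1: "?R1 \<longleftrightarrow>
        (\<forall>s r. Suc s < n \<and> Suc s \<notin> zeros n q \<and> Suc r < n \<and> s \<le> Suc r \<and> r \<le> Suc s \<longrightarrow> Suc r \<in> zeros n p')"
      unfolding m_set_subset_iff[OF q p']
    proof (intro iffI allI impI)
      fix s r
      assume *: "\<forall>m k. 1 \<le> m \<and> m < n \<and> m \<notin> zeros n q \<and> 1 \<le> k \<and> k < n \<and> k \<le> Suc m \<and> m \<le> Suc k \<longrightarrow> k \<in> zeros n p'"
        and "Suc s < n \<and> Suc s \<notin> zeros n q \<and> Suc r < n \<and> s \<le> Suc r \<and> r \<le> Suc s"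
      then show "Suc r \<in> zeros n p'" using *[rule_format, of "Suc s" "Suc r"] by auto
    next
      fix m k
      assume *: "\<forall>s r. Suc s < n \<and> Suc s \<notin> zeros n q \<and> Suc r < n \<and> s \<le> Suc r \<and> r \<le> Suc s \<longrightarrow> Suc r \<in> zeros n p'"
        and "1 \<le> m \<and> m < n \<and> m \<notin> zeros n q \<and> 1 \<le> k \<and> k < n \<and> k \<le> Suc m \<and> m \<le> Suc k"
      moreover then obtain s r where "m = Suc s" "k = Suc r" by (cases m; cases k) auto
      ultimately show "k \<in> zeros n p'" using *[rule_format, of s r] by simp
    qed
    have R2: "?R2 \<longleftrightarrow>
        (\<forall>s. Suc s < n \<and> Suc s \<notin> zeros n q \<and> (s = 0 \<or> Suc (Suc s) = n) \<longrightarrow> q' = max_path n)"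
    proof -
      have "(\<exists>s. Suc s < n \<and> Suc s \<notin> zeros n q \<and> (s = 0 \<or> Suc (Suc s) = n)) \<longleftrightarrow>
          1 \<notin> zeros n q \<or> n - 1 \<notin> zeros n q"
      proof
        assume "1 \<notin> zeros n q \<or> n - 1 \<notin> zeros n q"
        then show "\<exists>s. Suc s < n \<and> Suc s \<notin> zeros n q \<and> (s = 0 \<or> Suc (Suc s) = n)"
        proof
          assume "n - 1 \<notin> zeros n q"
          moreover have "Suc (n - 2) = n - 1" using n by simp
          ultimately show ?thesis using n by (intro exI[of _ "n - 2"]) auto
        qed (use n in \<open>auto intro!: exI[of _ 0]\<close>)
      qed auto
      then show ?thesis by blast
    qed
    show ?thesis unfolding L R1 R2 by (rule refl)
  qed
  show ?thesis
    unfolding level_one_data_def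
    unfolding adj
    unfolding pos pos_last pos_first neg_boxes_corner[OF q' n0]
      pos_boxes_empty_iff[OF p n0] bar_path_le_iff[OF n p q] bar_path_le_iff[OF n p' q']
    using up[OF p] up[OF q] up[OF p'] up[OF q'] pos_boxes_dyck[OF p] pos_boxes_dyck[OF p']
      neg_boxes_dyck[OF q] neg_boxes_dyck[OF q']
    by (simp only: simp_thms conj_assoc)
qed

section \<open>Vectors of sum zero with prescribed jumps\<close>

lemma nonconstant:
  fixes v :: "nat \<Rightarrow> complex"
  assumes "i < n" "v i \<noteq> 0" "(\<Sum>i<n. v i) = 0"
  obtains k where "Suc k < n" "v k \<noteq> v (Suc k)"
proof -
  have "\<exists>j<n. v j \<noteq> v 0"
  proof (rule ccontr)
    assume "\<not> ?thesis"
    then have const: "\<And>j. j < n \<Longrightarrow> v j = v 0" by blast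
    have "(\<Sum>i<n. v i) = (\<Sum>i<n. v 0)" by (rule sum.cong[OF refl], rule const) simp
    then have "of_nat n * v 0 = 0" using assms(3) by simp
    then show False using assms(1,2) const[OF assms(1)] by simp
  qed
  then obtain j where j: "j < n" "v 0 \<noteq> v j" by metis
  then obtain k where "k < j" "v k \<noteq> v (Suc k)" using telescope_neq[of 0 j v] by auto
  then show thesis using that[of k] j by auto
qed

text \<open>Read cyclically, a vector with equal ends cannot have a single jump: what changes at
  \<open>k\<close> has to be undone before or after it.\<close>

lemma two_changes:
  fixes v :: "nat \<Rightarrow> complex"
  assumes "v 0 = v (n - 1)" "Suc k < n" "v k \<noteq> v (Suc k)"
  obtains l where "l \<noteq> k" "Suc l < n" "v l \<noteq> v (Suc l)"
proof -
  have "v 0 \<noteq> v k \<or> v (Suc k) \<noteq> v (n - 1)" using assms by metis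
  then show thesis
  proof
    assume "v 0 \<noteq> v k"
    then obtain l where "l < k" "v l \<noteq> v (Suc l)" using telescope_neq[of 0 k v] by auto
    then show thesis using that[of l] assms by auto
  next
    assume *: "v (Suc k) \<noteq> v (n - 1)"
    have "Suc k \<le> n - 1" using assms(2) by auto
    then obtain l where "Suc k \<le> l" "l < n - 1" "v l \<noteq> v (Suc l)"
      using * by (rule telescope_neq)
    then show thesis using that[of l] assms by auto
  qed
qed

lemma finite_zeros [simp]: "finite (zeros n p)"
  by (simp add: zeros_def)

lemma block_vector:
  assumes "j < k" "k \<le> n" "0 < j \<or> k < n"
  obtains v :: "nat \<Rightarrow> complex" where "\<exists>i<n. v i \<noteq> 0" "(\<Sum>i<n. v i) = 0"
    "\<And>i. Suc i < n \<Longrightarrow> v i \<noteq> v (Suc i) \<Longrightarrow> Suc i = j \<or> Suc i = k"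
    "0 < j \<Longrightarrow> k < n \<Longrightarrow> v 0 = v (n - 1)"
proof
  \<comment> \<open>This is \<open>- n\<close> times the indicator of the block from
    \<open>j\<close> to \<open>k - 1\<close>, shifted by the constant that makes the sum zero. A
    proper block makes it nonzero. For \<open>j = 0\<close> only the jump at \<open>k\<close>
    remains.\<close>
  define v where "v i = (if j \<le> i \<and> i < k then - of_nat (n - (k - j)) else of_nat (k - j) :: complex)" for i
  show "\<exists>i<n. v i \<noteq> 0"
  proof (intro exI conjI)
    have "n - (k - j) \<noteq> 0" using assms by auto
    then show "v j \<noteq> 0" using assms(1) by (simp add: v_def del: of_nat_diff)
  qed (use assms in auto)
  have "{..<n} = {j..<k} \<union> ({..<n} - {j..<k})" using assms by auto
  then have "(\<Sum>i<n. v i) = (\<Sum>i\<in>{j..<k}. v i) + (\<Sum>i\<in>{..<n} - {j..<k}. v i)"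
    by (metis Diff_disjoint finite_Diff finite_atLeastLessThan finite_lessThan sum.union_disjoint)
  also have "(\<Sum>i\<in>{j..<k}. v i) = - of_nat ((k - j) * (n - (k - j)))"
    using assms(1) by (simp add: v_def)
  also have "(\<Sum>i\<in>{..<n} - {j..<k}. v i) = (\<Sum>i\<in>{..<n} - {j..<k}. of_nat (k - j))"
    by (rule sum.cong) (auto simp: v_def)
  also have "\<dots> = of_nat (card ({..<n} - {j..<k}) * (k - j))" by simp
  also have "card ({..<n} - {j..<k}) = n - (k - j)"
  proof -
    have "{j..<k} \<subseteq> {..<n}" using assms(2) by auto
    then show ?thesis by (simp add: card_Diff_subset)
  qed
  finally show "(\<Sum>i<n. v i) = 0" by (simp add: mult.commute)
  show "Suc i = j \<or> Suc i = k" if "Suc i < n" "v i \<noteq> v (Suc i)" for i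
    using that by (auto simp: v_def split: if_splits)
  show "v 0 = v (n - 1)" if "0 < j" "k < n"
    using that assms by (auto simp: v_def)
qed

lemma level_one_data_iff:
  assumes n: "1 < n" and p: "p \<in> dyck_paths n" and q: "q \<in> dyck_paths n"
    and p': "p' \<in> dyck_paths n" and q': "q' \<in> dyck_paths n"
  shows "level_one_data n (pos_boxes n p) (neg_boxes n q) (pos_boxes n p') (neg_boxes n q') \<longleftrightarrow>
    cond_i n p q p' q' \<or> cond_ii n p q p' q' \<or> cond_iii n p q p' q' \<or> cond_iv n p q p' q'"
proof -
  have n0: "0 < n" using n by simp
  have two: "(2, 0) \<in> zero_valleys r \<longleftrightarrow> 1 \<in> zeros n r" "(2 * n - 2, 0) \<in> zero_valleys r \<longleftrightarrow> n - 1 \<in> zeros n r"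
    if "r \<in> dyck_paths n" for r
    using mem_zero_valleys[OF that, of 1] mem_zero_valleys[OF that, of "n - 1"]
    by (simp_all add: diff_mult_distrib2)
  \<comment> \<open>This and the next fact explain why some comparisons do not occur in the four
    conditions: a maximal path on the smaller side has no boxes to transfer, and one on the larger
    side contains every target box.\<close>
  have bar_max: "path_le (bar_path n p) q" if "p = max_path n"
    unfolding bar_path_le_iff[OF n p q] using pos_boxes_empty_iff[OF p n0] that by simp
  have bar_max': "path_le (bar_path n p') q'" if "q' = max_path n"
    unfolding bar_path_le_iff[OF n p' q'] using neg_boxes_max_path q' that n0 by (auto simp: pos_boxes_def)
  have min: "q = min_path n \<longleftrightarrow> (\<forall>m. 1 \<le> m \<and> m < n \<longrightarrow> m \<in> zeros n q)"
    unfolding dyck_eq_min_path_iff[OF q] by (auto simp: zeros_def)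
  have m_set: "m_set n q \<subseteq> zero_valleys p' \<longleftrightarrow>
    (\<forall>m k. 1 \<le> m \<and> m < n \<and> m \<notin> zeros n q \<and> 1 \<le> k \<and> k < n \<and> k \<le> Suc m \<and> m \<le> Suc k \<longrightarrow> k \<in> zeros n p')"
    by (rule m_set_subset_iff[OF q p'])
  note data = level_one_data_iff_zeros[OF n p q p' q']
  define V where "V \<longleftrightarrow> (\<exists>v :: nat \<Rightarrow> complex. (\<exists>i<n. v i \<noteq> 0) \<and> (\<Sum>i<n. v i) = 0 \<and>
        (\<forall>i. Suc i < n \<and> v i \<noteq> v (Suc i) \<longrightarrow> Suc i \<in> zeros n p') \<and>
        (v 0 \<noteq> v (n - 1) \<longrightarrow> q' = max_path n))"
  have Vone: V if "k \<in> zeros n p'" "q' = max_path n" for k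
  proof -
    have k: "0 < k" "k \<le> n" "k < n" using that by (auto simp: zeros_def)
    obtain v :: "nat \<Rightarrow> complex" where v: "\<exists>i<n. v i \<noteq> 0" "(\<Sum>i<n. v i) = 0"
      "\<And>i. Suc i < n \<Longrightarrow> v i \<noteq> v (Suc i) \<Longrightarrow> Suc i = 0 \<or> Suc i = k"
      using block_vector[of 0 k n] k by auto
    have "Suc i \<in> zeros n p'" if "Suc i < n" "v i \<noteq> v (Suc i)" for i
      using v(3)[OF that] \<open>k \<in> zeros n p'\<close> by simp
    then show V unfolding V_def using v(1,2) that(2) by (intro exI[of _ v]) simp
  qed
  have Vtwo: V if "j \<in> zeros n p'" "k \<in> zeros n p'" "j < k" for j k
  proof -
    have jk: "0 < j" "k \<le> n" "k < n" using that by (auto simp: zeros_def)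
    obtain v :: "nat \<Rightarrow> complex" where v: "\<exists>i<n. v i \<noteq> 0" "(\<Sum>i<n. v i) = 0"
      "\<And>i. Suc i < n \<Longrightarrow> v i \<noteq> v (Suc i) \<Longrightarrow> Suc i = j \<or> Suc i = k" "v 0 = v (n - 1)"
      using block_vector[of j k n] jk \<open>j < k\<close> by auto
    have "Suc i \<in> zeros n p'" if "Suc i < n" "v i \<noteq> v (Suc i)" for i
      using v(3)[OF that] \<open>j \<in> zeros n p'\<close> \<open>k \<in> zeros n p'\<close> by auto
    then show V unfolding V_def using v(1,2,4) by (intro exI[of _ v]) simp
  qed
  \<comment> \<open>A missing zero \<open>m\<close> of \<open>q\<close> makes \<open>m\<close> and
    its neighbours zeros of \<open>p'\<close>. Away from the ends, \<open>m - 1\<close> and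
    \<open>m\<close> are two jumps that can cancel; at an end \<open>q'\<close> is maximal and one
    jump suffices. So case (iii) needs no count of valleys.\<close>
  have Vadj: V if m: "1 \<le> m" "m < n" and z: "\<And>k. 1 \<le> k \<Longrightarrow> k < n \<Longrightarrow> k \<le> Suc m \<Longrightarrow> m \<le> Suc k \<Longrightarrow> k \<in> zeros n p'"
    and c: "m = 1 \<or> m = n - 1 \<Longrightarrow> q' = max_path n" for m
  proof (cases "m = 1 \<or> m = n - 1")
    case True
    then show ?thesis using Vone[of m] c z[of m] m by auto
  next
    case False
    then show ?thesis using Vtwo[of "m - 1" m] z[of m] z[of "m - 1"] m by auto
  qed
  have Vzeros: "card (zeros n p') \<noteq> 0 \<and> (card (zeros n p') = 1 \<longrightarrow> q' = max_path n)" if V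
  proof -
    from that obtain v :: "nat \<Rightarrow> complex" and i where v: "i < n" "v i \<noteq> 0" "(\<Sum>i<n. v i) = 0"
      "\<And>i. Suc i < n \<Longrightarrow> v i \<noteq> v (Suc i) \<Longrightarrow> Suc i \<in> zeros n p'" "v 0 \<noteq> v (n - 1) \<Longrightarrow> q' = max_path n"
      unfolding V_def by blast
    obtain k where k: "Suc k < n" "v k \<noteq> v (Suc k)" using nonconstant[OF v(1-3)] .
    have kz: "Suc k \<in> zeros n p'" using v(4) k by blast
    have "q' = max_path n" if "card (zeros n p') = 1"
    proof (rule ccontr)
      assume "q' \<noteq> max_path n"
      then have "v 0 = v (n - 1)" using v(5) by blast
      then obtain l where "l \<noteq> k" "Suc l < n" "v l \<noteq> v (Suc l)" using two_changes[of v n k] k by blast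
      then have "Suc l \<in> zeros n p'" "Suc l \<noteq> Suc k" using v(4) by auto
      then show False using that kz by (metis card_1_singletonE singletonD)
    qed
    then show ?thesis using kz by auto
  qed
  have Vcard: V if "1 < card (zeros n p')"
  proof -
    obtain j k where "j \<in> zeros n p'" "k \<in> zeros n p'" "j \<noteq> k"
      using \<open>1 < card (zeros n p')\<close> by (metis card_le_Suc0_iff_eq finite_zeros not_le One_nat_def)
    then show V using Vtwo[of j k] Vtwo[of k j] by (cases "j < k") auto
  qed
  show ?thesis
  proof (cases "p = max_path n")
    \<comment> \<open>Here the data, like condition (iv), contain a zero of \<open>p'\<close> and
      the maximality of \<open>q'\<close>, so the vector exists by \<open>Vone\<close> and the
      comparison of \<open>p'\<close> with \<open>q'\<close> is automatic.\<close>
    case False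
    have "m_set n q \<union> {(2, 0), (2 * n - 2, 0)} \<subseteq> zero_valleys p' \<longleftrightarrow>
        m_set n q \<subseteq> zero_valleys p' \<and> 1 \<in> zeros n p' \<and> n - 1 \<in> zeros n p'"
      using two[OF p'] by auto
    then show ?thesis
      unfolding data cond_i_def cond_ii_def cond_iii_def cond_iv_def V_def[symmetric]
      using False bar_max' Vone[of 1] by auto
  next
    case True
    show ?thesis
    proof (cases "q = min_path n")
      case False
      then obtain m where m: "1 \<le> m" "m < n" "m \<notin> zeros n q" using min by auto
      have V if "m_set n q \<subseteq> zero_valleys p'" "1 \<notin> zeros n q \<or> n - 1 \<notin> zeros n q \<longrightarrow> q' = max_path n"
        using that m unfolding m_set by (intro Vadj[of m]) auto
      then show ?thesis
        unfolding data cond_i_def cond_ii_def cond_iii_def cond_iv_def V_def[symmetric] two[OF q]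
        using True False bar_max by auto
    next
      case qmin: True
      have "m_set n q \<subseteq> zero_valleys p'" unfolding m_set using qmin min by blast
      moreover have "1 \<in> zeros n q" "n - 1 \<in> zeros n q" using qmin min n by auto
      \<comment> \<open>With \<open>q\<close> minimal no coroot is forced, so existence of the
        vector is a genuine condition. It is the part of (i) and (ii) that counts valleys.\<close>
      moreover have "V \<longleftrightarrow> (card (zeros n p') = 1 \<and> q' = max_path n) \<or> 1 < card (zeros n p')"
      proof
        assume R: "(card (zeros n p') = 1 \<and> q' = max_path n) \<or> 1 < card (zeros n p')"
        then show V
        proof
          assume "card (zeros n p') = 1 \<and> q' = max_path n"
          then show V using Vone by (metis card_1_singletonE singletonI)
        qed (rule Vcard)
      next
        assume V
        then have "card (zeros n p') \<noteq> 0" "card (zeros n p') = 1 \<Longrightarrow> q' = max_path n"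
          using Vzeros by simp_all
        then show "(card (zeros n p') = 1 \<and> q' = max_path n) \<or> 1 < card (zeros n p')" by linarith
      qed
      ultimately show ?thesis
        unfolding data cond_i_def cond_ii_def cond_iii_def cond_iv_def V_def[symmetric]
          card_zero_valleys[OF p'] using True qmin bar_max bar_max' by auto
    qed
  qed
qed

section \<open>From box sets back to quadruples of paths\<close>

lemma Psi_iff:
  assumes n: "1 < n" and p: "p \<in> dyck_paths n" and q: "q \<in> dyck_paths n"
    and p': "p' \<in> dyck_paths n" and q': "q' \<in> dyck_paths n"
    and data: "level_one_data n (boxes_of_roots n (a_pos n I)) (diag_boxes n \<union> boxes_of_roots n (a_neg n I))
      (boxes_of_roots n (a_pos' n I)) (diag_boxes n \<union> boxes_of_roots n (a_neg' n I))"
  shows "Psi n I = (p, q, p', q') \<longleftrightarrow>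
    boxes_of_roots n (a_pos n I) = pos_boxes n p \<and>
    diag_boxes n \<union> boxes_of_roots n (a_neg n I) = neg_boxes n q \<and>
    boxes_of_roots n (a_pos' n I) = pos_boxes n p' \<and>
    diag_boxes n \<union> boxes_of_roots n (a_neg' n I) = neg_boxes n q'"
proof -
  have up: "up_closed n (boxes_of_roots n (a_pos n I))" "up_closed n (diag_boxes n \<union> boxes_of_roots n (a_neg n I))"
    "up_closed n (boxes_of_roots n (a_pos' n I))" "up_closed n (diag_boxes n \<union> boxes_of_roots n (a_neg' n I))"
    using data unfolding level_one_data_def by - (elim conjE, assumption)+
  show ?thesis
    unfolding Psi_def prod.inject
      dyck_of_pos_iff[OF up(1) dyck_balanced[OF p]] dyck_of_pos_iff[OF up(3) dyck_balanced[OF p']]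
      dyck_of_neg_iff[OF up(2)[unfolded diag_boxes_def] dyck_balanced[OF q]]
      dyck_of_neg_iff[OF up(4)[unfolded diag_boxes_def] dyck_balanced[OF q']] diag_boxes_def ..
qed

theorem theorem27:
  fixes n :: nat and p q p' q' :: "step list"
  assumes "1 < n"
    and "p \<in> dyck_paths n" and "q \<in> dyck_paths n"
    and "p' \<in> dyck_paths n" and "q' \<in> dyck_paths n"
  shows "((\<exists>I. is_ideal_of_b_hat n I \<and> I \<subseteq> n_hat_pos n \<and> has_level n I 1 \<and>
              Psi n I = (p, q, p', q'))
          \<longleftrightarrow> cond_i n p q p' q' \<or> cond_ii n p q p' q' \<or>
              cond_iii n p q p' q' \<or> cond_iv n p q p' q') \<and>
         \<not> (cond_i n p q p' q' \<and> cond_ii n p q p' q') \<and>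
         \<not> (cond_i n p q p' q' \<and> cond_iii n p q p' q') \<and>
         \<not> (cond_i n p q p' q' \<and> cond_iv n p q p' q') \<and>
         \<not> (cond_ii n p q p' q' \<and> cond_iii n p q p' q') \<and>
         \<not> (cond_ii n p q p' q' \<and> cond_iv n p q p' q') \<and>
         \<not> (cond_iii n p q p' q' \<and> cond_iv n p q p' q')"
proof (intro conjI)
  have "(\<exists>I. is_ideal_of_b_hat n I \<and> I \<subseteq> n_hat_pos n \<and> has_level n I 1 \<and> Psi n I = (p, q, p', q'))
      \<longleftrightarrow> level_one_data n (pos_boxes n p) (neg_boxes n q) (pos_boxes n p') (neg_boxes n q')"
  proof
    assume "\<exists>I. is_ideal_of_b_hat n I \<and> I \<subseteq> n_hat_pos n \<and> has_level n I 1 \<and> Psi n I = (p, q, p', q')"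
    then obtain I where I: "is_ideal_of_b_hat n I" "I \<subseteq> n_hat_pos n" "has_level n I 1"
      "Psi n I = (p, q, p', q')" by blast
    note data = level_one_dataI[OF assms(1) I(1-3)]
    show "level_one_data n (pos_boxes n p) (neg_boxes n q) (pos_boxes n p') (neg_boxes n q')"
      using data I(4) unfolding Psi_iff[OF assms data] by simp
  next
    assume data: "level_one_data n (pos_boxes n p) (neg_boxes n q) (pos_boxes n p') (neg_boxes n q')"
    then interpret level_one n "pos_boxes n p" "neg_boxes n q" "pos_boxes n p'" "neg_boxes n q'"
      using assms(1) by unfold_locales
    have "Psi n the_ideal = (p, q, p', q')"
      using the_ideal_boxes data by (subst Psi_iff[OF assms]) simp_all
    then show "\<exists>I. is_ideal_of_b_hat n I \<and> I \<subseteq> n_hat_pos n \<and> has_level n I 1 \<and> Psi n I = (p, q, p', q')"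
      using the_ideal_ideal the_ideal_sub the_ideal_level by blast
  qed
  then show "(\<exists>I. is_ideal_of_b_hat n I \<and> I \<subseteq> n_hat_pos n \<and> has_level n I 1 \<and> Psi n I = (p, q, p', q'))
      \<longleftrightarrow> cond_i n p q p' q' \<or> cond_ii n p q p' q' \<or> cond_iii n p q p' q' \<or> cond_iv n p q p' q'"
    unfolding level_one_data_iff[OF assms] .
qed (auto simp: cond_i_def cond_ii_def cond_iii_def cond_iv_def)

end
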